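(* Let $\Omega=(0,1)$ and consider the linear time-invariant system $$\partial_t x^\alpha(z,t)=A^\alpha_\beta(z)x^\beta(z,t)+A^\alpha_{z,\beta}(z)\partial_zx^\beta(z,t)+A^\alpha_{zz,\beta}(z)\partial_z^2x^\beta(z,t)+B^\alpha(z)u(t),\quad \alpha=1,\dots,n_x,$$ on $\Omega$, with boundary conditions $$G^\lambda_\beta x^\beta(0,t)+G^\lambda_{z,\beta}\partial_zx^\beta(0,t)=0,\ \lambda=1,\dots,n_A,\qquad H^\mu_\beta x^\beta(1,t)+H^\mu_{z,\beta}\partial_zx^\beta(1,t)=0,\ \mu=1,\dots,n_B,$$ and output $y(t)=C_\beta x^\beta(z_0,t)+C_{z,\beta}\partial_zx^\beta(z_0,t)$ at a fixed point $z_0\in\bar\Omega$. Put $f^\alpha=A^\alpha_\beta(z)x^\beta+A^\alpha_{z,\beta}(z)x_z^\beta+A^\alpha_{zz,\beta}(z)x_{zz}^\beta+B^\alpha(z)u$, $g^\lambda=G^\lambda_\beta x^\beta+G^\lambda_{z,\beta}x_z^\beta$, $h^\mu=H^\mu_\beta x^\beta+H^\mu_{z,\beta}x_z^\beta$, $c=C_\beta x^\beta+C_{z,\beta}x_z^\beta$. With the conventions and standing assumptions in the context: The system is not observable if and only if there exists a smooth vector field $v=v_x^\alpha(z,t,x,u)\partial_{x^\alpha}$ on $\mathcal{E}$ with $\partial_uv_x^\alpha|_{t=0}=0$ for all $\alpha$ and $v|_{t=0}\neq0$ that satisfies $L_{j^2(v)}(x_t^\alpha-f^\alpha)=0$ on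 $\mathcal{S}^2$ for all $\alpha$, $L_{j^1(v)}g^\lambda|_{z=0}=0$ on $\mathcal{S}^1_A$ for all $\lambda$, $L_{j^1(v)}h^\mu|_{z=1}=0$ on $\mathcal{S}^1_B$ for all $\mu$, and $L_{j^1(v)}c|_{z=z_0}=0$. Therefore the existence of a symmetry group $\Phi_\varepsilon$ (the flow of such a $v$) that does not change the trajectories of the input and the output is necessary and sufficient for non-observability. Moreover, it is sufficient to consider vector fields of the form $v=v^\alpha(z,t)\partial_{x^\alpha}$. For these, the conditions on the Lie derivatives become $$\partial_tv^\alpha(z,t)=A^\alpha_\beta(z)v^\beta(z,t)+A^\alpha_{z,\beta}(z)\partial_zv^\beta(z,t)+A^\alpha_{zz,\beta}(z)\partial_z^2v^\beta(z,t),$$ $$G^\lambda_\beta v^\beta(0,t)+G^\lambda_{z,\beta}\partial_zv^\beta(0,t)=0,\qquad H^\mu_\beta v^\beta(1,t)+H^\mu_{z,\beta}\partial_zv^\beta(1,t)=0,$$ $$C_\beta v^\beta(z_0,t)+C_{z,\beta}\partial_zv^\beta(z_0,t)=0,$$ i.e. the coefficients $v^\alpha$ must be a (non-trivial) solution of the homogeneous part of the PDEs with the original boundary conditions that generates an output which is identically zero.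
   Context: All functions, vector fields, etc. are assumed smooth, only smooth solutions are considered, and all considerations are only local. $G^\lambda_\beta,G^\lambda_{z,\beta},H^\mu_\beta,H^\mu_{z,\beta},C_\beta,C_{z,\beta}$ are constants. The Einstein summation convention is used; $L_w\varphi$ is the Lie derivative of $\varphi$ along the vector field $w$. $\bar\Omega=[0,1]$, and $\mathbb{R}^+$ is the time axis, starting at $t=0$. $\mathcal{E}$ is a $(3+n_x)$-dimensional manifold with coordinates $(z,t,x,u)$, $x=(x^1,\dots,x^{n_x})$, regarded as a bundle over $\bar\Omega\times\mathbb{R}^+$ via $(z,t,x,u)\mapsto(z,t)$. $J^1(\mathcal{E})$ has coordinates $(z,t,x,u,x_z,x_t,u_z,u_t)$, and $J^2(\mathcal{E})$ has in addition $(x_{zz},x_{zt},x_{tt},u_{zz},u_{zt},u_{tt})$. $\mathcal{S}^2\subset J^2(\mathcal{E})$ is the submanifold given by $x_t^\alpha-f^\alpha=0$ ($\alpha=1,\dots,n_x$), $u_z=u_{zz}=u_{zt}=0$. $\mathcal{B}_A$, $\mathcal{B}_B$ are manifolds with coordinates $(t,x,u,x_z,x_t,u_z,u_t)$ (corresponding to $z=0$ and $z=1$), and $\mathcal{S}^1_A\subset\mathcal{B}_A$, $\mathcal{S}^1_B\subset\mathcal{B}_B$ are the submanifolds given by $g^\lambda=0$ ($\lambda=1,\dots,n_A$) and $h^\mu=0$ ($\mu=1,\dots,n_B$), the Jacobians being assumed to have maximal ranks $n_A$ and $n_B$. Solution: a smooth section $\gamma(z,t)=(z,t,\gamma_x(z,t),\gamma_u(z,t))$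 on $\bar\Omega\times\mathbb{R}^+$ with $\gamma_u$ independent of $z$ that satisfies the PDEs on $\Omega\times\mathbb{R}^+$ and the boundary conditions on $\mathbb{R}^+$. Its input is $\gamma_u$, its initial condition is $\gamma_x(\cdot,0)$, and its output is the corresponding $y(t)$. Total derivatives: $d_z=\partial_z+x_z^\alpha\partial_{x^\alpha}+u_z\partial_u+x_{zz}^\alpha\partial_{x_z^\alpha}+x_{zt}^\alpha\partial_{x_t^\alpha}+u_{zz}\partial_{u_z}+u_{zt}\partial_{u_t}$ and $d_t=\partial_t+x_t^\alpha\partial_{x^\alpha}+u_t\partial_u+x_{zt}^\alpha\partial_{x_z^\alpha}+x_{tt}^\alpha\partial_{x_t^\alpha}+u_{zt}\partial_{u_z}+u_{tt}\partial_{u_t}$, with $d_{zz}=d_z\circ d_z$, $d_{zt}=d_t\circ d_z$, $d_{tt}=d_t\circ d_t$. For $v=v_x^\alpha\partial_{x^\alpha}$: $j^1(v)=v_x^\alpha\partial_{x^\alpha}+d_z(v_x^\alpha)\partial_{x_z^\alpha}+d_t(v_x^\alpha)\partial_{x_t^\alpha}$ and $j^2(v)=j^1(v)+d_{zz}(v_x^\alpha)\partial_{x_{zz}^\alpha}+d_{zt}(v_x^\alpha)\partial_{x_{zt}^\alpha}+d_{tt}(v_x^\alpha)\partial_{x_{tt}^\alpha}$. A symmetry group of the system with its boundary conditions is a local group of transformations on $\mathcal{E}$ that maps solutions to solutions wherever the transformed solution is defined. The groups here are vertical (they leave $(z,t)$ unchanged) 1-parameter groups $\Phi_\varepsilon$,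 i.e. flows, with parameter $\varepsilon$ in some interval containing $0$, of vector fields on $\mathcal{E}$ without components in the $\partial_z,\partial_t$ directions. Standing assumption (well-posedness): solutions of the PDEs with the boundary conditions exist and are uniquely determined by the initial condition $x(\cdot,0)$ and the input function $u(t)$. Observability: a pair of initial conditions is indistinguishable if for every admissible trajectory of the input, the system generates for both initial conditions the same trajectory of the output. The system is observable if (locally) there exists no pair of indistinguishable initial conditions. For the linear systems considered here this notion corresponds to the injectivity of the map assigning to each initial condition the output trajectory of the homogeneous system without input (approximate observability). *)

theory Defs
  imports "HOL-Analysis.Analysis"
begin

section \<open>Smooth maps\<close>

text \<open>\<open>C\<^sup>k\<close> maps on an open set \<open>U\<close>, via directional derivatives of the Frechet derivative.\<close>

primrec Ck_on :: "nat \<Rightarrow> 'a::euclidean_space set \<Rightarrow> ('a \<Rightarrow> 'b::real_normed_vector) \<Rightarrow> bool" where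
  "Ck_on 0 U f \<longleftrightarrow> continuous_on U f"
| "Ck_on (Suc k) U f \<longleftrightarrow> f differentiable_on U \<and>
     (\<forall>d. Ck_on k U (\<lambda>x. frechet_derivative f (at x) d))"

text \<open>On a set that is not open (the base \<open>[0,1] \<times> [0,\<infinity>)\<close> has corners), smooth means: restriction of a
  smooth map on an open neighbourhood.\<close>

definition smooth_on :: "'a::euclidean_space set \<Rightarrow> ('a \<Rightarrow> 'b::real_normed_vector) \<Rightarrow> bool" where
  "smooth_on S f \<longleftrightarrow>
     (\<exists>U g. open U \<and> S \<subseteq> U \<and> (\<forall>k. Ck_on k U g) \<and> (\<forall>x\<in>S. g x = f x))"


section \<open>The system\<close>

text \<open>The state dimension is \<open>CARD('n)\<close>. \<open>G_x S l\<close> and \<open>G_z S l\<close> are the rows of the coefficients of the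
  \<open>l\<close>-th boundary condition, \<open>l < n_A S\<close>; no boundary conditions at one end (\<open>n_A S = 0\<close>) is allowed.\<close>

record ('n::finite) lti_system =
  A_x :: "real \<Rightarrow> real^'n^'n"
  A_z :: "real \<Rightarrow> real^'n^'n"
  A_zz :: "real \<Rightarrow> real^'n^'n"
  B_u :: "real \<Rightarrow> real^'n"
  n_A :: nat
  G_x :: "nat \<Rightarrow> real^'n"
  G_z :: "nat \<Rightarrow> real^'n"
  n_B :: nat
  H_x :: "nat \<Rightarrow> real^'n"
  H_z :: "nat \<Rightarrow> real^'n"
  C_x :: "real^'n"
  C_z :: "real^'n"
  z_out :: real

text \<open>Points \<open>(z, t)\<close> of the base, and points \<open>(z, t, x, u)\<close> of the bundle.\<close>

definition base :: "(real \<times> real) set" where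
  "base = {0..1} \<times> {0..}"

type_synonym 'n etotal = "real \<times> real \<times> (real^'n) \<times> real"

definition E_space :: "('n::finite) etotal set" where
  "E_space = {0..1} \<times> {0..} \<times> UNIV \<times> UNIV"

definition x_of :: "('n::finite) etotal \<Rightarrow> real^'n" where
  "x_of = (\<lambda>(z, t, x, u). x)"

definition u_of :: "('n::finite) etotal \<Rightarrow> real" where
  "u_of = (\<lambda>(z, t, x, u). u)"

text \<open>Partial derivatives on the base, one-sided at its boundary.\<close>

definition ddz :: "(real \<Rightarrow> 'a::real_normed_vector) \<Rightarrow> real \<Rightarrow> 'a" where
  "ddz f z = vector_derivative f (at z within {0..1})"

definition ddt :: "(real \<Rightarrow> 'a::real_normed_vector) \<Rightarrow> real \<Rightarrow> 'a" where
  "ddt f t = vector_derivative f (at t within {0..})"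

definition par_z :: "(real \<times> real \<Rightarrow> 'a::real_normed_vector) \<Rightarrow> real \<times> real \<Rightarrow> 'a" where
  "par_z w = (\<lambda>(z, t). ddz (\<lambda>s. w (s, t)) z)"

definition par_t :: "(real \<times> real \<Rightarrow> 'a::real_normed_vector) \<Rightarrow> real \<times> real \<Rightarrow> 'a" where
  "par_t w = (\<lambda>(z, t). ddt (\<lambda>s. w (z, s)) t)"

text \<open>Solutions are sections \<open>\<gamma>\<close> of the bundle over a relatively open part \<open>D\<close> of the base.\<close>

definition solves_on :: "('n::finite) lti_system \<Rightarrow> (real \<times> real) set \<Rightarrow> (real \<times> real \<Rightarrow> 'n etotal) \<Rightarrow> bool" where
  "solves_on S D \<gamma> \<longleftrightarrow>
     smooth_on D \<gamma> \<and>
     (\<forall>z t. (z, t) \<in> D \<longrightarrow> \<gamma> (z, t) = (z, t, x_of (\<gamma> (z, t)), u_of (\<gamma> (z, t)))) \<and>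
     (\<forall>z z' t. (z, t) \<in> D \<longrightarrow> (z', t) \<in> D \<longrightarrow> u_of (\<gamma> (z, t)) = u_of (\<gamma> (z', t))) \<and>
     (\<forall>z t. (z, t) \<in> D \<longrightarrow> z \<in> {0<..<1} \<longrightarrow>
        par_t (x_of \<circ> \<gamma>) (z, t) =
          A_x S z *v x_of (\<gamma> (z, t)) + A_z S z *v par_z (x_of \<circ> \<gamma>) (z, t)
          + A_zz S z *v par_z (par_z (x_of \<circ> \<gamma>)) (z, t) + u_of (\<gamma> (z, t)) *\<^sub>R B_u S z) \<and>
     (\<forall>t l. (0, t) \<in> D \<longrightarrow> l < n_A S \<longrightarrow>
        G_x S l \<bullet> x_of (\<gamma> (0, t)) + G_z S l \<bullet> par_z (x_of \<circ> \<gamma>) (0, t) = 0) \<and>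
     (\<forall>t m. (1, t) \<in> D \<longrightarrow> m < n_B S \<longrightarrow>
        H_x S m \<bullet> x_of (\<gamma> (1, t)) + H_z S m \<bullet> par_z (x_of \<circ> \<gamma>) (1, t) = 0)"

definition solution :: "('n::finite) lti_system \<Rightarrow> (real \<times> real \<Rightarrow> 'n etotal) \<Rightarrow> bool" where
  "solution S \<gamma> \<longleftrightarrow> solves_on S base \<gamma>"

definition output_of :: "('n::finite) lti_system \<Rightarrow> (real \<times> real \<Rightarrow> 'n etotal) \<Rightarrow> real \<Rightarrow> real" where
  "output_of S \<gamma> t =
     C_x S \<bullet> x_of (\<gamma> (z_out S, t)) + C_z S \<bullet> par_z (x_of \<circ> \<gamma>) (z_out S, t)"

text \<open>\<open>\<gamma>\<close> is a solution with initial condition \<open>x0\<close> and input \<open>u\<close>.\<close>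

definition trajectory ::
  "('n::finite) lti_system \<Rightarrow> (real \<Rightarrow> real^'n) \<Rightarrow> (real \<Rightarrow> real) \<Rightarrow> (real \<times> real \<Rightarrow> 'n etotal) \<Rightarrow> bool" where
  "trajectory S x0 u \<gamma> \<longleftrightarrow>
     solution S \<gamma> \<and> (\<forall>z\<in>{0..1}. x_of (\<gamma> (z, 0)) = x0 z) \<and> (\<forall>(z, t)\<in>base. u_of (\<gamma> (z, t)) = u t)"


section \<open>Well-posedness and observability\<close>

text \<open>The value at \<open>t = 0\<close> of the \<open>k\<close>-th time derivative that the PDEs prescribe for a solution with
  initial condition \<open>x0\<close> and input \<open>u\<close>.\<close>

primrec init_deriv ::
  "('n::finite) lti_system \<Rightarrow> (real \<Rightarrow> real^'n) \<Rightarrow> (real \<Rightarrow> real) \<Rightarrow> nat \<Rightarrow> real \<Rightarrow> real^'n" where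
  "init_deriv S x0 u 0 = x0"
| "init_deriv S x0 u (Suc k) = (\<lambda>z.
     A_x S z *v init_deriv S x0 u k z + A_z S z *v ddz (init_deriv S x0 u k) z
     + A_zz S z *v ddz (ddz (init_deriv S x0 u k)) z + ((ddt ^^ k) u 0) *\<^sub>R B_u S z)"

text \<open>Differentiating the boundary conditions in time at \<open>t = 0\<close> gives the usual compatibility
  conditions, without which no solution that is smooth up to \<open>t = 0\<close> can exist.\<close>

definition compatible :: "('n::finite) lti_system \<Rightarrow> (real \<Rightarrow> real^'n) \<Rightarrow> (real \<Rightarrow> real) \<Rightarrow> bool" where
  "compatible S x0 u \<longleftrightarrow>
     smooth_on {0..1} x0 \<and> smooth_on {0..} u \<and>
     (\<forall>k. \<forall>l<n_A S. G_x S l \<bullet> init_deriv S x0 u k 0 + G_z S l \<bullet> ddz (init_deriv S x0 u k) 0 = 0) \<and>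
     (\<forall>k. \<forall>m<n_B S. H_x S m \<bullet> init_deriv S x0 u k 1 + H_z S m \<bullet> ddz (init_deriv S x0 u k) 1 = 0)"

definition well_posed :: "('n::finite) lti_system \<Rightarrow> bool" where
  "well_posed S \<longleftrightarrow>
     (\<forall>x0 u. compatible S x0 u \<longrightarrow> (\<exists>\<gamma>. trajectory S x0 u \<gamma>)) \<and>
     (\<forall>x0 u \<gamma> \<gamma>'. trajectory S x0 u \<gamma> \<longrightarrow> trajectory S x0 u \<gamma>' \<longrightarrow> (\<forall>p\<in>base. \<gamma> p = \<gamma>' p))"

text \<open>An input is admissible for a pair of initial conditions if both generate a solution with it. The
  first conjunct excludes pairs that would be indistinguishable only for want of such an input.\<close>

definition indistinguishable ::
  "('n::finite) lti_system \<Rightarrow> (real \<Rightarrow> real^'n) \<Rightarrow> (real \<Rightarrow> real^'n) \<Rightarrow> bool" where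
  "indistinguishable S x0 x0' \<longleftrightarrow>
     (\<exists>u \<gamma> \<gamma>'. trajectory S x0 u \<gamma> \<and> trajectory S x0' u \<gamma>') \<and>
     (\<forall>u \<gamma> \<gamma>'. trajectory S x0 u \<gamma> \<longrightarrow> trajectory S x0' u \<gamma>' \<longrightarrow>
        (\<forall>t\<ge>0. output_of S \<gamma> t = output_of S \<gamma>' t))"

definition observable :: "('n::finite) lti_system \<Rightarrow> bool" where
  "observable S \<longleftrightarrow> \<not> (\<exists>x0 x0'. (\<exists>z\<in>{0..1}. x0 z \<noteq> x0' z) \<and> indistinguishable S x0 x0')"


section \<open>Jets, prolongations and Lie derivatives\<close>

text \<open>Points of the jet manifolds are \<open>((z, t, x, u), (x\<^sub>z, x\<^sub>t, u\<^sub>z, u\<^sub>t))\<close> and, with this as first component,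
  \<open>(_, (x\<^sub>z\<^sub>z, x\<^sub>z\<^sub>t, x\<^sub>t\<^sub>t, u\<^sub>z\<^sub>z, u\<^sub>z\<^sub>t, u\<^sub>t\<^sub>t))\<close>. Tangent vectors are written in the same coordinates.\<close>

type_synonym 'n jet1 = "'n etotal \<times> ((real^'n) \<times> (real^'n) \<times> real \<times> real)"
type_synonym 'n jet2 = "'n jet1 \<times> ((real^'n) \<times> (real^'n) \<times> (real^'n) \<times> real \<times> real \<times> real)"

definition J1 :: "('n::finite) jet1 set" where
  "J1 = E_space \<times> UNIV"

definition J2 :: "('n::finite) jet2 set" where
  "J2 = J1 \<times> UNIV"

text \<open>Lie derivative of a function \<open>\<phi>\<close> on the manifold \<open>M\<close> along the vector field \<open>w\<close>. The manifolds
  used here have a boundary (\<open>z = 0\<close>, \<open>z = 1\<close>, \<open>t = 0\<close>), hence the derivative within \<open>M\<close>.\<close>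

definition lie :: "'a::euclidean_space set \<Rightarrow> ('a \<Rightarrow> 'a) \<Rightarrow> ('a \<Rightarrow> 'b::real_normed_vector) \<Rightarrow> 'a \<Rightarrow> 'b" where
  "lie M w \<phi> p = frechet_derivative \<phi> (at p within M) (w p)"

text \<open>Total derivatives \<open>d\<^sub>z\<close>, \<open>d\<^sub>t\<close>, of functions on the bundle (suffix \<open>0\<close>) and on the first jet manifold
  (suffix \<open>1\<close>): the derivative in direction \<open>\<partial>\<^sub>z + x\<^sub>z \<partial>\<^sub>x + u\<^sub>z \<partial>\<^sub>u + \<dots>\<close>, respectively \<open>\<partial>\<^sub>t + x\<^sub>t \<partial>\<^sub>x + u\<^sub>t \<partial>\<^sub>u + \<dots>\<close>.\<close>

definition dz0 :: "(('n::finite) etotal \<Rightarrow> 'b::real_normed_vector) \<Rightarrow> 'n jet1 \<Rightarrow> 'b" where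
  "dz0 \<phi> = (\<lambda>(p, (xz, xt, uz, ut)). frechet_derivative \<phi> (at p within E_space) (1, 0, xz, uz))"

definition dt0 :: "(('n::finite) etotal \<Rightarrow> 'b::real_normed_vector) \<Rightarrow> 'n jet1 \<Rightarrow> 'b" where
  "dt0 \<phi> = (\<lambda>(p, (xz, xt, uz, ut)). frechet_derivative \<phi> (at p within E_space) (0, 1, xt, ut))"

definition dz1 :: "(('n::finite) jet1 \<Rightarrow> 'b::real_normed_vector) \<Rightarrow> 'n jet2 \<Rightarrow> 'b" where
  "dz1 \<phi> = (\<lambda>((p, (xz, xt, uz, ut)), (xzz, xzt, xtt, uzz, uzt, utt)).
     frechet_derivative \<phi> (at (p, (xz, xt, uz, ut)) within J1)
       ((1, 0, xz, uz), (xzz, xzt, uzz, uzt)))"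

definition dt1 :: "(('n::finite) jet1 \<Rightarrow> 'b::real_normed_vector) \<Rightarrow> 'n jet2 \<Rightarrow> 'b" where
  "dt1 \<phi> = (\<lambda>((p, (xz, xt, uz, ut)), (xzz, xzt, xtt, uzz, uzt, utt)).
     frechet_derivative \<phi> (at (p, (xz, xt, uz, ut)) within J1)
       ((0, 1, xt, ut), (xzt, xtt, uzt, utt)))"

text \<open>A vertical vector field \<open>v\<^sup>\<alpha> \<partial>\<^bsub>x\<^sup>\<alpha>\<^esub>\<close> is given by its coefficients \<open>v :: 'n etotal \<Rightarrow> real^'n\<close>.\<close>

definition vert :: "(('n::finite) etotal \<Rightarrow> real^'n) \<Rightarrow> 'n etotal \<Rightarrow> 'n etotal" where
  "vert v = (\<lambda>p. (0, 0, v p, 0))"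

definition prolong1 :: "(('n::finite) etotal \<Rightarrow> real^'n) \<Rightarrow> 'n jet1 \<Rightarrow> 'n jet1" where
  "prolong1 v = (\<lambda>p. (vert v (fst p), (dz0 v p, dt0 v p, 0, 0)))"

definition prolong2 :: "(('n::finite) etotal \<Rightarrow> real^'n) \<Rightarrow> 'n jet2 \<Rightarrow> 'n jet2" where
  "prolong2 v = (\<lambda>p. (prolong1 v (fst p),
     (dz1 (dz0 v) p, dt1 (dz0 v) p, dt1 (dt0 v) p, 0, 0, 0)))"

definition pde_lhs :: "('n::finite) lti_system \<Rightarrow> 'n \<Rightarrow> 'n jet2 \<Rightarrow> real" where
  "pde_lhs S \<alpha> = (\<lambda>(((z, t, x, u), (xz, xt, uz, ut)), (xzz, xzt, xtt, uzz, uzt, utt)).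
     xt $ \<alpha> - (A_x S z *v x + A_z S z *v xz + A_zz S z *v xzz + u *\<^sub>R B_u S z) $ \<alpha>)"

definition g_fun :: "('n::finite) lti_system \<Rightarrow> nat \<Rightarrow> 'n jet1 \<Rightarrow> real" where
  "g_fun S l = (\<lambda>((z, t, x, u), (xz, xt, uz, ut)). G_x S l \<bullet> x + G_z S l \<bullet> xz)"

definition h_fun :: "('n::finite) lti_system \<Rightarrow> nat \<Rightarrow> 'n jet1 \<Rightarrow> real" where
  "h_fun S m = (\<lambda>((z, t, x, u), (xz, xt, uz, ut)). H_x S m \<bullet> x + H_z S m \<bullet> xz)"

definition c_fun :: "('n::finite) lti_system \<Rightarrow> 'n jet1 \<Rightarrow> real" where
  "c_fun S = (\<lambda>((z, t, x, u), (xz, xt, uz, ut)). C_x S \<bullet> x + C_z S \<bullet> xz)"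

definition S2 :: "('n::finite) lti_system \<Rightarrow> 'n jet2 set" where
  "S2 S = {p \<in> J2. (\<forall>\<alpha>. pde_lhs S \<alpha> p = 0) \<and>
     (case p of ((_, (xz, xt, uz, ut)), (xzz, xzt, xtt, uzz, uzt, utt)) \<Rightarrow> uz = 0 \<and> uzz = 0 \<and> uzt = 0)}"

text \<open>The boundary manifolds are identified with the parts \<open>z = 0\<close> and \<open>z = 1\<close> of the first jet manifold.\<close>

definition S1A :: "('n::finite) lti_system \<Rightarrow> 'n jet1 set" where
  "S1A S = {p \<in> J1. fst (fst p) = 0 \<and> (\<forall>l<n_A S. g_fun S l p = 0)}"

definition S1B :: "('n::finite) lti_system \<Rightarrow> 'n jet1 set" where
  "S1B S = {p \<in> J1. fst (fst p) = 1 \<and> (\<forall>m<n_B S. h_fun S m p = 0)}"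

definition lie_conditions :: "('n::finite) lti_system \<Rightarrow> ('n etotal \<Rightarrow> real^'n) \<Rightarrow> bool" where
  "lie_conditions S v \<longleftrightarrow>
     (\<forall>\<alpha>. \<forall>p\<in>S2 S. lie J2 (prolong2 v) (pde_lhs S \<alpha>) p = 0) \<and>
     (\<forall>l<n_A S. \<forall>p\<in>S1A S. lie J1 (prolong1 v) (g_fun S l) p = 0) \<and>
     (\<forall>m<n_B S. \<forall>p\<in>S1B S. lie J1 (prolong1 v) (h_fun S m) p = 0) \<and>
     (\<forall>p\<in>J1. fst (fst p) = z_out S \<longrightarrow> lie J1 (prolong1 v) (c_fun S) p = 0)"

definition starts_nontrivially :: "(('n::finite) etotal \<Rightarrow> real^'n) \<Rightarrow> bool" where
  "starts_nontrivially v \<longleftrightarrow>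
     (\<forall>z\<in>{0..1}. \<forall>x u. vector_derivative (\<lambda>s. v (z, 0, x, s)) (at u) = 0) \<and>
     (\<exists>z\<in>{0..1}. \<exists>x u. v (z, 0, x, u) \<noteq> 0)"

definition base_field :: "(real \<times> real \<Rightarrow> real^'n) \<Rightarrow> ('n::finite) etotal \<Rightarrow> real^'n" where
  "base_field w = (\<lambda>(z, t, x, u). w (z, t))"


section \<open>Symmetry groups\<close>

text \<open>\<open>\<Phi>\<close> is the local flow of \<open>v\<close>. It is defined on \<open>W\<close>, an open neighbourhood of \<open>\<epsilon> = 0\<close>, so that the
  interval of the group parameter may depend on the point of the bundle.\<close>

definition flow_of ::
  "(('n::finite) etotal \<Rightarrow> real^'n) \<Rightarrow> (real \<times> 'n etotal) set \<Rightarrow> (real \<Rightarrow> 'n etotal \<Rightarrow> 'n etotal) \<Rightarrow> bool" where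
  "flow_of v W \<Phi> \<longleftrightarrow>
     openin (top_of_set (UNIV \<times> E_space)) W \<and>
     (\<forall>p\<in>E_space. (0, p) \<in> W \<and> is_interval {\<epsilon>. (\<epsilon>, p) \<in> W} \<and> \<Phi> 0 p = p) \<and>
     smooth_on W (\<lambda>(\<epsilon>, p). \<Phi> \<epsilon> p) \<and>
     (\<forall>(\<epsilon>, p)\<in>W. \<Phi> \<epsilon> p \<in> E_space \<and>
        ((\<lambda>s. \<Phi> s p) has_vector_derivative vert v (\<Phi> \<epsilon> p)) (at \<epsilon>)) \<and>
     (\<forall>\<delta> \<epsilon> p. (\<delta>, p) \<in> W \<longrightarrow> (\<epsilon>, \<Phi> \<delta> p) \<in> W \<longrightarrow> (\<epsilon> + \<delta>, p) \<in> W \<longrightarrow>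
        \<Phi> \<epsilon> (\<Phi> \<delta> p) = \<Phi> (\<epsilon> + \<delta>) p)"

text \<open>A transformed solution need not be defined on the whole base, hence local solutions.\<close>

definition symmetry_group ::
  "('n::finite) lti_system \<Rightarrow> (real \<times> 'n etotal) set \<Rightarrow> (real \<Rightarrow> 'n etotal \<Rightarrow> 'n etotal) \<Rightarrow> bool" where
  "symmetry_group S W \<Phi> \<longleftrightarrow>
     (\<forall>D \<gamma> \<epsilon>. openin (top_of_set base) D \<longrightarrow> solves_on S D \<gamma> \<longrightarrow> (\<forall>q\<in>D. (\<epsilon>, \<gamma> q) \<in> W) \<longrightarrow>
        solves_on S D (\<Phi> \<epsilon> \<circ> \<gamma>))"

definition preserves_io ::
  "('n::finite) lti_system \<Rightarrow> (real \<times> 'n etotal) set \<Rightarrow> (real \<Rightarrow> 'n etotal \<Rightarrow> 'n etotal) \<Rightarrow> bool" where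
  "preserves_io S W \<Phi> \<longleftrightarrow>
     (\<forall>D \<gamma> \<epsilon>. openin (top_of_set base) D \<longrightarrow> solves_on S D \<gamma> \<longrightarrow> (\<forall>q\<in>D. (\<epsilon>, \<gamma> q) \<in> W) \<longrightarrow>
        (\<forall>q\<in>D. u_of (\<Phi> \<epsilon> (\<gamma> q)) = u_of (\<gamma> q)) \<and>
        (\<forall>t. (z_out S, t) \<in> D \<longrightarrow> output_of S (\<Phi> \<epsilon> \<circ> \<gamma>) t = output_of S \<gamma> t))"

end

theory Submission imports Defs begin

text \<open>The whole theorem rests on one correspondence. Let \<open>\<gamma>\<close> be a section and \<open>v\<close> a vertical field, and put
  \<open>w = v \<circ> \<gamma>\<close>. Total derivatives of \<open>v\<close> at the jets of \<open>\<gamma>\<close> are partial derivatives of \<open>w\<close>, so the Lie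
  derivative of the PDE (affine in the jet coordinates) at the jet of \<open>\<gamma>\<close> is the residual of \<open>w\<close> in the
  homogeneous PDE, and similarly for the boundary conditions and the output (\<open>hom_residual_section\<close>,
  \<open>boundary_A_section\<close>, \<open>output_section\<close>). On the other hand, by linearity and uniqueness of solutions,
  the system is not observable iff some nontrivial solution \<open>w\<close> of the homogeneous system without input has
  zero output (\<open>not_observable_iff\<close>); such a \<open>w\<close> is called silent.

  From non-observability to fields: a silent \<open>w\<close> is itself the coefficient of a field on the base, whose
  flow is \<open>x \<mapsto> x + \<epsilon> w\<close> (\<open>lie_conditions_base_field\<close>, \<open>base_field_flow\<close>).

  From fields to non-observability: if \<open>v\<close> satisfies the Lie conditions, then \<open>v \<circ> \<gamma>\<close> is silent for every
  solution \<open>\<gamma>\<close> (\<open>silent_of_lie\<close>). It is nontrivial for a suitable \<open>\<gamma>\<close>: because \<open>v\<close> at time zero does not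
  depend on \<open>u\<close>, it is enough to find a solution with zero input that starts through a given point of the
  state space over some \<open>z\<close> in the open interval, and a bump function there is an initial condition
  compatible with any boundary conditions (\<open>trajectory_through\<close>). If only the flow is known to be a symmetry
  group that preserves input and output, then transformed solutions are solutions near every point of the base for small parameters, and
  differentiating in the parameter at zero shows again that \<open>v \<circ> \<gamma>\<close> is silent
  (\<open>silent_of_symmetry\<close>).

  That the Lie conditions make the flow a symmetry group needs more than differentiation, since they hold
  only on the submanifolds \<open>S2\<close>, \<open>S1A\<close> and \<open>S1B\<close>, and the transformed jet must be shown not to leave them.
  For the PDE the residual satisfies a linear differential equation in the group parameter
  (\<open>flow_solves_pde\<close>); for the boundary conditions the pair \<open>(x, x\<^sub>z)\<close> follows a smooth vector field that
  is tangent to the subspace of admissible values (\<open>invariant_subspace\<close>). Both end in Gronwall's inequality.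
  Interchanging the group parameter with derivatives on the base needs the symmetry of second derivatives
  (\<open>family_derivative_par\<close>).\<close>

section \<open>Calculus of smooth maps\<close>

lemma Ck_on_continuous: "Ck_on k U f \<Longrightarrow> continuous_on U f"
  by (cases k) (auto intro: differentiable_imp_continuous_on)

lemma Ck_on_SucD: "Ck_on (Suc k) U f \<Longrightarrow> Ck_on k U f"
proof (induction k arbitrary: f)
  case 0
  then show ?case by (simp add: differentiable_imp_continuous_on)
next
  case (Suc k)
  have "f differentiable_on U" "\<And>d. Ck_on (Suc k) U (\<lambda>x. frechet_derivative f (at x) d)"
    using Suc.prems unfolding Ck_on.simps(2)[of "Suc k"] by blast+
  then show ?case
    unfolding Ck_on.simps(2)[of k U f] using Suc.IH by blast
qed

lemma Ck_on_subset:
  assumes "Ck_on k U f" "V \<subseteq> U"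
  shows "Ck_on k V f"
  using assms(1)
proof (induction k arbitrary: f)
  case 0
  then show ?case using assms(2) continuous_on_subset by simp
next
  case (Suc k)
  then show ?case using assms(2) differentiable_on_subset by (metis Ck_on.simps(2))
qed

lemma Ck_on_cong:
  assumes "Ck_on k U f" "open U" "\<And>x. x \<in> U \<Longrightarrow> f x = g x"
  shows "Ck_on k U g"
  using assms(1,3)
proof (induction k arbitrary: f g)
  case 0
  then show ?case by (simp cong: continuous_on_cong)
next
  case (Suc k)
  have d: "f differentiable at x" if "x \<in> U" for x
    using Suc.prems(1) that by (simp add: differentiable_on_eq_differentiable_at[OF assms(2)])
  have eq: "frechet_derivative f (at x) = frechet_derivative g (at x)" if "x \<in> U" for x
    by (rule frechet_derivative_transform_within_open[OF d[OF that] \<open>open U\<close> that Suc.prems(2)])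
  have "g differentiable_on U"
    unfolding differentiable_on_eq_differentiable_at[OF assms(2)]
  proof
    fix x assume "x \<in> U"
    then obtain D where "(f has_derivative D) (at x)" using d unfolding differentiable_def by blast
    then have "(g has_derivative D) (at x)"
      by (rule has_derivative_transform_within_open[OF _ assms(2) \<open>x \<in> U\<close> Suc.prems(2)])
    then show "g differentiable at x" unfolding differentiable_def by blast
  qed
  moreover have "Ck_on k U (\<lambda>x. frechet_derivative g (at x) d)" for d
    by (rule Suc.IH[of "\<lambda>x. frechet_derivative f (at x) d"]) (use Suc.prems(1) in \<open>simp_all add: eq\<close>)
  ultimately show ?case by simp
qed

lemma Ck_on_SucI:
  assumes "open U" "\<And>x. x \<in> U \<Longrightarrow> (f has_derivative f' x) (at x)" "\<And>d. Ck_on k U (\<lambda>x. f' x d)"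
  shows "Ck_on (Suc k) U f"
proof -
  have eq: "f' x = frechet_derivative f (at x)" if "x \<in> U" for x
    by (rule frechet_derivative_at[OF assms(2)[OF that]])
  have "f differentiable_on U"
    using assms(1,2) unfolding differentiable_def differentiable_on_eq_differentiable_at[OF assms(1)] by blast
  moreover have "Ck_on k U (\<lambda>x. frechet_derivative f (at x) d)" for d
    by (rule Ck_on_cong[OF assms(3)[of d] assms(1)]) (simp add: eq)
  ultimately show ?thesis by simp
qed

lemma Ck_on_SucE:
  assumes "Ck_on (Suc k) U f" "open U"
  obtains f' where "\<And>x. x \<in> U \<Longrightarrow> (f has_derivative f' x) (at x)" "\<And>d. Ck_on k U (\<lambda>x. f' x d)"
proof
  show "(f has_derivative frechet_derivative f (at x)) (at x)" if "x \<in> U" for x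
    using assms that differentiable_on_eq_differentiable_at[OF assms(2), of f]
    by (simp add: frechet_derivative_works)
  show "Ck_on k U (\<lambda>x. frechet_derivative f (at x) d)" for d
    using assms(1) by simp
qed

lemma Ck_on_const: "Ck_on k U (\<lambda>x. c)"
  by (induction k arbitrary: c) auto

lemma Ck_on_bounded_linear_compose:
  assumes "bounded_linear h" "open U" "Ck_on k U f"
  shows "Ck_on k U (\<lambda>x. h (f x))"
  using assms(3)
proof (induction k arbitrary: f)
  case 0
  then show ?case using bounded_linear.continuous_on[OF assms(1)] by auto
next
  case (Suc k)
  obtain f' where f': "\<And>x. x \<in> U \<Longrightarrow> (f has_derivative f' x) (at x)" "\<And>d. Ck_on k U (\<lambda>x. f' x d)"
    using Ck_on_SucE[OF Suc.prems assms(2)] by metis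
  show ?case
  proof (rule Ck_on_SucI[where f' = "\<lambda>x d. h (f' x d)"])
    show "((\<lambda>x. h (f x)) has_derivative (\<lambda>d. h (f' x d))) (at x)" if "x \<in> U" for x
      by (rule bounded_linear.has_derivative[OF assms(1) f'(1)[OF that]])
    show "Ck_on k U (\<lambda>x. h (f' x d))" for d
      by (rule Suc.IH[OF f'(2)])
  qed fact
qed

lemma Ck_on_add:
  assumes "open U" "Ck_on k U f" "Ck_on k U g"
  shows "Ck_on k U (\<lambda>x. f x + g x)"
  using assms(2,3)
proof (induction k arbitrary: f g)
  case 0
  then show ?case by (simp add: continuous_on_add)
next
  case (Suc k)
  obtain f' where f': "\<And>x. x \<in> U \<Longrightarrow> (f has_derivative f' x) (at x)" "\<And>d. Ck_on k U (\<lambda>x. f' x d)"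
    using Ck_on_SucE[OF Suc.prems(1) assms(1)] by metis
  obtain g' where g': "\<And>x. x \<in> U \<Longrightarrow> (g has_derivative g' x) (at x)" "\<And>d. Ck_on k U (\<lambda>x. g' x d)"
    using Ck_on_SucE[OF Suc.prems(2) assms(1)] by metis
  show ?case
  proof (rule Ck_on_SucI[where f' = "\<lambda>x d. f' x d + g' x d"])
    show "((\<lambda>x. f x + g x) has_derivative (\<lambda>d. f' x d + g' x d)) (at x)" if "x \<in> U" for x
      by (rule has_derivative_add[OF f'(1)[OF that] g'(1)[OF that]])
    show "Ck_on k U (\<lambda>x. f' x d + g' x d)" for d
      by (rule Suc.IH[OF f'(2) g'(2)])
  qed fact
qed

lemma Ck_on_sum:
  assumes "open U" "\<And>i. i \<in> I \<Longrightarrow> Ck_on k U (f i)"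
  shows "Ck_on k U (\<lambda>x. \<Sum>i\<in>I. f i x)"
  using assms(2)
  by (induction I rule: infinite_finite_induct) (auto intro: Ck_on_const Ck_on_add[OF assms(1)])

lemma Ck_on_bilinear:
  assumes "bounded_bilinear h" "open U" "Ck_on k U f" "Ck_on k U g"
  shows "Ck_on k U (\<lambda>x. h (f x) (g x))"
  using assms(3,4)
proof (induction k arbitrary: f g)
  case 0
  then show ?case using bounded_bilinear.continuous_on[OF assms(1)] by auto
next
  case (Suc k)
  obtain f' where f': "\<And>x. x \<in> U \<Longrightarrow> (f has_derivative f' x) (at x)" "\<And>d. Ck_on k U (\<lambda>x. f' x d)"
    using Ck_on_SucE[OF Suc.prems(1) assms(2)] by metis
  obtain g' where g': "\<And>x. x \<in> U \<Longrightarrow> (g has_derivative g' x) (at x)" "\<And>d. Ck_on k U (\<lambda>x. g' x d)"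
    using Ck_on_SucE[OF Suc.prems(2) assms(2)] by metis
  show ?case
  proof (rule Ck_on_SucI[where f' = "\<lambda>x d. h (f x) (g' x d) + h (f' x d) (g x)"])
    show "((\<lambda>x. h (f x) (g x)) has_derivative (\<lambda>d. h (f x) (g' x d) + h (f' x d) (g x))) (at x)"
      if "x \<in> U" for x
      using bounded_bilinear.FDERIV[OF assms(1)] f' g' that by blast
    show "Ck_on k U (\<lambda>x. h (f x) (g' x d) + h (f' x d) (g x))" for d
      by (intro Ck_on_add assms Suc.IH f' g' Ck_on_SucD[OF Suc.prems(1)] Ck_on_SucD[OF Suc.prems(2)])
  qed fact
qed

text \<open>The chain rule expresses a directional derivative of \<open>f \<circ> g\<close> through the finitely many partial
  derivatives of \<open>f\<close>, which is the shape that the recursive definition of \<open>C\<^sup>k\<close> can absorb.\<close>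

lemma Ck_on_compose:
  fixes g :: "'a::euclidean_space \<Rightarrow> 'b::euclidean_space"
  assumes "open U" "open V" "Ck_on k V f" "Ck_on k U g" "g ` U \<subseteq> V"
  shows "Ck_on k U (\<lambda>x. f (g x))"
  using assms(3,4)
proof (induction k arbitrary: f)
  case 0
  then show ?case using continuous_on_compose2[of V f U g] assms(5) by simp
next
  case (Suc k)
  obtain f' where f': "\<And>x. x \<in> V \<Longrightarrow> (f has_derivative f' x) (at x)" "\<And>d. Ck_on k V (\<lambda>x. f' x d)"
    using Ck_on_SucE[OF Suc.prems(1) assms(2)] by metis
  obtain g' where g': "\<And>x. x \<in> U \<Longrightarrow> (g has_derivative g' x) (at x)" "\<And>d. Ck_on k U (\<lambda>x. g' x d)"
    using Ck_on_SucE[OF Suc.prems(2) assms(1)] by metis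
  have exp: "f' (g x) (g' x d) = (\<Sum>b\<in>Basis. (g' x d \<bullet> b) *\<^sub>R f' (g x) b)" if "x \<in> U" for x d
  proof -
    have "linear (f' (g x))"
      using f'(1) assms(5) that by (meson has_derivative_linear image_subset_iff)
    then have "f' (g x) (\<Sum>b\<in>Basis. (g' x d \<bullet> b) *\<^sub>R b) = (\<Sum>b\<in>Basis. (g' x d \<bullet> b) *\<^sub>R f' (g x) b)"
      by (simp add: linear_sum linear_cmul)
    then show ?thesis by (simp only: euclidean_representation)
  qed
  show ?case
  proof (rule Ck_on_SucI[where f' = "\<lambda>x d. \<Sum>b\<in>Basis. (g' x d \<bullet> b) *\<^sub>R f' (g x) b"])
    show "((\<lambda>x. f (g x)) has_derivative (\<lambda>d. \<Sum>b\<in>Basis. (g' x d \<bullet> b) *\<^sub>R f' (g x) b)) (at x)"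
      if "x \<in> U" for x
      using has_derivative_compose[OF g'(1)[OF that] f'(1)] that assms(5) exp[OF that] by auto
    show "Ck_on k U (\<lambda>x. \<Sum>b\<in>Basis. (g' x d \<bullet> b) *\<^sub>R f' (g x) b)" for d
      by (intro Ck_on_sum Ck_on_bilinear[OF bounded_bilinear_scaleR] Suc.IH assms f' Ck_on_SucD[OF Suc.prems(2)]
          Ck_on_bounded_linear_compose[OF bounded_linear_inner_left] g')
  qed fact
qed

lemma Ck_on_linear:
  assumes "bounded_linear h" "open U"
  shows "Ck_on k U h"
proof (cases k)
  case 0
  then show ?thesis using assms linear_continuous_on by auto
next
  case (Suc k')
  show ?thesis unfolding Suc
  proof (rule Ck_on_SucI[where f' = "\<lambda>_. h"])
    show "(h has_derivative h) (at x)" for x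
      by (rule bounded_linear_imp_has_derivative[OF assms(1)])
  qed (use assms(2) Ck_on_const in auto)
qed

text \<open>A second difference over a parallelogram equals a mixed derivative at some point of it, by the mean value
  theorem in each direction. Exchanging the directions leaves the second difference unchanged, which is the
  reason for the symmetry of second derivatives.\<close>

lemma second_difference:
  fixes f :: "'a::real_normed_vector \<Rightarrow> real"
  assumes h: "h > 0"
    and f': "\<And>a b. a \<in> {0..h} \<Longrightarrow> b \<in> {0..h} \<Longrightarrow>
          (f has_derivative f' (x + a *\<^sub>R d + b *\<^sub>R e)) (at (x + a *\<^sub>R d + b *\<^sub>R e))"
    and f'': "\<And>a b. a \<in> {0..h} \<Longrightarrow> b \<in> {0..h} \<Longrightarrow>
          ((\<lambda>y. f' y d) has_derivative f'' (x + a *\<^sub>R d + b *\<^sub>R e)) (at (x + a *\<^sub>R d + b *\<^sub>R e))"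
  obtains a b where "a \<in> {0..h}" "b \<in> {0..h}"
    "f (x + h *\<^sub>R d + h *\<^sub>R e) - f (x + h *\<^sub>R d) - f (x + h *\<^sub>R e) + f x
       = h * h * f'' (x + a *\<^sub>R d + b *\<^sub>R e) e"
proof -
  define p where "p a = f (x + a *\<^sub>R d + h *\<^sub>R e) - f (x + a *\<^sub>R d + 0 *\<^sub>R e)" for a
  define p' where "p' a = f' (x + a *\<^sub>R d + h *\<^sub>R e) d - f' (x + a *\<^sub>R d + 0 *\<^sub>R e) d" for a
  have "(p has_real_derivative p' a) (at a)" if "0 \<le> a" "a \<le> h" for a
  proof -
    have l: "((\<lambda>a. x + a *\<^sub>R d + b *\<^sub>R e) has_derivative (\<lambda>k. k *\<^sub>R d)) (at a)" for b
      by (auto intro!: derivative_eq_intros)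
    have b: "((\<lambda>a. f (x + a *\<^sub>R d + b *\<^sub>R e)) has_derivative (\<lambda>k. f' (x + a *\<^sub>R d + b *\<^sub>R e) (k *\<^sub>R d))) (at a)"
      if "b \<in> {0..h}" for b
      using has_derivative_compose[OF l f'] that \<open>0 \<le> a\<close> \<open>a \<le> h\<close> by auto
    have lin: "f' (x + a *\<^sub>R d + b *\<^sub>R e) (k *\<^sub>R d) = k * f' (x + a *\<^sub>R d + b *\<^sub>R e) d"
      if "b \<in> {0..h}" for b k
      using has_derivative_linear[OF f'[of a b]] that \<open>0 \<le> a\<close> \<open>a \<le> h\<close> by (simp add: linear_cmul)
    have "(p has_derivative (\<lambda>k. k * p' a)) (at a)"
      using has_derivative_diff[OF b[of h] b[of 0]] lin[of h] lin[of 0] h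
      unfolding p_def p'_def by (simp add: algebra_simps)
    then show ?thesis
      by (simp add: has_field_derivative_def mult.commute[of _ "p' a"])
  qed
  then obtain a where a: "0 < a" "a < h" "p h - p 0 = h * p' a"
    using MVT2[OF h, of p p'] by auto
  define q where "q b = f' (x + a *\<^sub>R d + b *\<^sub>R e) d" for b
  define q' where "q' b = f'' (x + a *\<^sub>R d + b *\<^sub>R e) e" for b
  have "(q has_real_derivative q' b) (at b)" if "0 \<le> b" "b \<le> h" for b
  proof -
    have l: "((\<lambda>b. x + a *\<^sub>R d + b *\<^sub>R e) has_derivative (\<lambda>k. k *\<^sub>R e)) (at b)"
      by (auto intro!: derivative_eq_intros)
    have "(q has_derivative (\<lambda>k. f'' (x + a *\<^sub>R d + b *\<^sub>R e) (k *\<^sub>R e))) (at b)"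
      unfolding q_def using has_derivative_compose[OF l f''] that a by auto
    moreover have "f'' (x + a *\<^sub>R d + b *\<^sub>R e) (k *\<^sub>R e) = k * q' b" for k
      unfolding q'_def using has_derivative_linear[OF f''[of a b]] that a by (simp add: linear_cmul)
    ultimately show ?thesis
      by (simp add: has_field_derivative_def mult.commute[of _ "q' b"])
  qed
  then obtain b where b: "0 < b" "b < h" "q h - q 0 = h * q' b"
    using MVT2[OF h, of q q'] by auto
  have "p h - p 0 = h * h * q' b"
    using a b unfolding p'_def q_def by (simp add: algebra_simps)
  then show thesis
    using that[of a b] a b unfolding p_def q'_def by (simp add: algebra_simps)
qed

lemma second_derivative_symmetric:
  fixes f :: "'a::euclidean_space \<Rightarrow> real"
  assumes U: "open U" "x \<in> U"
    and f': "\<And>y. y \<in> U \<Longrightarrow> (f has_derivative f' y) (at y)"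
    and f'': "\<And>y d. y \<in> U \<Longrightarrow> ((\<lambda>y. f' y d) has_derivative f'' d y) (at y)"
    and cont: "\<And>d e. continuous_on U (\<lambda>y. f'' d y e)"
  shows "f'' d x e = f'' e x d"
proof -
  obtain r where r: "r > 0" "ball x r \<subseteq> U" using U open_contains_ball by blast
  define N where "N = norm d + norm e + 1"
  have N: "N > 0" unfolding N_def by (smt (verit) norm_ge_zero)
  have near: "dist x (x + a *\<^sub>R d' + b *\<^sub>R e') < h * N"
    if "a \<in> {0..h}" "b \<in> {0..h}" "h > 0" "norm d' + norm e' + 1 = N" for a b h d' e'
  proof -
    have "dist x (x + a *\<^sub>R d' + b *\<^sub>R e') = norm (a *\<^sub>R d' + b *\<^sub>R e')"
      by (metis (no_types, lifting) add.assoc add_diff_cancel_left' dist_commute dist_norm)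
    also have "\<dots> \<le> a * norm d' + b * norm e'"
      using that norm_triangle_ineq[of "a *\<^sub>R d'" "b *\<^sub>R e'"] by simp
    also have "\<dots> \<le> h * norm d' + h * norm e'"
      using that by (intro add_mono mult_right_mono) auto
    also have "\<dots> < h * N" using that by (auto simp: algebra_simps)
    finally show ?thesis .
  qed
  show ?thesis
  proof (rule ccontr)
    assume ne: "f'' d x e \<noteq> f'' e x d"
    define \<epsilon> where "\<epsilon> = \<bar>f'' d x e - f'' e x d\<bar> / 2"
    have \<epsilon>: "\<epsilon> > 0" using ne by (simp add: \<epsilon>_def)
    have "\<exists>\<delta>>0. \<forall>y\<in>U. dist y x < \<delta> \<longrightarrow> \<bar>f'' d' y e' - f'' d' x e'\<bar> < \<epsilon>" for d' e'
      using cont[of d' e'] U(2) \<epsilon> unfolding continuous_on_iff dist_real_def by blast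
    from this[of d e] this[of e d] obtain \<delta>1 \<delta>2 where \<delta>: "\<delta>1 > 0" "\<delta>2 > 0"
      "\<And>y. y \<in> U \<Longrightarrow> dist y x < \<delta>1 \<Longrightarrow> \<bar>f'' d y e - f'' d x e\<bar> < \<epsilon>"
      "\<And>y. y \<in> U \<Longrightarrow> dist y x < \<delta>2 \<Longrightarrow> \<bar>f'' e y d - f'' e x d\<bar> < \<epsilon>"
      by blast
    define h where "h = min r (min \<delta>1 \<delta>2) / N"
    have h: "h > 0" "h * N \<le> r" "h * N \<le> \<delta>1" "h * N \<le> \<delta>2"
      using \<delta>(1,2) r(1) N by (simp_all add: h_def)
    have close: "dist (x + a *\<^sub>R d' + b *\<^sub>R e') x < s"
      if "a \<in> {0..h}" "b \<in> {0..h}" "norm d' + norm e' + 1 = N" "h * N \<le> s" for a b d' e' s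
      using less_le_trans[OF near[OF that(1,2) h(1) that(3)] that(4)] by (simp add: dist_commute)
    have Nd: "norm d + norm e + 1 = N" and Ne: "norm e + norm d + 1 = N"
      by (simp_all add: N_def)
    have inU: "x + a *\<^sub>R d' + b *\<^sub>R e' \<in> U"
      if "a \<in> {0..h}" "b \<in> {0..h}" "norm d' + norm e' + 1 = N" for a b d' e'
      using close[OF that h(2)] r(2) by (auto simp: dist_commute)
    obtain a b where ab: "a \<in> {0..h}" "b \<in> {0..h}"
      "f (x + h *\<^sub>R d + h *\<^sub>R e) - f (x + h *\<^sub>R d) - f (x + h *\<^sub>R e) + f x
         = h * h * f'' d (x + a *\<^sub>R d + b *\<^sub>R e) e"
      by (rule second_difference[OF h(1), of f f' x d e "f'' d"]) (rule f' f'' inU Nd | assumption)+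
    obtain a' b' where ab': "a' \<in> {0..h}" "b' \<in> {0..h}"
      "f (x + h *\<^sub>R e + h *\<^sub>R d) - f (x + h *\<^sub>R e) - f (x + h *\<^sub>R d) + f x
         = h * h * f'' e (x + a' *\<^sub>R e + b' *\<^sub>R d) d"
      by (rule second_difference[OF h(1), of f f' x e d "f'' e"]) (rule f' f'' inU Ne | assumption)+
    have "h * h * f'' d (x + a *\<^sub>R d + b *\<^sub>R e) e = h * h * f'' e (x + a' *\<^sub>R e + b' *\<^sub>R d) d"
      unfolding ab(3)[symmetric] ab'(3)[symmetric] by (simp add: add_ac)
    then have eq: "f'' d (x + a *\<^sub>R d + b *\<^sub>R e) e = f'' e (x + a' *\<^sub>R e + b' *\<^sub>R d) d"
      using h(1) by simp
    have "\<bar>f'' d (x + a *\<^sub>R d + b *\<^sub>R e) e - f'' d x e\<bar> < \<epsilon>"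
      by (rule \<delta>(3)[OF inU[OF ab(1,2) Nd] close[OF ab(1,2) Nd h(3)]])
    moreover have "\<bar>f'' e (x + a' *\<^sub>R e + b' *\<^sub>R d) d - f'' e x d\<bar> < \<epsilon>"
      by (rule \<delta>(4)[OF inU[OF ab'(1,2) Ne] close[OF ab'(1,2) Ne h(4)]])
    ultimately have "\<bar>f'' d x e - f'' e x d\<bar> < \<epsilon> + \<epsilon>" using eq by linarith
    then show False by (simp add: \<epsilon>_def)
  qed
qed

lemma smooth_onI:
  assumes "open U" "S \<subseteq> U" "\<And>k. Ck_on k U g" "\<And>x. x \<in> S \<Longrightarrow> g x = f x"
  shows "smooth_on S f"
  using assms unfolding smooth_on_def by blast

lemma smooth_onE:
  assumes "smooth_on S f"
  obtains U g where "open U" "S \<subseteq> U" "\<And>k. Ck_on k U g" "\<And>x. x \<in> S \<Longrightarrow> g x = f x"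
  using assms unfolding smooth_on_def by blast

lemma smooth_on_subset: "smooth_on S f \<Longrightarrow> T \<subseteq> S \<Longrightarrow> smooth_on T f"
  unfolding smooth_on_def by (meson subset_iff)

lemma smooth_on_cong: "smooth_on S f \<Longrightarrow> (\<And>x. x \<in> S \<Longrightarrow> f x = g x) \<Longrightarrow> smooth_on S g"
  unfolding smooth_on_def by metis

lemma smooth_on_continuous:
  assumes "smooth_on S f" shows "continuous_on S f"
proof -
  obtain U g where U: "open U" "S \<subseteq> U" "\<And>k. Ck_on k U g" "\<And>x. x \<in> S \<Longrightarrow> g x = f x"
    using smooth_onE[OF assms] by metis
  have "continuous_on S g"
    using Ck_on_continuous[OF U(3)] U(2) continuous_on_subset by blast
  then show ?thesis
    using U(4) by (simp cong: continuous_on_cong)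
qed

lemma smooth_on_const: "smooth_on S (\<lambda>x. c)"
  by (rule smooth_onI[of UNIV]) (auto intro: Ck_on_const)

lemma smooth_on_linear: "bounded_linear h \<Longrightarrow> smooth_on S h"
  by (rule smooth_onI[of UNIV]) (auto intro: Ck_on_linear)

lemma smooth_on_bilinear:
  assumes h: "bounded_bilinear h" and "smooth_on S f" "smooth_on S g"
  shows "smooth_on S (\<lambda>x. h (f x) (g x))"
proof -
  obtain U F where U: "open U" "S \<subseteq> U" "\<And>k. Ck_on k U F" "\<And>x. x \<in> S \<Longrightarrow> F x = f x"
    using smooth_onE[OF assms(2)] by metis
  obtain V G where V: "open V" "S \<subseteq> V" "\<And>k. Ck_on k V G" "\<And>x. x \<in> S \<Longrightarrow> G x = g x"
    using smooth_onE[OF assms(3)] by metis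
  have UV: "open (U \<inter> V)" using U V by blast
  show ?thesis
  proof (rule smooth_onI[OF UV])
    show "Ck_on k (U \<inter> V) (\<lambda>x. h (F x) (G x))" for k
      by (rule Ck_on_bilinear[OF h UV Ck_on_subset[OF U(3)] Ck_on_subset[OF V(3)]]) auto
  qed (use U V in auto)
qed

lemma smooth_on_compose:
  fixes g :: "'a::euclidean_space \<Rightarrow> 'b::euclidean_space"
  assumes "smooth_on T f" "smooth_on S g" "\<And>x. x \<in> S \<Longrightarrow> g x \<in> T"
  shows "smooth_on S (\<lambda>x. f (g x))"
proof -
  obtain V F where V: "open V" "T \<subseteq> V" "\<And>k. Ck_on k V F" "\<And>x. x \<in> T \<Longrightarrow> F x = f x"
    using smooth_onE[OF assms(1)] by metis
  obtain U G where U: "open U" "S \<subseteq> U" "\<And>k. Ck_on k U G" "\<And>x. x \<in> S \<Longrightarrow> G x = g x"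
    using smooth_onE[OF assms(2)] by metis
  have o: "open (U \<inter> G -` V)"
    using continuous_open_preimage[OF Ck_on_continuous[OF U(3)] U(1) V(1)] .
  show ?thesis
  proof (rule smooth_onI[OF o])
    show "Ck_on k (U \<inter> G -` V) (\<lambda>x. F (G x))" for k
      by (rule Ck_on_compose[OF o V(1) V(3) Ck_on_subset[OF U(3)]]) auto
    show "S \<subseteq> U \<inter> G -` V"
    proof
      fix x assume "x \<in> S"
      then show "x \<in> U \<inter> G -` V" using U(2) U(4)[of x] V(2) assms(3)[of x] by auto
    qed
    show "F (G x) = f (g x)" if "x \<in> S" for x
      using that U(4) V(4) assms(3) by metis
  qed
qed

lemma smooth_on_linear_compose:
  assumes "bounded_linear h" "smooth_on S f"
  shows "smooth_on S (\<lambda>x. h (f x))"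
proof -
  obtain U F where U: "open U" "S \<subseteq> U" "\<And>k. Ck_on k U F" "\<And>x. x \<in> S \<Longrightarrow> F x = f x"
    using smooth_onE[OF assms(2)] by metis
  show ?thesis
    by (rule smooth_onI[OF U(1,2) Ck_on_bounded_linear_compose[OF assms(1) U(1) U(3)]]) (simp add: U(4))
qed

lemma smooth_on_add:
  assumes "smooth_on S f" "smooth_on S g"
  shows "smooth_on S (\<lambda>x. f x + g x)"
proof -
  obtain U F where U: "open U" "S \<subseteq> U" "\<And>k. Ck_on k U F" "\<And>x. x \<in> S \<Longrightarrow> F x = f x"
    using smooth_onE[OF assms(1)] by metis
  obtain V G where V: "open V" "S \<subseteq> V" "\<And>k. Ck_on k V G" "\<And>x. x \<in> S \<Longrightarrow> G x = g x"
    using smooth_onE[OF assms(2)] by metis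
  have UV: "open (U \<inter> V)" using U V by blast
  show ?thesis
  proof (rule smooth_onI[OF UV])
    show "Ck_on k (U \<inter> V) (\<lambda>x. F x + G x)" for k
      by (rule Ck_on_add[OF UV Ck_on_subset[OF U(3)] Ck_on_subset[OF V(3)]]) auto
  qed (use U V in auto)
qed

lemma smooth_on_diff:
  assumes "smooth_on S f" "smooth_on S g"
  shows "smooth_on S (\<lambda>x. f x - g x)"
  using smooth_on_add[OF assms(1) smooth_on_linear_compose[OF bounded_linear_minus[OF bounded_linear_ident] assms(2)]]
  by simp

lemma smooth_on_sum:
  assumes "\<And>i. i \<in> I \<Longrightarrow> smooth_on S (f i)"
  shows "smooth_on S (\<lambda>x. \<Sum>i\<in>I. f i x)"
  using assms
  by (induction I rule: infinite_finite_induct) (simp_all add: smooth_on_const smooth_on_add)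

lemma smooth_on_Pair:
  assumes "smooth_on S f" "smooth_on S g"
  shows "smooth_on S (\<lambda>x. (f x, g x))"
proof -
  have "bounded_linear (\<lambda>a. (a, 0))" "bounded_linear (\<lambda>b. (0, b))"
    by (auto intro: bounded_linear_Pair bounded_linear_ident bounded_linear_zero)
  then show ?thesis
    using smooth_on_add[OF smooth_on_linear_compose smooth_on_linear_compose, OF _ assms(1) _ assms(2)]
    by fastforce
qed

lemma smooth_on_fst: "smooth_on S f \<Longrightarrow> smooth_on S (\<lambda>x. fst (f x))"
  by (rule smooth_on_linear_compose[OF bounded_linear_fst])

lemma smooth_on_snd: "smooth_on S f \<Longrightarrow> smooth_on S (\<lambda>x. snd (f x))"
  by (rule smooth_on_linear_compose[OF bounded_linear_snd])

lemma smooth_on_ident: "smooth_on S (\<lambda>x. x)"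
  by (rule smooth_on_linear[OF bounded_linear_ident])

lemmas smooth_on_intros = smooth_on_const smooth_on_add smooth_on_diff smooth_on_Pair smooth_on_fst smooth_on_snd
  smooth_on_ident smooth_on_bilinear[OF bounded_bilinear_scaleR]

text \<open>All later arguments on sets with boundary use derivatives only in this form, which hides the open
  extension: they exist within the set, are again smooth there, and commute, because those of the
  extension do.\<close>

lemma smooth_on_derivatives:
  fixes f :: "'a::euclidean_space \<Rightarrow> 'b::real_inner"
  assumes "smooth_on S f"
  obtains f' f'' where
    "\<And>x. x \<in> S \<Longrightarrow> (f has_derivative f' x) (at x within S)"
    "\<And>d. smooth_on S (\<lambda>x. f' x d)"
    "\<And>x d. x \<in> S \<Longrightarrow> ((\<lambda>x. f' x d) has_derivative f'' d x) (at x within S)"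
    "\<And>x d e. x \<in> S \<Longrightarrow> f'' d x e = f'' e x d"
proof -
  obtain U g where U: "open U" "S \<subseteq> U" "\<And>k. Ck_on k U g" "\<And>x. x \<in> S \<Longrightarrow> g x = f x"
    using smooth_onE[OF assms] by metis
  define f' where "f' x = frechet_derivative g (at x)" for x
  define f'' where "f'' d x = frechet_derivative (\<lambda>y. f' y d) (at x)" for d x
  have ck: "Ck_on k U (\<lambda>x. f' x d)" for k d
    using U(3)[of "Suc k"] unfolding f'_def by simp
  have ck2: "Ck_on k U (\<lambda>x. f'' d x e)" for k d e
    using ck[of "Suc k" d] unfolding f''_def by simp
  have d1: "(g has_derivative f' x) (at x)" if "x \<in> U" for x
    using U(3)[of 1] that differentiable_on_eq_differentiable_at[OF U(1), of g]
    by (simp add: f'_def frechet_derivative_works)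
  have d2: "((\<lambda>x. f' x d) has_derivative f'' d x) (at x)" if "x \<in> U" for x d
    using ck[of 1 d] that differentiable_on_eq_differentiable_at[OF U(1), of "\<lambda>x. f' x d"]
    by (simp add: f''_def frechet_derivative_works)
  show thesis
  proof (rule that)
    show "(f has_derivative f' x) (at x within S)" if "x \<in> S" for x
      by (rule has_derivative_transform[OF that _ has_derivative_at_withinI[OF d1]])
        (use that U in auto)
    show "smooth_on S (\<lambda>x. f' x d)" for d
      by (rule smooth_onI[OF U(1,2) ck]) simp
    show "((\<lambda>x. f' x d) has_derivative f'' d x) (at x within S)" if "x \<in> S" for x d
      using d2[of x d] that U(2) has_derivative_at_withinI by blast
    show "f'' d x e = f'' e x d" if "x \<in> S" for x d e
    proof -
      have "c \<bullet> f'' d x e = c \<bullet> f'' e x d" for c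
      proof (rule second_derivative_symmetric[where f = "\<lambda>x. c \<bullet> g x" and f' = "\<lambda>x d. c \<bullet> f' x d"
            and f'' = "\<lambda>d x e. c \<bullet> f'' d x e", OF U(1)])
        show "x \<in> U" using that U(2) by auto
        show "((\<lambda>x. c \<bullet> g x) has_derivative (\<lambda>d. c \<bullet> f' y d)) (at y)" if "y \<in> U" for y
          by (rule has_derivative_inner_right[OF d1[OF that]])
        show "((\<lambda>x. c \<bullet> f' x d) has_derivative (\<lambda>e. c \<bullet> f'' d y e)) (at y)" if "y \<in> U" for y d
          by (rule has_derivative_inner_right[OF d2[OF that]])
        show "continuous_on U (\<lambda>y. c \<bullet> f'' d y e)" for d e
          by (rule continuous_on_inner[OF continuous_on_const Ck_on_continuous[OF ck2]])
      qed
      then show ?thesis using vector_eq_ldot by blast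
    qed
  qed
qed

lemma smooth_on_derivative_apply:
  fixes f' :: "'a::euclidean_space \<Rightarrow> 'b::euclidean_space \<Rightarrow> 'c::real_normed_vector"
  assumes "\<And>x. x \<in> S \<Longrightarrow> linear (f' x)" "\<And>d. smooth_on S (\<lambda>x. f' x d)" "smooth_on S c"
  shows "smooth_on S (\<lambda>x. f' x (c x))"
proof (rule smooth_on_cong)
  show "smooth_on S (\<lambda>x. \<Sum>b\<in>Basis. (c x \<bullet> b) *\<^sub>R f' x b)"
    by (intro smooth_on_sum smooth_on_bilinear[OF bounded_bilinear_scaleR] assms(2)
        smooth_on_linear_compose[OF bounded_linear_inner_left] assms(3))
  show "(\<Sum>b\<in>Basis. (c x \<bullet> b) *\<^sub>R f' x b) = f' x (c x)" if "x \<in> S" for x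
  proof -
    have "f' x (\<Sum>b\<in>Basis. (c x \<bullet> b) *\<^sub>R b) = (\<Sum>b\<in>Basis. (c x \<bullet> b) *\<^sub>R f' x b)"
      using assms(1)[OF that] by (simp add: linear_sum linear_cmul)
    then show ?thesis by (simp only: euclidean_representation)
  qed
qed

section \<open>Derivatives on sets with boundary\<close>

text \<open>The condition, in every coordinate direction, under which derivatives within a set are unique. It passes
  to products, hence holds for the bundle and its jet manifolds despite their corners.\<close>

definition fat :: "'a::euclidean_space set \<Rightarrow> bool" where
  "fat S \<longleftrightarrow> (\<forall>x\<in>S. \<forall>b\<in>Basis. \<forall>e>0. \<exists>d. 0 < \<bar>d\<bar> \<and> \<bar>d\<bar> < e \<and> x + d *\<^sub>R b \<in> S)"

lemma frechet_derivative_fat: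
  assumes "fat S" "x \<in> S" "(f has_derivative f') (at x within S)"
  shows "frechet_derivative f (at x within S) = f'"
proof (rule frechet_derivative_unique_within)
  show "(f has_derivative frechet_derivative f (at x within S)) (at x within S)"
    using assms(3) frechet_derivative_works differentiable_def by blast
  show "\<exists>d. 0 < \<bar>d\<bar> \<and> \<bar>d\<bar> < e \<and> x + d *\<^sub>R b \<in> S" if "b \<in> Basis" "e > 0" for b e
    using assms(1,2) that unfolding fat_def by blast
qed fact

lemma fat_UNIV: "fat UNIV"
proof -
  have "\<exists>d::real. 0 < \<bar>d\<bar> \<and> \<bar>d\<bar> < e" if "e > 0" for e
    using that by (intro exI[of _ "e/2"]) auto
  then show ?thesis by (simp add: fat_def)
qed

lemma fat_Times:
  assumes "fat A" "fat B" shows "fat (A \<times> B)"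
  using assms unfolding fat_def by (fastforce simp: Basis_prod_def)

lemma fat_Icc: "fat {0..1::real}"
proof -
  have "\<exists>d. 0 < \<bar>d\<bar> \<and> \<bar>d\<bar> < e \<and> 0 \<le> x + d \<and> x + d \<le> 1" if "e > 0" "0 \<le> x" "x \<le> 1" for x e :: real
  proof (cases "x \<le> 1/2")
    case True
    then show ?thesis using that by (intro exI[of _ "min (e/2) (1/2)"]) auto
  next
    case False
    then show ?thesis using that by (intro exI[of _ "- min (e/2) (1/2)"]) auto
  qed
  then show ?thesis by (simp add: fat_def)
qed

lemma fat_atLeast: "fat {0::real..}"
proof -
  have "\<exists>d. 0 < \<bar>d\<bar> \<and> \<bar>d\<bar> < e \<and> 0 \<le> x + d" if "e > 0" "0 \<le> x" for x e :: real
    using that by (intro exI[of _ "e/2"]) auto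
  then show ?thesis by (simp add: fat_def)
qed

lemma fat_jets:
  "fat (E_space :: ('n::finite) etotal set)" "fat (J1 :: 'n jet1 set)" "fat (J2 :: 'n jet2 set)"
  unfolding J2_def J1_def E_space_def by (intro fat_Times fat_UNIV fat_Icc fat_atLeast)+

text \<open>The chain rule along a curve in a set that is only relatively open in \<open>Z\<close>; it turns derivatives within
  parts of the base into the one-sided partial derivatives.\<close>

lemma has_vector_derivative_along:
  assumes X: "(X has_derivative X') (at (c r) within T)"
    and T: "openin (top_of_set Z) T" "c r \<in> T"
    and c: "\<And>r. r \<in> I \<Longrightarrow> c r \<in> Z" "(c has_vector_derivative e) (at r within I)" "r \<in> I" "continuous_on I c"
  shows "((\<lambda>r. X (c r)) has_vector_derivative X' e) (at r within I)"
proof -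
  have "openin (top_of_set I) (I \<inter> c -` T)"
    using continuous_openin_preimage[OF c(4) _ T(1)] c(1) by auto
  then obtain N where N: "open N" "I \<inter> c -` T = I \<inter> N"
    by (auto simp: openin_open)
  have at: "at r within I = at r within (I \<inter> c -` T)"
    by (rule at_within_nhd[of _ N]) (use N c T in auto)
  have "(c has_derivative (\<lambda>h. h *\<^sub>R e)) (at r within (I \<inter> c -` T))"
    using c(2) at by (simp add: has_vector_derivative_def)
  then have "((\<lambda>r. X (c r)) has_derivative (\<lambda>h. X' (h *\<^sub>R e))) (at r within (I \<inter> c -` T))"
    using X by (rule has_derivative_in_compose[OF _ has_derivative_subset]) auto
  moreover have "X' (h *\<^sub>R e) = h *\<^sub>R X' e" for h
    using has_derivative_linear[OF X] by (rule linear_cmul)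
  ultimately show ?thesis by (simp add: at has_vector_derivative_def)
qed

lemma ddz_eq: "z \<in> {0..1} \<Longrightarrow> (f has_vector_derivative d) (at z within {0..1}) \<Longrightarrow> ddz f z = d"
  unfolding ddz_def by (rule vector_derivative_within) (simp_all add: trivial_limit_within islimpt_Icc)

lemma ddt_eq:
  assumes "t \<ge> 0" "(f has_vector_derivative d) (at t within {0..})" shows "ddt f t = d"
proof -
  have "t islimpt {t..t+1}" by (simp add: islimpt_Icc)
  then have "t islimpt {0..}" by (rule islimpt_subset) (use assms in auto)
  then show ?thesis unfolding ddt_def using assms(2)
    by (intro vector_derivative_within) (simp_all add: trivial_limit_within)
qed

section \<open>Families of maps on the base\<close>

lemma par_family:
  fixes X :: "real \<times> real \<times> real \<Rightarrow> 'b::real_normed_vector"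
  assumes T: "openin (top_of_set (UNIV \<times> base)) T" "(s, z, t) \<in> T"
    and X: "(X has_derivative X') (at (s, z, t) within T)"
  shows "par_z (\<lambda>q. X (s, q)) (z, t) = X' (0, 1, 0)"
    "par_t (\<lambda>q. X (s, q)) (z, t) = X' (0, 0, 1)"
    "((\<lambda>s. X (s, z, t)) has_vector_derivative X' (1, 0, 0)) (at s)"
proof -
  have zt: "z \<in> {0..1}" "t \<in> {0..}"
    using T openin_subset by (force simp: base_def)+
  have "((\<lambda>r. X (s, r, t)) has_vector_derivative X' (0, 1, 0)) (at z within {0..1})"
    by (rule has_vector_derivative_along[where c = "\<lambda>r. (s, r, t)", OF X T])
      (use zt in \<open>auto simp: base_def intro!: derivative_eq_intros continuous_intros
          has_vector_derivative_Pair\<close>)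
  then show "par_z (\<lambda>q. X (s, q)) (z, t) = X' (0, 1, 0)"
    using zt by (simp add: par_z_def ddz_eq)
  have "((\<lambda>r. X (s, z, r)) has_vector_derivative X' (0, 0, 1)) (at t within {0..})"
    by (rule has_vector_derivative_along[where c = "\<lambda>r. (s, z, r)", OF X T])
      (use zt in \<open>auto simp: base_def intro!: derivative_eq_intros continuous_intros
          has_vector_derivative_Pair\<close>)
  then show "par_t (\<lambda>q. X (s, q)) (z, t) = X' (0, 0, 1)"
    using zt by (simp add: par_t_def ddt_eq)
  show "((\<lambda>s. X (s, z, t)) has_vector_derivative X' (1, 0, 0)) (at s)"
    by (rule has_vector_derivative_along[where c = "\<lambda>s. (s, z, t)", OF X T])
      (use zt in \<open>auto simp: base_def zero_prod_def intro!: derivative_eq_intros continuous_intros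
          has_vector_derivative_Pair\<close>)
qed

lemma openin_UNIV_Times: "openin (top_of_set Z) D \<Longrightarrow> openin (top_of_set (UNIV \<times> Z)) (UNIV \<times> D)"
  by (rule openin_Times) simp_all

lemma par_base:
  assumes D: "openin (top_of_set base) D" "(z, t) \<in> D"
    and w: "(w has_derivative w') (at (z, t) within D)"
  shows "par_z w (z, t) = w' (1, 0)" "par_t w (z, t) = w' (0, 1)"
proof -
  have T: "openin (top_of_set (UNIV \<times> base)) ((UNIV :: real set) \<times> D)" "(0, z, t) \<in> UNIV \<times> D"
    using D openin_UNIV_Times by auto
  have "((\<lambda>p. w (snd p)) has_derivative (\<lambda>p. w' (snd p))) (at (0::real, z, t) within UNIV \<times> D)"
    by (rule has_derivative_in_compose[OF has_derivative_snd[OF has_derivative_ident]])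
      (use w has_derivative_subset[of w w' "(z, t)" D] in auto)
  from par_family[OF T this] show "par_z w (z, t) = w' (1, 0)" "par_t w (z, t) = w' (0, 1)"
    by auto
qed

lemma par_z_cong:
  assumes "openin (top_of_set base) D" "smooth_on D (w :: real \<times> real \<Rightarrow> 'b::real_inner)"
    "\<And>q. q \<in> D \<Longrightarrow> w q = w' q" "q \<in> D"
  shows "par_z w q = par_z w' q" "par_t w q = par_t w' q"
proof -
  obtain z t where q: "q = (z, t)" by fastforce
  obtain f' where f': "(w has_derivative f' q) (at q within D)"
    using smooth_on_derivatives[OF assms(2)] assms(4) by metis
  have "(w' has_derivative f' q) (at q within D)"
    by (rule has_derivative_transform[OF assms(4) _ f']) (simp add: assms(3))
  then show "par_z w q = par_z w' q" "par_t w q = par_t w' q"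
    using par_base[OF assms(1)] f' assms(4) q by metis+
qed

lemma smooth_on_par:
  fixes w :: "real \<times> real \<Rightarrow> 'b::real_inner"
  assumes D: "openin (top_of_set base) D" and "smooth_on D w"
  shows "smooth_on D (par_z w)" "smooth_on D (par_t w)"
proof -
  obtain f' where f': "\<And>x. x \<in> D \<Longrightarrow> (w has_derivative f' x) (at x within D)"
    "\<And>d. smooth_on D (\<lambda>x. f' x d)"
    using smooth_on_derivatives[OF assms(2)] by metis
  show "smooth_on D (par_z w)" "smooth_on D (par_t w)"
    using par_base[OF D _ f'(1)]
    by (auto intro: smooth_on_cong[OF f'(2)[of "(1, 0)"]] smooth_on_cong[OF f'(2)[of "(0, 1)"]])
qed

lemma smooth_on_par_z_family:
  fixes X :: "real \<times> real \<times> real \<Rightarrow> 'b::real_inner"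
  assumes T: "openin (top_of_set (UNIV \<times> base)) T" and "smooth_on T X"
  shows "smooth_on T (\<lambda>(s, q). par_z (\<lambda>q. X (s, q)) q)"
proof -
  obtain f' where f': "\<And>x. x \<in> T \<Longrightarrow> (X has_derivative f' x) (at x within T)"
    "\<And>d. smooth_on T (\<lambda>x. f' x d)"
    using smooth_on_derivatives[OF assms(2)] by metis
  show ?thesis
    using par_family(1)[OF T _ f'(1)] by (auto intro: smooth_on_cong[OF f'(2)[of "(0, 1, 0)"]])
qed

text \<open>At boundary points of the base the partial derivatives are one-sided; they still commute with the
  parameter derivative because all of them are derivatives of one smooth map on \<open>T\<close>.\<close>

lemma family_derivative_par:
  fixes X :: "real \<times> real \<times> real \<Rightarrow> 'b::real_inner"
  assumes T: "openin (top_of_set (UNIV \<times> base)) T" and X: "smooth_on T X"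
    and Y: "\<And>s q. (s, q) \<in> T \<Longrightarrow> ((\<lambda>s. X (s, q)) has_vector_derivative Y (s, q)) (at s)"
    and sq: "(s, q) \<in> T"
  shows "((\<lambda>s. par_z (\<lambda>q. X (s, q)) q) has_vector_derivative par_z (\<lambda>q. Y (s, q)) q) (at s)"
    "((\<lambda>s. par_t (\<lambda>q. X (s, q)) q) has_vector_derivative par_t (\<lambda>q. Y (s, q)) q) (at s)"
proof -
  obtain z t where q: "q = (z, t)" by fastforce
  obtain f' f'' where f': "\<And>x. x \<in> T \<Longrightarrow> (X has_derivative f' x) (at x within T)"
    and f'': "\<And>x d. x \<in> T \<Longrightarrow> ((\<lambda>x. f' x d) has_derivative f'' d x) (at x within T)"
    and sym: "\<And>x d e. x \<in> T \<Longrightarrow> f'' d x e = f'' e x d"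
    using smooth_on_derivatives[OF X] by metis
  have Y': "Y p = f' p (1, 0, 0)" if "p \<in> T" for p
  proof -
    obtain a b c where p: "p = (a, b, c)" by (cases p) auto
    show ?thesis
      using par_family(3)[OF T that[unfolded p] f'[OF that, unfolded p]] Y[of a "(b, c)"] that
      by (metis p vector_derivative_at)
  qed
  have Y'': "(Y has_derivative f'' (1, 0, 0) (s, z, t)) (at (s, z, t) within T)"
    by (rule has_derivative_transform[OF _ Y' f'']) (use sq q in auto)
  have T': "(s, z, t) \<in> T" using sq q by simp
  have op: "open {s. (s, z, t) \<in> T}"
  proof -
    have "openin (top_of_set UNIV) (UNIV \<inter> (\<lambda>s. (s, z, t)) -` T)"
      by (rule continuous_openin_preimage[OF _ _ T])
        (use T' T openin_subset in \<open>fastforce intro!: continuous_intros\<close>)+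
    then show ?thesis by (simp add: vimage_def)
  qed
  have "((\<lambda>s. par_z (\<lambda>q. X (s, q)) q) has_vector_derivative f'' (0, 1, 0) (s, z, t) (1, 0, 0)) (at s)"
    by (rule has_vector_derivative_transform_within_open[OF par_family(3)[OF T T' f''[OF T']] op])
      (use T' q par_family(1)[OF T _ f'] in auto)
  then show "((\<lambda>s. par_z (\<lambda>q. X (s, q)) q) has_vector_derivative par_z (\<lambda>q. Y (s, q)) q) (at s)"
    using par_family(1)[OF T T' Y''] sym[OF T'] q by simp
  have "((\<lambda>s. par_t (\<lambda>q. X (s, q)) q) has_vector_derivative f'' (0, 0, 1) (s, z, t) (1, 0, 0)) (at s)"
    by (rule has_vector_derivative_transform_within_open[OF par_family(3)[OF T T' f''[OF T']] op])
      (use T' q par_family(2)[OF T _ f'] in auto)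
  then show "((\<lambda>s. par_t (\<lambda>q. X (s, q)) q) has_vector_derivative par_t (\<lambda>q. Y (s, q)) q) (at s)"
    using par_family(2)[OF T T' Y''] sym[OF T'] q by simp
qed

section \<open>Total derivatives along sections\<close>

lemma bounded_bilinear_matrix_vector: "bounded_bilinear ((*v) :: real^'n^'m \<Rightarrow> real^'n \<Rightarrow> real^'m)"
proof -
  have "linear (\<lambda>A :: real^'n^'m. A *v x)" for x
    by (rule linearI) (simp_all add: matrix_vector_mult_add_rdistrib scaleR_matrix_vector_assoc)
  moreover have "linear ((*v) A)" for A :: "real^'n^'m"
    by (rule linearI) (simp_all add: matrix_vector_right_distrib matrix_vector_mult_scaleR)
  ultimately show ?thesis
    by (simp add: bilinear_def flip: bilinear_conv_bounded_bilinear)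
qed

definition section_on :: "(real \<times> real) set \<Rightarrow> (real \<times> real \<Rightarrow> ('n::finite) etotal) \<Rightarrow> bool" where
  "section_on D \<gamma> \<longleftrightarrow> openin (top_of_set base) D \<and> smooth_on D \<gamma> \<and>
     (\<forall>z t. (z, t) \<in> D \<longrightarrow> \<gamma> (z, t) = (z, t, x_of (\<gamma> (z, t)), u_of (\<gamma> (z, t))))"

lemma x_of_eq: "x_of p = fst (snd (snd p))" and u_of_eq: "u_of p = snd (snd (snd p))"
  by (auto simp: x_of_def u_of_def split: prod.splits)

lemma bounded_linear_x_of: "bounded_linear (x_of :: ('n::finite) etotal \<Rightarrow> real^'n)"
  unfolding x_of_eq[abs_def]
  by (intro bounded_linear_compose[OF bounded_linear_fst] bounded_linear_compose[OF bounded_linear_snd]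
      bounded_linear_snd)

lemma bounded_linear_u_of: "bounded_linear (u_of :: ('n::finite) etotal \<Rightarrow> real)"
  unfolding u_of_eq[abs_def]
  by (intro bounded_linear_compose[OF bounded_linear_snd] bounded_linear_snd)

lemma E_space_iff: "p \<in> E_space \<longleftrightarrow> fst p \<in> {0..1} \<and> fst (snd p) \<ge> 0"
  by (auto simp: E_space_def mem_Times_iff)

lemma section_onD:
  assumes "section_on D \<gamma>"
  shows "openin (top_of_set base) D" "smooth_on D \<gamma>" "D \<subseteq> base"
    "q \<in> D \<Longrightarrow> \<gamma> q = (fst q, snd q, x_of (\<gamma> q), u_of (\<gamma> q))"
    "q \<in> D \<Longrightarrow> \<gamma> q \<in> E_space"
proof -
  show o: "openin (top_of_set base) D" and "smooth_on D \<gamma>" and D: "D \<subseteq> base"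
    using assms openin_subset unfolding section_on_def by fastforce+
  show eq: "\<gamma> q = (fst q, snd q, x_of (\<gamma> q), u_of (\<gamma> q))" if "q \<in> D" for q
    using assms that unfolding section_on_def by (metis prod.collapse)
  show "\<gamma> q \<in> E_space" if "q \<in> D"
  proof -
    have "fst (\<gamma> q) = fst q" "fst (snd (\<gamma> q)) = snd q"
      using arg_cong[OF eq[OF that], of fst] arg_cong[OF eq[OF that], of "\<lambda>p. fst (snd p)"] by simp_all
    then show ?thesis using D that by (auto simp: E_space_iff base_def)
  qed
qed

lemma section_smooth:
  assumes "section_on D \<gamma>"
  shows "smooth_on D (x_of \<circ> \<gamma>)" "smooth_on D (u_of \<circ> \<gamma>)"
  unfolding comp_def
  using smooth_on_linear_compose[OF bounded_linear_x_of section_onD(2)[OF assms]]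
    smooth_on_linear_compose[OF bounded_linear_u_of section_onD(2)[OF assms]] .

lemma section_derivative:
  assumes \<gamma>: "section_on D \<gamma>" and q: "q \<in> D" and \<gamma>': "(\<gamma> has_derivative \<gamma>') (at q within D)"
  shows "\<gamma>' (1, 0) = (1, 0, par_z (x_of \<circ> \<gamma>) q, par_z (u_of \<circ> \<gamma>) q)"
    "\<gamma>' (0, 1) = (0, 1, par_t (x_of \<circ> \<gamma>) q, par_t (u_of \<circ> \<gamma>) q)"
proof -
  obtain z t where zt: "q = (z, t)" by fastforce
  note D = section_onD(1)[OF \<gamma>] q[unfolded zt]
  have e: "par_z (\<lambda>q. h (\<gamma> q)) q = h (\<gamma>' (1, 0))" "par_t (\<lambda>q. h (\<gamma> q)) q = h (\<gamma>' (0, 1))"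
    if "bounded_linear h" for h :: "_ \<Rightarrow> 'c::real_normed_vector"
    using par_base[OF D bounded_linear.has_derivative[OF that \<gamma>'[unfolded zt]]] by (simp_all add: zt)
  have c: "par_z (\<lambda>q. fst (\<gamma> q)) q = 1" "par_t (\<lambda>q. fst (\<gamma> q)) q = 0"
    "par_z (\<lambda>q. fst (snd (\<gamma> q))) q = 0" "par_t (\<lambda>q. fst (snd (\<gamma> q))) q = 1"
  proof -
    have f: "fst q = fst (\<gamma> q)" "snd q = fst (snd (\<gamma> q))" if "q \<in> D" for q
      using arg_cong[OF section_onD(4)[OF \<gamma> that], of fst]
        arg_cong[OF section_onD(4)[OF \<gamma> that], of "\<lambda>p. fst (snd p)"] by simp_all
    have "par_z fst q = (1::real)" "par_t fst q = (0::real)" "par_z snd q = (0::real)" "par_t snd q = (1::real)"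
      using par_base[OF D has_derivative_fst[OF has_derivative_ident]]
        par_base[OF D has_derivative_snd[OF has_derivative_ident]] by (simp_all add: zt)
    moreover have "par_z fst q = par_z (\<lambda>q. fst (\<gamma> q)) q" "par_t fst q = par_t (\<lambda>q. fst (\<gamma> q)) q"
      by (rule par_z_cong[OF D(1) smooth_on_linear[OF bounded_linear_fst] f(1) q]; assumption)+
    moreover have "par_z snd q = par_z (\<lambda>q. fst (snd (\<gamma> q))) q" "par_t snd q = par_t (\<lambda>q. fst (snd (\<gamma> q))) q"
      by (rule par_z_cong[OF D(1) smooth_on_linear[OF bounded_linear_snd] f(2) q]; assumption)+
    ultimately show "par_z (\<lambda>q. fst (\<gamma> q)) q = 1" "par_t (\<lambda>q. fst (\<gamma> q)) q = 0"
      "par_z (\<lambda>q. fst (snd (\<gamma> q))) q = 0" "par_t (\<lambda>q. fst (snd (\<gamma> q))) q = 1" by simp_all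
  qed
  have fs: "bounded_linear (\<lambda>p :: 'a etotal. fst (snd p))"
    by (rule bounded_linear_compose[OF bounded_linear_fst bounded_linear_snd])
  show "\<gamma>' (1, 0) = (1, 0, par_z (x_of \<circ> \<gamma>) q, par_z (u_of \<circ> \<gamma>) q)"
    "\<gamma>' (0, 1) = (0, 1, par_t (x_of \<circ> \<gamma>) q, par_t (u_of \<circ> \<gamma>) q)"
    using e[OF bounded_linear_fst] e[OF fs] e[OF bounded_linear_x_of] e[OF bounded_linear_u_of] c
    unfolding comp_def by (auto simp: prod_eq_iff x_of_eq u_of_eq)
qed

lemma total_derivatives:
  fixes v :: "('n::finite) etotal \<Rightarrow> real^'n"
  assumes v: "smooth_on E_space v"
  obtains v' where "\<And>p. p \<in> E_space \<Longrightarrow> (v has_derivative v' p) (at p within E_space)"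
    "\<And>d. smooth_on E_space (\<lambda>p. v' p d)"
    "\<And>p xz xt uz ut. p \<in> E_space \<Longrightarrow> dz0 v (p, (xz, xt, uz, ut)) = v' p (1, 0, xz, uz)"
    "\<And>p xz xt uz ut. p \<in> E_space \<Longrightarrow> dt0 v (p, (xz, xt, uz, ut)) = v' p (0, 1, xt, ut)"
proof -
  obtain v' where v': "\<And>p. p \<in> E_space \<Longrightarrow> (v has_derivative v' p) (at p within E_space)"
    "\<And>d. smooth_on E_space (\<lambda>p. v' p d)"
    using smooth_on_derivatives[OF v] by metis
  show thesis
    using frechet_derivative_fat[OF fat_jets(1) _ v'(1)]
    by (intro that[of v'] v') (auto simp: dz0_def dt0_def)
qed

lemma smooth_on_dz0:
  fixes v :: "('n::finite) etotal \<Rightarrow> real^'n"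
  assumes "smooth_on E_space v"
  shows "smooth_on J1 (dz0 v)"
proof -
  obtain v' where v': "\<And>p. p \<in> E_space \<Longrightarrow> (v has_derivative v' p) (at p within E_space)"
    "\<And>d. smooth_on E_space (\<lambda>p. v' p d)"
    "\<And>p xz xt uz ut. p \<in> E_space \<Longrightarrow> dz0 v (p, (xz, xt, uz, ut)) = v' p (1, 0, xz, uz)"
    by (rule total_derivatives[OF assms]) blast
  let ?c = "\<lambda>j :: 'n jet1. (1::real, 0::real, fst (snd j), fst (snd (snd (snd j))))"
  have "smooth_on J1 (\<lambda>j. v' (fst j) (?c j))"
  proof (rule smooth_on_derivative_apply[where f' = "\<lambda>j. v' (fst j)" and c = ?c])
    show "linear (v' (fst j))" if "j \<in> J1" for j :: "'n jet1"
      by (rule has_derivative_linear[OF v'(1)]) (use that in \<open>simp add: J1_def mem_Times_iff\<close>)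
    show "smooth_on J1 (\<lambda>j :: 'n jet1. v' (fst j) d)" for d
      by (rule smooth_on_compose[OF v'(2) smooth_on_fst[OF smooth_on_ident]]) (auto simp: J1_def)
    show "smooth_on J1 ?c" by (intro smooth_on_intros)
  qed
  then show ?thesis
  proof (rule smooth_on_cong)
    fix j :: "'n jet1" assume j: "j \<in> J1"
    obtain p xz xt uz ut where "j = (p, (xz, xt, uz, ut))" by (cases j) auto
    with j show "v' (fst j) (?c j) = dz0 v j" using v'(3)[of p] by (simp add: J1_def)
  qed
qed

text \<open>By the chain rule, since the \<open>z\<close>-derivative of a section has the components \<open>1\<close>, \<open>0\<close>, \<open>x\<^sub>z\<close>, \<open>u\<^sub>z\<close>, and
  correspondingly for \<open>t\<close>. The coordinates that do not enter a total derivative stay free, so that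
  jets other than those of the section can be inserted.\<close>

lemma
  fixes v :: "('n::finite) etotal \<Rightarrow> real^'n"
  assumes \<gamma>: "section_on D \<gamma>" and q: "q \<in> D" and v: "smooth_on E_space v"
  shows dz0_section: "dz0 v (\<gamma> q, (par_z (x_of \<circ> \<gamma>) q, a, par_z (u_of \<circ> \<gamma>) q, b)) = par_z (v \<circ> \<gamma>) q"
    and dt0_section: "dt0 v (\<gamma> q, (a, par_t (x_of \<circ> \<gamma>) q, b, par_t (u_of \<circ> \<gamma>) q)) = par_t (v \<circ> \<gamma>) q"
proof -
  obtain v' where v': "\<And>p. p \<in> E_space \<Longrightarrow> (v has_derivative v' p) (at p within E_space)"
    "\<And>p xz xt uz ut. p \<in> E_space \<Longrightarrow> dz0 v (p, (xz, xt, uz, ut)) = v' p (1, 0, xz, uz)"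
    "\<And>p xz xt uz ut. p \<in> E_space \<Longrightarrow> dt0 v (p, (xz, xt, uz, ut)) = v' p (0, 1, xt, ut)"
    by (rule total_derivatives[OF v]) blast
  obtain \<gamma>' where \<gamma>': "(\<gamma> has_derivative \<gamma>') (at q within D)"
    using smooth_on_derivatives[OF section_onD(2)[OF \<gamma>]] q by metis
  have "((\<lambda>q. v (\<gamma> q)) has_derivative (\<lambda>d. v' (\<gamma> q) (\<gamma>' d))) (at q within D)"
    by (rule has_derivative_in_compose2[OF v'(1) _ q \<gamma>']) (use section_onD(5)[OF \<gamma>] in auto)
  from par_base[OF section_onD(1)[OF \<gamma>], of "fst q" "snd q", unfolded prod.collapse, OF q this]
  have "par_z (v \<circ> \<gamma>) q = v' (\<gamma> q) (\<gamma>' (1, 0))" "par_t (v \<circ> \<gamma>) q = v' (\<gamma> q) (\<gamma>' (0, 1))"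
    by (simp_all add: comp_def)
  then show "dz0 v (\<gamma> q, (par_z (x_of \<circ> \<gamma>) q, a, par_z (u_of \<circ> \<gamma>) q, b)) = par_z (v \<circ> \<gamma>) q"
    "dt0 v (\<gamma> q, (a, par_t (x_of \<circ> \<gamma>) q, b, par_t (u_of \<circ> \<gamma>) q)) = par_t (v \<circ> \<gamma>) q"
    unfolding v'(2,3)[OF section_onD(5)[OF \<gamma> q]] section_derivative[OF \<gamma> q \<gamma>'] by (simp_all only:)
qed

text \<open>Since \<open>dz0 v\<close> along the jet is \<open>par_z (v \<circ> \<gamma>)\<close>, one more derivative along the jet gives the second
  total derivative. The \<open>x\<^sub>t\<close> and \<open>u\<^sub>t\<close> slots are left arbitrary, both in the jet and in the direction:
  \<open>dz0 v\<close> is constant in them. This freedom is what later allows jets to be moved in \<open>x\<^sub>t\<close> onto the PDE.\<close>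

lemma dz1_dz0_section:
  fixes v :: "('n::finite) etotal \<Rightarrow> real^'n"
  assumes \<gamma>: "section_on D \<gamma>" and q: "q \<in> D" and v: "smooth_on E_space v"
  shows "dz1 (dz0 v) ((\<gamma> q, (par_z (x_of \<circ> \<gamma>) q, a, par_z (u_of \<circ> \<gamma>) q, b)),
      (par_z (par_z (x_of \<circ> \<gamma>)) q, c, a', par_z (par_z (u_of \<circ> \<gamma>)) q, d, b')) = par_z (par_z (v \<circ> \<gamma>)) q"
proof -
  note D = section_onD(1)[OF \<gamma>]
  define j where "j = (\<lambda>q. (\<gamma> q, (par_z (x_of \<circ> \<gamma>) q, a, par_z (u_of \<circ> \<gamma>) q, b)))"
  have jJ: "j q \<in> J1" if "q \<in> D" for q
    using section_onD(5)[OF \<gamma> that] by (simp add: j_def J1_def)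
  have sm: "smooth_on D j" "smooth_on D (par_z (x_of \<circ> \<gamma>))" "smooth_on D (par_z (u_of \<circ> \<gamma>))"
    unfolding j_def
    by (intro smooth_on_intros section_onD(2)[OF \<gamma>] smooth_on_par[OF D] section_smooth[OF \<gamma>])+
  obtain \<phi>' where \<phi>': "(dz0 v has_derivative \<phi>') (at (j q) within J1)"
    using smooth_on_derivatives[OF smooth_on_dz0[OF v]] jJ[OF q] by metis
  obtain j' where j': "(j has_derivative j') (at q within D)"
    using smooth_on_derivatives[OF sm(1)] q by metis
  have comp: "par_z (\<lambda>q. h (j q)) q = h (j' (1, 0))" if "bounded_linear h" for h :: "_ \<Rightarrow> 'c::real_normed_vector"
    using par_base(1)[OF D, of "fst q" "snd q", unfolded prod.collapse, OF q bounded_linear.has_derivative[OF that j']] .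
  have g: "(\<gamma> has_derivative (\<lambda>d. fst (j' d))) (at q within D)"
    using has_derivative_fst[OF j'] by (simp add: j_def)
  have const: "par_z (\<lambda>q. k) q = 0" for k :: real
    using par_base(1)[OF D, of "fst q" "snd q" "\<lambda>_. k" "\<lambda>_. 0"] q by simp
  have bl: "bounded_linear (\<lambda>j::'n jet1. fst (snd j))" "bounded_linear (\<lambda>j::'n jet1. fst (snd (snd j)))"
    "bounded_linear (\<lambda>j::'n jet1. fst (snd (snd (snd j))))" "bounded_linear (\<lambda>j::'n jet1. snd (snd (snd (snd j))))"
    by (intro bounded_linear_compose[OF bounded_linear_fst] bounded_linear_compose[OF bounded_linear_snd]
        bounded_linear_snd bounded_linear_fst)+
  have constx: "par_z (\<lambda>q. k) q = 0" for k :: "real^'n"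
    using par_base(1)[OF D, of "fst q" "snd q" "\<lambda>_. k" "\<lambda>_. 0"] q by simp
  have j10: "j' (1, 0) = ((1, 0, par_z (x_of \<circ> \<gamma>) q, par_z (u_of \<circ> \<gamma>) q),
      (par_z (par_z (x_of \<circ> \<gamma>)) q, 0, par_z (par_z (u_of \<circ> \<gamma>)) q, 0))"
    using section_derivative(1)[OF \<gamma> q g] comp[OF bl(1)] comp[OF bl(2)] comp[OF bl(3)] comp[OF bl(4)]
    by (simp add: j_def prod_eq_iff const constx)
  have "((\<lambda>q. dz0 v (j q)) has_derivative (\<lambda>d. \<phi>' (j' d))) (at q within D)"
    by (rule has_derivative_in_compose[OF j' has_derivative_subset[OF \<phi>']]) (use jJ in auto)
  from par_base(1)[OF D, of "fst q" "snd q", unfolded prod.collapse, OF q this]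
  have "par_z (\<lambda>q. dz0 v (j q)) q = \<phi>' (j' (1, 0))" .
  moreover have "par_z (\<lambda>q. dz0 v (j q)) q = par_z (par_z (v \<circ> \<gamma>)) q"
    by (rule par_z_cong(1)[OF D smooth_on_compose[OF smooth_on_dz0[OF v] sm(1) jJ] _ q])
      (use dz0_section[OF \<gamma> _ v] in \<open>auto simp: j_def\<close>)
  \<comment> \<open>\<open>dz0 v\<close> does not change along the \<open>x\<^sub>t\<close> and \<open>u\<^sub>t\<close> directions\<close>
  moreover have "\<phi>' (0, (0, c, 0, d)) = 0"
  proof -
    have inJ: "j q + r *\<^sub>R (0, 0, c, 0, d) \<in> J1" for r
      using section_onD(5)[OF \<gamma> q] by (simp add: j_def J1_def)
    have "((\<lambda>r. dz0 v (j q + r *\<^sub>R (0, (0, c, 0, d)))) has_vector_derivative \<phi>' (0, (0, c, 0, d))) (at 0)"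
    proof (rule has_vector_derivative_along[where T = J1 and Z = J1])
      show "j q + 0 *\<^sub>R (0, 0, c, 0, d) \<in> J1" by (rule inJ)
      show "((\<lambda>r. j q + r *\<^sub>R (0, 0, c, 0, d)) has_vector_derivative (0, 0, c, 0, d)) (at 0)"
        by (auto intro!: derivative_eq_intros)
      show "(dz0 v has_derivative \<phi>') (at (j q + 0 *\<^sub>R (0, 0, c, 0, d)) within J1)"
        using \<phi>' by (simp only: scaleR_zero_left add_0_right)
    qed (use inJ in \<open>auto intro!: continuous_intros\<close>)
    moreover have "dz0 v (j q + r *\<^sub>R (0, (0, c, 0, d))) = dz0 v (j q)" for r
      by (simp add: j_def dz0_def)
    ultimately show ?thesis
      using vector_derivative_unique_at[OF _ has_vector_derivative_const] by simp
  qed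
  moreover have "\<phi>' (j' (1, 0) + (0, (0, c, 0, d))) = \<phi>' (j' (1, 0)) + \<phi>' (0, (0, c, 0, d))"
    by (rule linear_add[OF has_derivative_linear[OF \<phi>']])
  ultimately show ?thesis
    using frechet_derivative_fat[OF fat_jets(2) jJ[OF q] \<phi>']
    by (simp add: dz1_def j_def j10)
qed

section \<open>Lie derivatives\<close>

text \<open>The boundary functions and the output function at once.\<close>

definition jet_form :: "real^'n \<Rightarrow> real^'n \<Rightarrow> ('n::finite) jet1 \<Rightarrow> real" where
  "jet_form a b = (\<lambda>((z, t, x, u), (xz, xt, uz, ut)). a \<bullet> x + b \<bullet> xz)"

lemma boundary_forms: "g_fun S l = jet_form (G_x S l) (G_z S l)" "h_fun S l = jet_form (H_x S l) (H_z S l)"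
  "c_fun S = jet_form (C_x S) (C_z S)"
  by (simp_all add: g_fun_def h_fun_def c_fun_def jet_form_def)

lemma lie_jet_form:
  assumes "p \<in> J1"
  shows "lie J1 (prolong1 v) (jet_form a b) p = a \<bullet> v (fst p) + b \<bullet> dz0 v p"
proof -
  have "linear (jet_form a b)"
    by (rule linearI) (auto simp: jet_form_def inner_add_right algebra_simps)
  then have "(jet_form a b has_derivative jet_form a b) (at p within J1)"
    by (simp add: linear_conv_bounded_linear bounded_linear_imp_has_derivative)
  then have "frechet_derivative (jet_form a b) (at p within J1) = jet_form a b"
    by (rule frechet_derivative_fat[OF fat_jets(2) assms])
  then show ?thesis
    by (simp add: lie_def prolong1_def vert_def jet_form_def)
qed

text \<open>A vertical field does not move \<open>z\<close> and \<open>u\<close>, and at fixed \<open>z\<close> and \<open>u\<close> the left-hand side is affine in the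
  remaining coordinates; only these directions matter, so no derivative of the coefficients enters.\<close>

lemma lie_pde_lhs:
  fixes v :: "('n::finite) etotal \<Rightarrow> real^'n"
  assumes S: "smooth_on {0..1} (A_x S)" "smooth_on {0..1} (A_z S)" "smooth_on {0..1} (A_zz S)"
    "smooth_on {0..1} (B_u S)" and p: "p \<in> J2"
  shows "lie J2 (prolong2 v) (pde_lhs S \<alpha>) p =
    (dt0 v (fst p) - (A_x S (fst (fst (fst p))) *v v (fst (fst p)) + A_z S (fst (fst (fst p))) *v dz0 v (fst p)
      + A_zz S (fst (fst (fst p))) *v dz1 (dz0 v) p)) $ \<alpha>"
proof -
  let ?z = "\<lambda>p :: 'n jet2. fst (fst (fst p))"
  let ?x = "\<lambda>p :: 'n jet2. fst (snd (snd (fst (fst p))))"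
  let ?u = "\<lambda>p :: 'n jet2. snd (snd (snd (fst (fst p))))"
  let ?xz = "\<lambda>p :: 'n jet2. fst (snd (fst p))"
  let ?xt = "\<lambda>p :: 'n jet2. fst (snd (snd (fst p)))"
  let ?xzz = "\<lambda>p :: 'n jet2. fst (snd p)"
  have eq: "pde_lhs S \<alpha> p = (?xt p - (A_x S (?z p) *v ?x p + A_z S (?z p) *v ?xz p + A_zz S (?z p) *v ?xzz p
      + ?u p *\<^sub>R B_u S (?z p))) $ \<alpha>" for p
    by (auto simp: pde_lhs_def split: prod.splits)
  have z: "smooth_on J2 (\<lambda>p. F (?z p))" if "smooth_on {0..1} F" for F :: "real \<Rightarrow> 'b::real_normed_vector"
  proof (rule smooth_on_compose[OF that])
    show "smooth_on J2 ?z" by (intro smooth_on_intros)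
  qed (auto simp: J2_def J1_def E_space_def)
  have "smooth_on J2 (pde_lhs S \<alpha>)"
    unfolding eq[abs_def]
    by (intro smooth_on_linear_compose[OF bounded_linear_vec_nth] smooth_on_intros
        z[OF S(1)] z[OF S(2)] z[OF S(3)] z[OF S(4)]
        smooth_on_bilinear[OF bounded_bilinear_matrix_vector])
  then obtain F' where F': "(pde_lhs S \<alpha> has_derivative F') (at p within J2)"
    using smooth_on_derivatives[of J2 "pde_lhs S \<alpha>"] p by metis
  define d where "d = prolong2 v p"
  have d: "?z d = 0" "fst (snd (fst (fst d))) = 0" "?x d = v (fst (fst p))" "?u d = 0" "?xz d = dz0 v (fst p)"
    "?xt d = dt0 v (fst p)" "?xzz d = dz1 (dz0 v) p"
    by (simp_all add: d_def prolong2_def prolong1_def vert_def)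
  have cJ: "p + r *\<^sub>R d \<in> J2" for r
    using p d(1,2) by (simp add: J2_def J1_def mem_Times_iff E_space_iff)
  define L where "L = (?xt d - (A_x S (?z p) *v ?x d + A_z S (?z p) *v ?xz d + A_zz S (?z p) *v ?xzz d)) $ \<alpha>"
  have "((\<lambda>r. pde_lhs S \<alpha> (p + r *\<^sub>R d)) has_vector_derivative F' d) (at 0)"
  proof (rule has_vector_derivative_along[where T = J2 and Z = J2])
    show "((\<lambda>r. p + r *\<^sub>R d) has_vector_derivative d) (at 0)"
      by (auto intro!: derivative_eq_intros)
    show "p + 0 *\<^sub>R d \<in> J2" by (rule cJ)
  qed (use F' cJ in \<open>auto intro!: continuous_intros\<close>)
  moreover have "pde_lhs S \<alpha> (p + r *\<^sub>R d) = pde_lhs S \<alpha> p + r * L" for r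
    unfolding eq L_def
    by (simp add: d(1) d(4) matrix_vector_right_distrib matrix_vector_mult_scaleR algebra_simps)
  moreover have "((\<lambda>r. pde_lhs S \<alpha> p + r * L) has_vector_derivative L) (at 0)"
    by (auto intro!: derivative_eq_intros)
  ultimately have "F' d = L"
    by (simp only:) (rule vector_derivative_unique_at)
  then show ?thesis
    using frechet_derivative_fat[OF fat_jets(3) p F']
    unfolding lie_def d_def[symmetric] by (simp only: L_def d)
qed

section \<open>Linearity and non-observability\<close>

definition homogeneous :: "('n::finite) lti_system \<Rightarrow> (real \<times> real \<Rightarrow> real^'n) \<Rightarrow> bool" where
  "homogeneous S w \<longleftrightarrow> smooth_on base w \<and>
     (\<forall>z\<in>{0<..<1}. \<forall>t\<ge>0. par_t w (z, t) =
        A_x S z *v w (z, t) + A_z S z *v par_z w (z, t) + A_zz S z *v par_z (par_z w) (z, t)) \<and>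
     (\<forall>l<n_A S. \<forall>t\<ge>0. G_x S l \<bullet> w (0, t) + G_z S l \<bullet> par_z w (0, t) = 0) \<and>
     (\<forall>m<n_B S. \<forall>t\<ge>0. H_x S m \<bullet> w (1, t) + H_z S m \<bullet> par_z w (1, t) = 0)"

definition silent :: "('n::finite) lti_system \<Rightarrow> (real \<times> real \<Rightarrow> real^'n) \<Rightarrow> bool" where
  "silent S w \<longleftrightarrow> homogeneous S w \<and>
     (\<forall>t\<ge>0. C_x S \<bullet> w (z_out S, t) + C_z S \<bullet> par_z w (z_out S, t) = 0)"

definition free_section :: "(real \<times> real \<Rightarrow> real^'n) \<Rightarrow> real \<times> real \<Rightarrow> ('n::finite) etotal" where
  "free_section w = (\<lambda>(z, t). (z, t, w (z, t), 0))"

lemma free_section_simps [simp]: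
  "x_of (free_section w q) = w q" "u_of (free_section w q) = 0" "x_of \<circ> free_section w = w"
  by (auto simp: free_section_def x_of_def u_of_def split: prod.splits)

lemma openin_base: "openin (top_of_set base) base"
  by simp

lemma free_section_eq: "free_section w q = (fst q, snd q, w q, 0)"
  by (cases q) (simp add: free_section_def)

lemma free_section_smooth: "smooth_on D (free_section w) \<longleftrightarrow> smooth_on D w"
proof
  assume "smooth_on D (free_section w)"
  from smooth_on_linear_compose[OF bounded_linear_x_of this] show "smooth_on D w" by simp
next
  assume "smooth_on D w"
  then show "smooth_on D (free_section w)"
    unfolding free_section_eq[abs_def] by (intro smooth_on_intros)
qed

lemma trajectory_free_section:
  "trajectory S x0 (\<lambda>_. 0) (free_section w) \<longleftrightarrow> homogeneous S w \<and> (\<forall>z\<in>{0..1}. w (z, 0) = x0 z)"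
proof -
  have "free_section w (z, t) = (z, t, w (z, t), 0)" for z t by (simp add: free_section_def)
  then show ?thesis
    unfolding trajectory_def solution_def solves_on_def homogeneous_def free_section_simps free_section_smooth
    by (auto simp: base_def)
qed

lemma solves_onD:
  assumes "solves_on S D \<gamma>"
  shows "smooth_on D \<gamma>"
    "(z, t) \<in> D \<Longrightarrow> (z', t) \<in> D \<Longrightarrow> u_of (\<gamma> (z, t)) = u_of (\<gamma> (z', t))"
    "(z, t) \<in> D \<Longrightarrow> z \<in> {0<..<1} \<Longrightarrow> par_t (x_of \<circ> \<gamma>) (z, t) =
          A_x S z *v x_of (\<gamma> (z, t)) + A_z S z *v par_z (x_of \<circ> \<gamma>) (z, t)
          + A_zz S z *v par_z (par_z (x_of \<circ> \<gamma>)) (z, t) + u_of (\<gamma> (z, t)) *\<^sub>R B_u S z"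
    "(0, t) \<in> D \<Longrightarrow> l < n_A S \<Longrightarrow> G_x S l \<bullet> x_of (\<gamma> (0, t)) + G_z S l \<bullet> par_z (x_of \<circ> \<gamma>) (0, t) = 0"
    "(1, t) \<in> D \<Longrightarrow> m < n_B S \<Longrightarrow> H_x S m \<bullet> x_of (\<gamma> (1, t)) + H_z S m \<bullet> par_z (x_of \<circ> \<gamma>) (1, t) = 0"
  using assms unfolding solves_on_def by blast+

lemma solves_on_section: "solves_on S D \<gamma> \<Longrightarrow> openin (top_of_set base) D \<Longrightarrow> section_on D \<gamma>"
  unfolding solves_on_def section_on_def by blast

lemma trajectory_solves: "trajectory S x0 u \<gamma> \<Longrightarrow> solves_on S base \<gamma>"
  by (simp add: trajectory_def solution_def)

lemma trajectory_section:
  assumes "trajectory S x0 u \<gamma>" shows "section_on base \<gamma>"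
  by (rule solves_on_section[OF trajectory_solves[OF assms] openin_base])

lemma par_diff:
  fixes f g :: "real \<times> real \<Rightarrow> 'b::real_inner"
  assumes D: "openin (top_of_set base) D" and f: "smooth_on D f" and g: "smooth_on D g" and q: "q \<in> D"
  shows "par_z (\<lambda>q. f q - g q) q = par_z f q - par_z g q" "par_t (\<lambda>q. f q - g q) q = par_t f q - par_t g q"
proof -
  obtain z t where zt: "q = (z, t)" by fastforce
  obtain f' where f': "(f has_derivative f') (at (z, t) within D)"
    using smooth_on_derivatives[OF f] q zt by metis
  obtain g' where g': "(g has_derivative g') (at (z, t) within D)"
    using smooth_on_derivatives[OF g] q zt by metis
  note D' = D q[unfolded zt]
  show "par_z (\<lambda>q. f q - g q) q = par_z f q - par_z g q" "par_t (\<lambda>q. f q - g q) q = par_t f q - par_t g q"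
    using par_base[OF D' has_derivative_diff[OF f' g']] par_base[OF D' f'] par_base[OF D' g']
    by (simp_all add: zt)
qed

lemma par_z_par_z_diff:
  fixes f g :: "real \<times> real \<Rightarrow> 'b::real_inner"
  assumes D: "openin (top_of_set base) D" and f: "smooth_on D f" and g: "smooth_on D g" and q: "q \<in> D"
  shows "par_z (par_z (\<lambda>q. f q - g q)) q = par_z (par_z f) q - par_z (par_z g) q"
proof -
  have "par_z (\<lambda>q. par_z f q - par_z g q) q = par_z (par_z (\<lambda>q. f q - g q)) q"
    by (rule par_z_cong(1)[OF D smooth_on_diff[OF smooth_on_par(1)[OF D f] smooth_on_par(1)[OF D g]] _ q])
      (simp add: par_diff[OF D f g])
  then show ?thesis
    using par_diff(1)[OF D smooth_on_par(1)[OF D f] smooth_on_par(1)[OF D g] q] by simp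
qed

lemma matrix_diff: "A *v (x - y) = A *v x - A *v (y :: real^'n)"
  by (rule linear_diff) simp

lemma
  assumes \<gamma>: "trajectory S x0 u \<gamma>" and \<gamma>': "trajectory S x0' u \<gamma>'"
  defines "w \<equiv> \<lambda>q. x_of (\<gamma> q) - x_of (\<gamma>' q)"
  shows trajectory_diff: "homogeneous S w" "\<forall>z\<in>{0..1}. w (z, 0) = x0 z - x0' z"
    and output_diff: "z_out S \<in> {0..1} \<Longrightarrow> t \<ge> 0 \<Longrightarrow>
      output_of S \<gamma> t - output_of S \<gamma>' t = C_x S \<bullet> w (z_out S, t) + C_z S \<bullet> par_z w (z_out S, t)"
proof -
  note s = section_smooth(1)[OF trajectory_section[OF \<gamma>]] section_smooth(1)[OF trajectory_section[OF \<gamma>']]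
  have w: "w = (\<lambda>q. (x_of \<circ> \<gamma>) q - (x_of \<circ> \<gamma>') q)" by (simp add: w_def)
  have d: "par_z w q = par_z (x_of \<circ> \<gamma>) q - par_z (x_of \<circ> \<gamma>') q"
    "par_t w q = par_t (x_of \<circ> \<gamma>) q - par_t (x_of \<circ> \<gamma>') q"
    "par_z (par_z w) q = par_z (par_z (x_of \<circ> \<gamma>)) q - par_z (par_z (x_of \<circ> \<gamma>')) q" if "q \<in> base" for q
    unfolding w by (rule par_diff[OF openin_base s that] par_z_par_z_diff[OF openin_base s that])+
  have u: "u_of (\<gamma> (z, t)) = u t" "u_of (\<gamma>' (z, t)) = u t" if "(z, t) \<in> base" for z t
    using \<gamma>[unfolded trajectory_def] \<gamma>'[unfolded trajectory_def] that by auto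
  have pde: "par_t w (z, t) = A_x S z *v w (z, t) + A_z S z *v par_z w (z, t) + A_zz S z *v par_z (par_z w) (z, t)"
    if "z \<in> {0<..<1}" "t \<ge> 0" for z t
  proof -
    have b: "(z, t) \<in> base" using that by (simp add: base_def)
    have "par_t (x_of \<circ> \<gamma>) (z, t) = A_x S z *v x_of (\<gamma> (z, t)) + A_z S z *v par_z (x_of \<circ> \<gamma>) (z, t)
          + A_zz S z *v par_z (par_z (x_of \<circ> \<gamma>)) (z, t) + u t *\<^sub>R B_u S z"
      "par_t (x_of \<circ> \<gamma>') (z, t) = A_x S z *v x_of (\<gamma>' (z, t)) + A_z S z *v par_z (x_of \<circ> \<gamma>') (z, t)
          + A_zz S z *v par_z (par_z (x_of \<circ> \<gamma>')) (z, t) + u t *\<^sub>R B_u S z"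
      using solves_onD(3)[OF trajectory_solves[OF \<gamma>] b that(1)]
        solves_onD(3)[OF trajectory_solves[OF \<gamma>'] b that(1)] unfolding u[OF b] .
    then show ?thesis
      unfolding d[OF b] by (simp add: w_def matrix_diff)
  qed
  have bc: "G_x S l \<bullet> w (0, t) + G_z S l \<bullet> par_z w (0, t) = 0" if "l < n_A S" "t \<ge> 0" for l t
  proof -
    have b: "(0, t) \<in> base" using that by (simp add: base_def)
    have "G_x S l \<bullet> x_of (\<gamma> (0, t)) + G_z S l \<bullet> par_z (x_of \<circ> \<gamma>) (0, t) = 0"
      "G_x S l \<bullet> x_of (\<gamma>' (0, t)) + G_z S l \<bullet> par_z (x_of \<circ> \<gamma>') (0, t) = 0"
      using solves_onD(4)[OF trajectory_solves[OF \<gamma>] b that(1)]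
        solves_onD(4)[OF trajectory_solves[OF \<gamma>'] b that(1)] .
    then show ?thesis unfolding d[OF b] by (simp add: w_def inner_diff_right)
  qed
  have bc': "H_x S m \<bullet> w (1, t) + H_z S m \<bullet> par_z w (1, t) = 0" if "m < n_B S" "t \<ge> 0" for m t
  proof -
    have b: "(1, t) \<in> base" using that by (simp add: base_def)
    have "H_x S m \<bullet> x_of (\<gamma> (1, t)) + H_z S m \<bullet> par_z (x_of \<circ> \<gamma>) (1, t) = 0"
      "H_x S m \<bullet> x_of (\<gamma>' (1, t)) + H_z S m \<bullet> par_z (x_of \<circ> \<gamma>') (1, t) = 0"
      using solves_onD(5)[OF trajectory_solves[OF \<gamma>] b that(1)]
        solves_onD(5)[OF trajectory_solves[OF \<gamma>'] b that(1)] .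
    then show ?thesis unfolding d[OF b] by (simp add: w_def inner_diff_right)
  qed
  show "homogeneous S w"
    unfolding homogeneous_def using pde bc bc' smooth_on_diff[OF s] by (simp add: w)
  show "\<forall>z\<in>{0..1}. w (z, 0) = x0 z - x0' z"
    using \<gamma>[unfolded trajectory_def] \<gamma>'[unfolded trajectory_def] by (simp add: w_def)
  show "output_of S \<gamma> t - output_of S \<gamma>' t = C_x S \<bullet> w (z_out S, t) + C_z S \<bullet> par_z w (z_out S, t)"
    if "z_out S \<in> {0..1}" "t \<ge> 0"
  proof -
    have b: "(z_out S, t) \<in> base" using that by (simp add: base_def)
    show ?thesis unfolding d[OF b] output_of_def by (simp add: w_def inner_diff_right)
  qed
qed

text \<open>By linearity two initial conditions are indistinguishable iff their difference, without input,
  produces no output; uniqueness transfers this from one input to all inputs.\<close>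

lemma not_observable_iff:
  assumes wp: "well_posed S" and z: "z_out S \<in> {0..1}"
  shows "\<not> observable S \<longleftrightarrow> (\<exists>w. silent S w \<and> (\<exists>z\<in>{0..1}. w (z, 0) \<noteq> 0))"
proof
  assume "\<not> observable S"
  then obtain x0 x0' z1 where ne: "z1 \<in> {0..1}" "x0 z1 \<noteq> x0' z1" and ind: "indistinguishable S x0 x0'"
    unfolding observable_def by blast
  then obtain u \<gamma> \<gamma>' where tr: "trajectory S x0 u \<gamma>" "trajectory S x0' u \<gamma>'"
    unfolding indistinguishable_def by blast
  define w where "w = (\<lambda>q. x_of (\<gamma> q) - x_of (\<gamma>' q))"
  have "output_of S \<gamma> t - output_of S \<gamma>' t = 0" if "t \<ge> 0" for t
    using ind tr that unfolding indistinguishable_def by auto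
  then have "silent S w"
    using trajectory_diff(1)[OF tr] output_diff[OF tr z] unfolding silent_def w_def by simp
  moreover have "w (z1, 0) \<noteq> 0"
    using trajectory_diff(2)[OF tr] ne unfolding w_def by simp
  ultimately show "\<exists>w. silent S w \<and> (\<exists>z\<in>{0..1}. w (z, 0) \<noteq> 0)" using ne by blast
next
  assume "\<exists>w. silent S w \<and> (\<exists>z\<in>{0..1}. w (z, 0) \<noteq> 0)"
  then obtain w z1 where w: "silent S w" and ne: "z1 \<in> {0..1}" "w (z1, 0) \<noteq> 0" by blast
  let ?x0 = "\<lambda>z. w (z, 0)" and ?o = "\<lambda>z :: real. 0 :: real^'a"
  have tr: "trajectory S ?x0 (\<lambda>_. 0) (free_section w)"
    using w by (simp add: trajectory_free_section silent_def)
  have "homogeneous S (\<lambda>q. w q - w q)"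
    using trajectory_diff(1)[OF tr tr] by simp
  then have tr0: "trajectory S ?o (\<lambda>_. 0) (free_section (\<lambda>q. 0))"
    by (simp add: trajectory_free_section)
  have "output_of S \<gamma> t = output_of S \<gamma>' t"
    if tr': "trajectory S ?x0 u \<gamma>" "trajectory S ?o u \<gamma>'" and t: "t \<ge> 0" for u \<gamma> \<gamma>' t
  proof -
    define d where "d = (\<lambda>q. x_of (\<gamma> q) - x_of (\<gamma>' q))"
    have d: "homogeneous S d" using trajectory_diff(1)[OF tr'] by (simp add: d_def)
    have "trajectory S ?x0 (\<lambda>_. 0) (free_section d)"
      using d trajectory_diff(2)[OF tr'] by (simp add: trajectory_free_section d_def)
    then have "\<forall>q\<in>base. free_section d q = free_section w q"
      using wp tr unfolding well_posed_def by blast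
    then have eq: "d q = w q" if "q \<in> base" for q
      using that by (metis free_section_simps(1))
    have b: "(z_out S, t) \<in> base" using z t by (simp add: base_def)
    have sm: "smooth_on base d" using d by (simp add: homogeneous_def)
    have "par_z d (z_out S, t) = par_z w (z_out S, t)"
      by (rule par_z_cong(1)[OF openin_base sm eq b])
    then have "output_of S \<gamma> t - output_of S \<gamma>' t = C_x S \<bullet> w (z_out S, t) + C_z S \<bullet> par_z w (z_out S, t)"
      using output_diff[OF tr' z t] eq[OF b] unfolding d_def by simp
    then show ?thesis using w t unfolding silent_def by simp
  qed
  then have "indistinguishable S ?x0 ?o"
    unfolding indistinguishable_def using tr tr0 by blast
  moreover have "\<exists>z\<in>{0..1}. ?x0 z \<noteq> ?o z" using ne by auto
  ultimately show "\<not> observable S"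
    unfolding observable_def not_not by (intro exI[of _ ?x0] exI[of _ ?o]) simp
qed

text \<open>The definition of a solution imposes the PDE on the open interval, the Lie conditions on the closed one;
  continuity bridges the gap.\<close>

lemma homogeneous_closed:
  assumes S: "smooth_on {0..1} (A_x S)" "smooth_on {0..1} (A_z S)" "smooth_on {0..1} (A_zz S)"
    and w: "homogeneous S w" and z: "z \<in> {0..1}" and t: "t \<ge> 0"
  shows "par_t w (z, t) = A_x S z *v w (z, t) + A_z S z *v par_z w (z, t) + A_zz S z *v par_z (par_z w) (z, t)"
proof -
  define F where "F z = par_t w (z, t)
    - (A_x S z *v w (z, t) + A_z S z *v par_z w (z, t) + A_zz S z *v par_z (par_z w) (z, t))" for z
  have sm: "smooth_on base w" using w by (simp add: homogeneous_def)
  have line: "continuous_on {0..1} (\<lambda>z. f (z, t))" if "smooth_on base f" for f :: "_ \<Rightarrow> real^'a"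
    by (rule continuous_on_compose2[OF smooth_on_continuous[OF that], of _ "\<lambda>z. (z, t)"])
      (use t in \<open>auto simp: base_def intro!: continuous_intros\<close>)
  note pz = smooth_on_par(1)[OF openin_base]
  have "continuous_on {0..1} F"
    unfolding F_def
    by (intro continuous_on_diff continuous_on_add
        bounded_bilinear.continuous_on[OF bounded_bilinear_matrix_vector]
        smooth_on_continuous[OF S(1)] smooth_on_continuous[OF S(2)] smooth_on_continuous[OF S(3)]
        line[OF sm] line[OF pz[OF sm]] line[OF pz[OF pz[OF sm]]] line[OF smooth_on_par(2)[OF openin_base sm]])
  moreover have "F z = 0" if "z \<in> {0<..<1}" for z
    using w that t unfolding F_def homogeneous_def by simp
  ultimately have "F z = 0"
    using continuous_constant_on_closure[of "{0<..<1::real}" F 0 z] z by simp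
  then show ?thesis by (simp add: F_def)
qed

lemma base_field_eq: "base_field w p = w (fst p, fst (snd p))"
  by (cases p) (simp add: base_field_def)

lemma smooth_on_base_field:
  assumes "smooth_on base w" shows "smooth_on E_space (base_field w)"
  unfolding base_field_eq[abs_def]
  by (rule smooth_on_compose[OF assms]) (auto intro!: smooth_on_Pair smooth_on_fst smooth_on_snd smooth_on_ident
      simp: base_def E_space_def)

lemma
  fixes w :: "real \<times> real \<Rightarrow> real^('n::finite)"
  assumes w: "smooth_on base w" and p: "p \<in> E_space"
  shows dz0_base_field: "dz0 (base_field w) (p, \<xi>) = base_field (par_z w) p"
    and dt0_base_field: "dt0 (base_field w) (p, \<xi>) = base_field (par_t w) p"
    and dz1_dz0_base_field: "dz1 (dz0 (base_field w)) ((p, \<xi>), \<eta>) = base_field (par_z (par_z w)) p"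
proof -
  have pull: "((\<lambda>j. f (\<pi> j)) has_derivative (\<lambda>d. f' (\<pi> d))) (at j within J)"
    if "(f has_derivative f') (at (\<pi> j) within base)" "bounded_linear \<pi>" "\<pi> ` J \<subseteq> base"
    for f :: "_ \<Rightarrow> real^'n" and f' j J and \<pi> :: "'j::euclidean_space \<Rightarrow> real \<times> real"
    by (rule has_derivative_in_compose[OF bounded_linear_imp_has_derivative[OF that(2)]
          has_derivative_subset[OF that(1,3)]])
  have bl: "bounded_linear (\<lambda>p :: 'n etotal. (fst p, fst (snd p)))"
    by (intro bounded_linear_Pair bounded_linear_fst bounded_linear_compose[OF bounded_linear_fst]
        bounded_linear_snd)
  have bl1: "bounded_linear (\<lambda>j :: 'n jet1. (fst (fst j), fst (snd (fst j))))"
    by (rule bounded_linear_compose[OF bl bounded_linear_fst])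
  have im: "(\<lambda>p :: 'n etotal. (fst p, fst (snd p))) ` E_space \<subseteq> base"
    "(\<lambda>j :: 'n jet1. (fst (fst j), fst (snd (fst j)))) ` J1 \<subseteq> base"
    by (auto simp: E_space_def base_def J1_def)
  have first: "dz0 (base_field f) (p, \<xi>) = base_field (par_z f) p \<and>
      dt0 (base_field f) (p, \<xi>) = base_field (par_t f) p"
    if f: "smooth_on base f" and p: "p \<in> E_space" for f :: "_ \<Rightarrow> real^'n" and p \<xi>
  proof -
    obtain z t x u where pe: "p = (z, t, x, u)" by (cases p)
    obtain xz xt uz ut where \<xi>: "\<xi> = (xz, xt, uz, ut)" by (cases \<xi>)
    have b: "(z, t) \<in> base" using p by (simp add: pe E_space_def base_def)
    obtain f' where f': "(f has_derivative f') (at (z, t) within base)"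
      using smooth_on_derivatives[OF f] b by metis
    have "(base_field f has_derivative (\<lambda>d. f' (fst d, fst (snd d)))) (at p within E_space)"
      unfolding base_field_eq[abs_def] by (rule pull[OF _ bl im(1)]) (simp add: pe f')
    from frechet_derivative_fat[OF fat_jets(1) p this] par_base[OF openin_base b f']
    show ?thesis by (simp add: dz0_def dt0_def base_field_eq pe \<xi>)
  qed
  show "dz0 (base_field w) (p, \<xi>) = base_field (par_z w) p"
    "dt0 (base_field w) (p, \<xi>) = base_field (par_t w) p"
    using first[OF w p] by simp_all
  obtain z t x u where pe: "p = (z, t, x, u)" by (cases p)
  obtain xz xt uz ut where \<xi>: "\<xi> = (xz, xt, uz, ut)" by (cases \<xi>)
  obtain xzz xzt xtt uzz uzt utt where \<eta>: "\<eta> = (xzz, xzt, xtt, uzz, uzt, utt)" by (cases \<eta>)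
  have b: "(z, t) \<in> base" using p by (simp add: pe E_space_def base_def)
  have jJ: "(p, \<xi>) \<in> J1" using p by (simp add: J1_def)
  obtain g' where g': "(par_z w has_derivative g') (at (z, t) within base)"
    using smooth_on_derivatives[OF smooth_on_par(1)[OF openin_base w]] b by metis
  have "((\<lambda>j. par_z w (fst (fst j), fst (snd (fst j)))) has_derivative
      (\<lambda>d. g' (fst (fst d), fst (snd (fst d))))) (at (p, \<xi>) within J1)"
    by (rule pull[OF _ bl1 im(2)]) (simp add: pe g')
  then have "(dz0 (base_field w) has_derivative (\<lambda>d. g' (fst (fst d), fst (snd (fst d))))) (at (p, \<xi>) within J1)"
  proof (rule has_derivative_transform[OF jJ, rotated])
    show "dz0 (base_field w) j = par_z w (fst (fst j), fst (snd (fst j)))" if "j \<in> J1" for j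
      using first[OF w, of "fst j" "snd j"] that by (simp add: J1_def mem_Times_iff base_field_eq)
  qed
  from frechet_derivative_fat[OF fat_jets(2) jJ this] par_base(1)[OF openin_base b g']
  show "dz1 (dz0 (base_field w)) ((p, \<xi>), \<eta>) = base_field (par_z (par_z w)) p"
    by (simp add: dz1_def base_field_eq pe \<xi> \<eta>)
qed

section \<open>Initial conditions that are flat at the boundary\<close>

text \<open>The derivatives of these functions are linear combinations of functions of the same family, so smoothness at zero follows for the whole family by one induction on the order.\<close>

definition flat :: "nat \<Rightarrow> real \<Rightarrow> real" where
  "flat n x = (if x > 0 then inverse x ^ n * exp (- inverse x) else 0)"

lemma flat_at_right: "(flat n \<longlongrightarrow> 0) (at_right 0)"
proof -
  have "((\<lambda>x. inverse x ^ n / exp (inverse x)) \<longlongrightarrow> (0::real)) (at_right 0)"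
    by (rule filterlim_compose[OF tendsto_power_div_exp_0 filterlim_inverse_at_top_right])
  then show ?thesis
  proof (rule Lim_transform_eventually)
    show "\<forall>\<^sub>F x in at_right 0. inverse x ^ n / exp (inverse x) = flat n x"
      using eventually_at_right_less[of "0::real"]
      by eventually_elim (simp add: flat_def exp_minus divide_inverse)
  qed
qed

lemma flat_derivative:
  "(flat n has_real_derivative (flat (Suc (Suc n)) x - real n * flat (Suc n) x)) (at x)"
proof -
  consider "x > 0" | "x < 0" | "x = 0" by linarith
  then show ?thesis
  proof cases
    case 1
    have p: "real n * inverse x ^ (n - 1) * (inverse x * inverse x) = real n * inverse x ^ Suc n"
      by (cases n) simp_all
    have "((\<lambda>x. inverse x ^ n * exp (- inverse x)) has_real_derivative
        (inverse x ^ n * (exp (- inverse x) * (inverse x * inverse x))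
          + (- (real n * inverse x ^ (n - 1) * (inverse x * inverse x))) * exp (- inverse x))) (at x)"
      using 1 by (auto intro!: derivative_eq_intros simp: algebra_simps)
    then have "((\<lambda>x. inverse x ^ n * exp (- inverse x)) has_real_derivative
        (flat (Suc (Suc n)) x - real n * flat (Suc n) x)) (at x)"
      unfolding p using 1 by (simp add: flat_def algebra_simps)
    then show ?thesis
      by (rule has_field_derivative_transform_within_open[of _ _ _ "{0<..}"]) (use 1 in \<open>auto simp: flat_def\<close>)
  next
    case 2
    have "((\<lambda>_. 0) has_real_derivative 0) (at x)" by simp
    then have "(flat n has_real_derivative 0) (at x)"
      by (rule has_field_derivative_transform_within_open[of _ _ _ "{..<0}"]) (use 2 in \<open>auto simp: flat_def\<close>)
    then show ?thesis using 2 by (simp add: flat_def)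
  next
    case 3
    have "((\<lambda>h. (flat n h - flat n 0) / (h - 0)) \<longlongrightarrow> 0) (at 0)"
    proof (rule filterlim_split_at)
      show "((\<lambda>h. (flat n h - flat n 0) / (h - 0)) \<longlongrightarrow> 0) (at_left 0)"
      proof (rule Lim_transform_eventually[OF tendsto_const])
        show "\<forall>\<^sub>F h in at_left 0. 0 = (flat n h - flat n 0) / (h - 0)"
          unfolding eventually_at_filter by (simp add: flat_def)
      qed
      show "((\<lambda>h. (flat n h - flat n 0) / (h - 0)) \<longlongrightarrow> 0) (at_right 0)"
      proof (rule Lim_transform_eventually[OF flat_at_right[of "Suc n"]])
        show "\<forall>\<^sub>F h in at_right 0. flat (Suc n) h = (flat n h - flat n 0) / (h - 0)"
          using eventually_at_right_less[of "0::real"]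
          by eventually_elim (simp add: flat_def divide_inverse)
      qed
    qed
    then show ?thesis using 3 by (simp add: has_field_derivative_iff flat_def)
  qed
qed

lemma Ck_on_flat: "Ck_on k UNIV (flat n)"
proof (induction k arbitrary: n)
  case 0
  show ?case using DERIV_isCont[OF flat_derivative] by (simp add: continuous_on_eq_continuous_at)
next
  case (Suc k)
  show ?case
  proof (rule Ck_on_SucI[where f' = "\<lambda>x d. (flat (Suc (Suc n)) x - real n * flat (Suc n) x) * d"])
    show "(flat n has_derivative (*) (flat (Suc (Suc n)) x - real n * flat (Suc n) x)) (at x)" for x
      using flat_derivative[of n x] by (simp add: has_field_derivative_def)
    have "Ck_on k UNIV (\<lambda>x. d *\<^sub>R flat (Suc (Suc n)) x + (- real n * d) *\<^sub>R flat (Suc n) x)" for d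
      by (intro Ck_on_add Ck_on_bounded_linear_compose[OF bounded_linear_scaleR_right] Suc.IH open_UNIV)
    then show "Ck_on k UNIV (\<lambda>x. (flat (Suc (Suc n)) x - real n * flat (Suc n) x) * d)" for d
      by (simp add: algebra_simps)
  qed simp
qed

lemma bump_exists:
  fixes a b c :: real
  assumes "a < c" "c < b"
  obtains \<phi> :: "real \<Rightarrow> real" where "smooth_on UNIV \<phi>" "\<phi> c = 1" "\<And>z. z \<notin> {a..b} \<Longrightarrow> \<phi> z = 0"
proof
  let ?k = "flat 0 (c - a) * flat 0 (b - c)"
  let ?\<phi> = "\<lambda>z. inverse ?k * (flat 0 (z - a) * flat 0 (b - z))"
  have fl: "smooth_on UNIV (flat 0)"
    by (rule smooth_onI[of UNIV]) (auto intro: Ck_on_flat)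
  have c: "smooth_on UNIV (\<lambda>z. flat 0 (z - a))" "smooth_on UNIV (\<lambda>z. flat 0 (b - z))"
    by (rule smooth_on_compose[OF fl]; intro smooth_on_intros UNIV_I)+
  show "smooth_on UNIV ?\<phi>"
    by (intro smooth_on_bilinear[OF bounded_bilinear_mult] smooth_on_const c)
  have "?k \<noteq> 0" using assms by (simp add: flat_def)
  then show "?\<phi> c = 1" by (rule left_inverse)
  show "?\<phi> z = 0" if "z \<notin> {a..b}" for z using that by (auto simp: flat_def)
qed

lemma ddz_zero:
  assumes "open N" "z \<in> N" "z \<in> {0..1}" "\<And>s. s \<in> N \<inter> {0..1} \<Longrightarrow> f s = 0"
  shows "ddz f z = 0"
proof (rule ddz_eq[OF assms(3)])
  have "((\<lambda>_. 0) has_vector_derivative 0) (at z within {0..1} \<inter> N)" by simp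
  then have "(f has_vector_derivative 0) (at z within {0..1} \<inter> N)"
    unfolding has_vector_derivative_def
    by (rule has_derivative_transform[rotated 2]) (use assms in auto)
  moreover have "at z within {0..1} = at z within ({0..1} \<inter> N)"
    by (rule at_within_nhd[of _ N]) (use assms in auto)
  ultimately show "(f has_vector_derivative 0) (at z within {0..1})" by simp
qed

lemma ddt_zero:
  assumes "t \<ge> 0" "\<And>s. s \<ge> 0 \<Longrightarrow> f s = 0"
  shows "ddt f t = 0"
proof (rule ddt_eq[OF assms(1)])
  have "((\<lambda>_. 0) has_vector_derivative 0) (at t within {0..})" by simp
  then show "(f has_vector_derivative 0) (at t within {0..})"
    unfolding has_vector_derivative_def
    by (rule has_derivative_transform[rotated 2]) (use assms in auto)
qed

text \<open>Without input, the prescribed time derivatives are built from \<open>z\<close>-derivatives of the initial condition and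
  vanish wherever it vanishes locally, in particular near both ends; so the compatibility conditions hold
  whatever the boundary conditions are.\<close>

lemma compatible_flat:
  assumes x0: "smooth_on {0..1} x0" and ab: "0 < a" "b < 1" and fl: "\<And>z. z \<notin> {a..b} \<Longrightarrow> x0 z = 0"
  shows "compatible S x0 (\<lambda>_. 0)"
proof -
  have u: "(ddt ^^ k) (\<lambda>_. 0 :: real) t = 0" if "t \<ge> 0" for k t
    using that by (induction k arbitrary: t) (simp_all add: ddt_zero)
  let ?N = "- {a..b}"
  have N: "open ?N" by (simp add: open_Compl)
  have d: "init_deriv S x0 (\<lambda>_. 0) k z = 0" if "z \<in> ?N \<inter> {0..1}" for k z
    using that
  proof (induction k arbitrary: z)
    case 0
    then show ?case using fl by simp
  next
    case (Suc k)
    have "ddz (init_deriv S x0 (\<lambda>_. 0) k) s = 0" if "s \<in> ?N \<inter> {0..1}" for s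
      by (rule ddz_zero[OF N]) (use that Suc.IH in auto)
    then have "ddz (ddz (init_deriv S x0 (\<lambda>_. 0) k)) z = 0" "ddz (init_deriv S x0 (\<lambda>_. 0) k) z = 0"
      using Suc.prems ddz_zero[OF N, of z "ddz (init_deriv S x0 (\<lambda>_. 0) k)"] by auto
    then show ?case using Suc.IH[OF Suc.prems] u[of 0 k] by simp
  qed
  have "ddz (init_deriv S x0 (\<lambda>_. 0) k) s = 0" if "s \<in> ?N \<inter> {0..1}" for s k
    by (rule ddz_zero[OF N]) (use that d in auto)
  then show ?thesis
    unfolding compatible_def using x0 d ab by (simp add: smooth_on_const)
qed

text \<open>The base point is first moved to the open interval, by continuity, and the input value to zero, since \<open>v\<close>
  does not depend on \<open>u\<close> at time zero. Then a multiple of a bump function is a compatible initial condition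
  through the point.\<close>

lemma trajectory_through:
  fixes S :: "('n::finite) lti_system"
  assumes wp: "well_posed S" and v: "smooth_on E_space v" and nt: "starts_nontrivially v"
  obtains x0 \<gamma> z where "trajectory S x0 (\<lambda>_. 0) \<gamma>" "z \<in> {0..1}" "v (\<gamma> (z, 0)) \<noteq> 0"
proof -
  obtain z1 x u where z1: "z1 \<in> {0..1}" "v (z1, 0, x, u) \<noteq> 0"
    and du: "\<And>u. vector_derivative (\<lambda>s. v (z1, 0, x, s)) (at u) = 0"
    using nt unfolding starts_nontrivially_def by blast
  have line: "smooth_on UNIV (\<lambda>s. v (z1, 0, x, s))"
    by (rule smooth_on_compose[OF v]) (use z1 in \<open>auto intro!: smooth_on_Pair smooth_on_const smooth_on_ident simp: E_space_def\<close>)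
  obtain f' where f': "\<And>s. ((\<lambda>s. v (z1, 0, x, s)) has_derivative f' s) (at s)"
    using smooth_on_derivatives[OF line] by (metis UNIV_I)
  have "((\<lambda>s. v (z1, 0, x, s)) has_vector_derivative 0) (at s within UNIV)" for s
    using f'[of s] du[of s] vector_derivative_works[of "\<lambda>s. v (z1, 0, x, s)" "at s"]
    by (auto simp: differentiable_def)
  then obtain c where "\<And>s. v (z1, 0, x, s) = c"
    using has_vector_derivative_zero_constant[of UNIV "\<lambda>s. v (z1, 0, x, s)"] by auto
  then have z1': "v (z1, 0, x, 0) \<noteq> 0" using z1(2) by metis
  have cont: "continuous_on {0..1} (\<lambda>z. v (z, 0, x, 0))"
    by (rule continuous_on_compose2[OF smooth_on_continuous[OF v]])
      (auto simp: E_space_def intro!: continuous_intros)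
  have "\<exists>z2\<in>{0<..<1}. v (z2, 0, x, 0) \<noteq> 0"
  proof (rule ccontr)
    assume "\<not> ?thesis"
    then have "\<And>z. z \<in> {0<..<1} \<Longrightarrow> v (z, 0, x, 0) = 0" by blast
    then show False
      using continuous_constant_on_closure[of "{0<..<1::real}" "\<lambda>z. v (z, 0, x, 0)" 0 z1] cont z1(1) z1' by simp
  qed
  then obtain z2 where z2: "0 < z2" "z2 < 1" "v (z2, 0, x, 0) \<noteq> 0" by auto
  obtain \<phi> :: "real \<Rightarrow> real" where \<phi>: "smooth_on UNIV \<phi>" "\<phi> z2 = 1" "\<And>z. z \<notin> {z2/2..(z2+1)/2} \<Longrightarrow> \<phi> z = 0"
    using bump_exists[of "z2/2" z2 "(z2+1)/2"] z2 by auto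
  define x0 where "x0 z = \<phi> z *\<^sub>R x" for z
  have "compatible S x0 (\<lambda>_. 0)"
  proof (rule compatible_flat)
    show "smooth_on {0..1} x0"
      unfolding x0_def by (intro smooth_on_bilinear[OF bounded_bilinear_scaleR] smooth_on_const
          smooth_on_subset[OF \<phi>(1)] subset_UNIV)
    show "0 < z2/2" "(z2+1)/2 < 1" using z2 by auto
    show "x0 z = 0" if "z \<notin> {z2/2..(z2+1)/2}" for z using \<phi>(3)[OF that] by (simp add: x0_def)
  qed
  then obtain \<gamma> where \<gamma>: "trajectory S x0 (\<lambda>_. 0) \<gamma>"
    using wp unfolding well_posed_def by blast
  have b: "(z2, 0) \<in> base" using z2 by (simp add: base_def)
  have "x_of (\<gamma> (z2, 0)) = x" "u_of (\<gamma> (z2, 0)) = 0"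
    using \<gamma>[unfolded trajectory_def] b z2 by (auto simp: x0_def \<phi>(2))
  then have "\<gamma> (z2, 0) = (z2, 0, x, 0)"
    using section_onD(4)[OF trajectory_section[OF \<gamma>] b] by simp
  then show thesis using that[OF \<gamma>, of z2] z2 by simp
qed

section \<open>Differential inequalities\<close>

lemma gronwall_zero:
  fixes e :: "real \<Rightarrow> 'a::real_inner"
  assumes e: "\<And>r. r \<in> {0..1} \<Longrightarrow> (e has_vector_derivative e' r) (at r)"
    and C: "\<And>r. r \<in> {0..1} \<Longrightarrow> norm (e' r) \<le> C * norm (e r)" and "e 0 = 0"
  shows "e 1 = 0"
proof -
  define \<phi> where "\<phi> r = exp (- (2 * C) * r) * (e r \<bullet> e r)" for r
  define \<phi>' where "\<phi>' r = exp (- (2 * C) * r) * (2 * (e r \<bullet> e' r) - 2 * C * (e r \<bullet> e r))" for r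
  have D: "(\<phi> has_real_derivative \<phi>' r) (at r)" if "0 \<le> r" "r \<le> 1" for r
  proof -
    have "(e has_derivative (\<lambda>h. h *\<^sub>R e' r)) (at r)"
      using e[of r] that by (simp add: has_vector_derivative_def)
    from has_derivative_inner[OF this this]
    have "((\<lambda>r. e r \<bullet> e r) has_real_derivative 2 * (e r \<bullet> e' r)) (at r)"
      unfolding has_field_derivative_def inner_scaleR_right inner_scaleR_left inner_commute[of "e' r"]
      by (rule has_derivative_eq_rhs) (simp add: fun_eq_iff)
    moreover have "((\<lambda>r. exp (- (2 * C) * r)) has_real_derivative exp (- (2 * C) * r) * (- (2 * C))) (at r)"
      by (rule DERIV_fun_exp) (rule DERIV_cmult_Id)
    ultimately have "((\<lambda>r. exp (- (2 * C) * r) * (e r \<bullet> e r)) has_real_derivative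
        exp (- (2 * C) * r) * (- (2 * C)) * (e r \<bullet> e r) + 2 * (e r \<bullet> e' r) * exp (- (2 * C) * r)) (at r)"
      by (rule DERIV_mult[rotated])
    then show ?thesis
      unfolding \<phi>_def \<phi>'_def by (simp add: algebra_simps)
  qed
  have N: "\<phi>' r \<le> 0" if "0 \<le> r" "r \<le> 1" for r
  proof -
    have "e r \<bullet> e' r \<le> norm (e r) * norm (e' r)" by (rule norm_cauchy_schwarz)
    also have "\<dots> \<le> norm (e r) * (C * norm (e r))" using C[of r] that by (intro mult_left_mono) auto
    also have "\<dots> = C * (e r \<bullet> e r)" by (simp only: dot_square_norm power2_eq_square mult_ac)
    finally have "2 * (e r \<bullet> e' r) - 2 * C * (e r \<bullet> e r) \<le> 0" by linarith
    then show ?thesis unfolding \<phi>'_def by (intro mult_nonneg_nonpos) auto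
  qed
  have "\<phi> 1 \<le> \<phi> 0"
  proof (rule DERIV_nonpos_imp_nonincreasing[where f = \<phi> and a = 0 and b = 1])
    show "\<exists>y. (\<phi> has_real_derivative y) (at r) \<and> y \<le> 0" if "0 \<le> r" "r \<le> 1" for r
      using D[OF that] N[OF that] by blast
  qed simp
  then have "exp (- (2 * C)) * (e 1 \<bullet> e 1) \<le> 0"
    using \<open>e 0 = 0\<close> by (simp add: \<phi>_def)
  then have "e 1 \<bullet> e 1 \<le> 0" using exp_gt_zero[of "- (2 * C)"] by (metis mult_le_cancel_left_pos mult_zero_right)
  then show ?thesis by (metis inner_eq_zero_iff inner_ge_zero order_antisym)
qed

lemma derivative_bound_compact:
  fixes f' :: "'a::topological_space \<Rightarrow> 'b::euclidean_space \<Rightarrow> 'c::real_normed_vector"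
  assumes K: "compact K" and lin: "\<And>x. x \<in> K \<Longrightarrow> linear (f' x)" and cont: "\<And>d. continuous_on K (\<lambda>x. f' x d)"
  obtains B where "B \<ge> 0" "\<And>x h. x \<in> K \<Longrightarrow> norm (f' x h) \<le> B * norm h"
proof -
  let ?N = "\<lambda>x. \<Sum>b\<in>Basis. norm (f' x b)"
  have "compact (?N ` K)"
    by (intro compact_continuous_image continuous_on_sum continuous_on_norm cont K)
  then have "bounded (?N ` K)" by (rule compact_imp_bounded)
  then obtain B where B: "B > 0" "\<forall>y\<in>?N ` K. norm y \<le> B" using bounded_pos by blast
  show thesis
  proof (rule that[of B])
    show "norm (f' x h) \<le> B * norm h" if x: "x \<in> K" for x h
    proof -
      have "f' x (\<Sum>b\<in>Basis. (h \<bullet> b) *\<^sub>R b) = (\<Sum>b\<in>Basis. (h \<bullet> b) *\<^sub>R f' x b)"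
        using lin[OF x] by (simp add: linear_sum linear_cmul)
      then have "norm (f' x h) = norm (\<Sum>b\<in>Basis. (h \<bullet> b) *\<^sub>R f' x b)"
        by (simp only: euclidean_representation)
      also have "\<dots> \<le> (\<Sum>b\<in>Basis. norm ((h \<bullet> b) *\<^sub>R f' x b))" by (rule norm_sum)
      also have "\<dots> \<le> (\<Sum>b\<in>Basis. norm h * norm (f' x b))"
        by (intro sum_mono) (auto intro!: mult_right_mono Basis_le_norm)
      also have "\<dots> = norm h * ?N x" by (simp add: sum_distrib_left)
      also have "\<dots> \<le> norm h * B"
      proof (rule mult_left_mono)
        have "norm (?N x) \<le> B" using B(2) x by blast
        then show "?N x \<le> B" by simp
      qed simp
      finally show ?thesis by (simp add: mult.commute)
    qed
  qed (use B in simp)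
qed

text \<open>A \<open>C\<^sup>1\<close> field that maps a subspace into itself is tangent to it, so its trajectories do not leave it:
  with a linear projection \<open>P\<close> onto the subspace, the defect \<open>y - P y\<close> satisfies a Gronwall inequality, because
  \<open>F (P y)\<close> has no defect and \<open>F\<close> is Lipschitz on bounded sets.\<close>

lemma invariant_subspace:
  fixes F :: "'a::euclidean_space \<Rightarrow> 'a" and y :: "real \<Rightarrow> 'a"
  assumes F: "smooth_on UNIV F" and L: "subspace L" "\<And>p. p \<in> L \<Longrightarrow> F p \<in> L"
    and y: "\<And>r. r \<in> {0..1} \<Longrightarrow> (y has_vector_derivative c *\<^sub>R F (y r)) (at r)" and y0: "y 0 \<in> L"
  shows "y 1 \<in> L"
proof -
  obtain P where P: "range P \<subseteq> L" "linear P" "\<And>p. p \<in> L \<Longrightarrow> P p = p"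
    using linear_exists_left_inverse_on[OF linear_id L(1)] by (auto simp: id_def)
  have blP: "bounded_linear P" using P(2) by (simp add: linear_conv_bounded_linear)
  define Q where "Q p = p - P p" for p
  have blQ: "bounded_linear Q" unfolding Q_def[abs_def] by (intro bounded_linear_sub bounded_linear_ident blP)
  have Q0: "Q p = 0" if "p \<in> L" for p using P(3)[OF that] by (simp add: Q_def)
  obtain KP where KP: "\<And>p. norm (P p) \<le> norm p * KP" "KP > 0" using bounded_linear.pos_bounded[OF blP] by auto
  obtain KQ where KQ: "\<And>p. norm (Q p) \<le> norm p * KQ" "KQ > 0" using bounded_linear.pos_bounded[OF blQ] by auto
  have "continuous_on {0..1} y"
    by (rule continuous_on_vector_derivative[OF has_vector_derivative_at_within[OF y]])
  then have "bounded (y ` {0..1})" by (intro compact_imp_bounded compact_continuous_image) auto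
  then obtain M where M: "M > 0" "\<forall>p\<in>y ` {0..1}. norm p \<le> M" using bounded_pos by blast
  define R where "R = M + M * KP"
  have inR: "y r \<in> cball 0 R" "P (y r) \<in> cball 0 R" if "r \<in> {0..1}" for r
  proof -
    have m: "norm (y r) \<le> M" using M(2) that by blast
    then have "norm (P (y r)) \<le> M * KP" using KP(1)[of "y r"] KP(2) by (meson less_imp_le mult_right_mono order_trans)
    then show "y r \<in> cball 0 R" "P (y r) \<in> cball 0 R"
      using m M(1) KP(2) unfolding R_def by (auto simp: add_increasing add_increasing2)
  qed
  obtain F' where F': "\<And>p. (F has_derivative F' p) (at p)" "\<And>d. smooth_on UNIV (\<lambda>p. F' p d)"
    using smooth_on_derivatives[OF F] by (metis UNIV_I)
  obtain B where B: "B \<ge> 0" "\<And>p h. p \<in> cball 0 R \<Longrightarrow> norm (F' p h) \<le> B * norm h"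
  proof (rule derivative_bound_compact[of "cball 0 R" F'])
    show "linear (F' p)" for p by (rule has_derivative_linear[OF F'(1)])
    show "continuous_on (cball 0 R) (\<lambda>p. F' p d)" for d
      by (rule continuous_on_subset[OF smooth_on_continuous[OF F'(2)]]) simp
  qed auto
  have lip: "norm (F p - F q) \<le> B * norm (p - q)" if "p \<in> cball 0 R" "q \<in> cball 0 R" for p q
    by (rule differentiable_bound[OF convex_cball has_derivative_at_withinI[OF F'(1)] onorm_le[OF B(2)] that])
  have "Q (y 1) = 0"
  proof (rule gronwall_zero[where e = "\<lambda>r. Q (y r)" and e' = "\<lambda>r. Q (c *\<^sub>R F (y r))" and C = "\<bar>c\<bar> * B * KQ"])
    show "((\<lambda>r. Q (y r)) has_vector_derivative Q (c *\<^sub>R F (y r))) (at r)" if "r \<in> {0..1}" for r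
      by (rule bounded_linear.has_vector_derivative[OF blQ y[OF that]])
    show "norm (Q (c *\<^sub>R F (y r))) \<le> \<bar>c\<bar> * B * KQ * norm (Q (y r))" if "r \<in> {0..1}" for r
    proof -
      have "F (P (y r)) \<in> L" using P(1) L(2) by blast
      then have "Q (F (y r)) = Q (F (y r) - F (P (y r)))"
        using Q0 linear_diff[OF bounded_linear.linear[OF blQ]] by simp
      then have "norm (Q (F (y r))) \<le> norm (F (y r) - F (P (y r))) * KQ" using KQ(1) by simp
      also have "\<dots> \<le> B * norm (Q (y r)) * KQ"
        using lip[OF inR[OF that]] KQ(2) unfolding Q_def by (intro mult_right_mono) auto
      finally have "\<bar>c\<bar> * norm (Q (F (y r))) \<le> \<bar>c\<bar> * (B * norm (Q (y r)) * KQ)"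
        by (rule mult_left_mono) simp
      then show ?thesis
        by (simp add: linear_cmul[OF bounded_linear.linear[OF blQ]] mult_ac)
    qed
    show "Q (y 0) = 0" by (rule Q0[OF y0])
  qed
  then have "y 1 = P (y 1)" by (simp add: Q_def)
  then show ?thesis using P(1) by (metis rangeI subsetD)
qed

section \<open>Linearization along sections\<close>

lemma par_z_const: "q \<in> base \<Longrightarrow> par_z (\<lambda>_. c) q = 0"
  using par_base(1)[OF openin_base, of "fst q" "snd q" "\<lambda>_. c" "\<lambda>_. 0"] by simp

text \<open>This puts the jets of solutions into the part \<open>u\<^sub>z = u\<^sub>z\<^sub>z = 0\<close> of the jet manifold. Independence of \<open>z\<close> is
  assumed only within \<open>D\<close>, so the comparison with a function of \<open>t\<close> alone is made near the point.\<close>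

lemma input_par_z:
  assumes \<gamma>: "section_on D \<gamma>" and u: "\<And>z z' t. (z, t) \<in> D \<Longrightarrow> (z', t) \<in> D \<Longrightarrow> u_of (\<gamma> (z, t)) = u_of (\<gamma> (z', t))"
    and q: "q \<in> D"
  shows "par_z (u_of \<circ> \<gamma>) q = 0" "par_z (par_z (u_of \<circ> \<gamma>)) q = 0"
proof -
  note D = section_onD(1,3)[OF \<gamma>]
  have 1: "par_z (u_of \<circ> \<gamma>) q = 0" if "q \<in> D" for q
  proof -
    obtain z t where q: "q = (z, t)" by fastforce
    define D' where "D' = D \<inter> (\<lambda>p. (z, snd p)) -` D"
    have zt: "(z, t) \<in> base" using D(2) that q by auto
    have "openin (top_of_set D) D'"
      unfolding D'_def
    proof (rule continuous_openin_preimage[OF _ _ D(1)])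
      show "(\<lambda>p. (z, snd p)) \<in> D \<rightarrow> base" using D(2) zt by (auto simp: base_def)
    qed (auto intro!: continuous_intros)
    then have D': "openin (top_of_set base) D'" using D(1) openin_trans by blast
    have "par_z (u_of \<circ> \<gamma>) q = par_z (\<lambda>p. u_of (\<gamma> (z, snd p))) q"
    proof (rule par_z_cong(1)[OF D'])
      show "smooth_on D' (u_of \<circ> \<gamma>)"
        by (rule smooth_on_subset[OF section_smooth(2)[OF \<gamma>]]) (auto simp: D'_def)
      show "(u_of \<circ> \<gamma>) p = u_of (\<gamma> (z, snd p))" if "p \<in> D'" for p
        using that u[of "fst p" "snd p" z] by (simp add: D'_def)
      show "q \<in> D'" using that q by (simp add: D'_def)
    qed
    also have "\<dots> = ddz (\<lambda>_. u_of (\<gamma> (z, t))) z" by (simp add: par_z_def q)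
    also have "\<dots> = 0" using zt by (intro ddz_eq) (auto simp: base_def)
    finally show ?thesis .
  qed
  show "par_z (u_of \<circ> \<gamma>) q = 0" by (rule 1[OF q])
  have "par_z (par_z (u_of \<circ> \<gamma>)) q = par_z (\<lambda>_. 0) q"
    by (rule par_z_cong(1)[OF D(1) smooth_on_par(1)[OF D(1) section_smooth(2)[OF \<gamma>]] 1 q])
  then show "par_z (par_z (u_of \<circ> \<gamma>)) q = 0" using par_z_const[of q] q D(2) by auto
qed

definition residual :: "('n::finite) lti_system \<Rightarrow> (real \<times> real \<Rightarrow> 'n etotal) \<Rightarrow> real \<times> real \<Rightarrow> real^'n" where
  "residual S \<gamma> q = par_t (x_of \<circ> \<gamma>) q - (A_x S (fst q) *v x_of (\<gamma> q) + A_z S (fst q) *v par_z (x_of \<circ> \<gamma>) q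
     + A_zz S (fst q) *v par_z (par_z (x_of \<circ> \<gamma>)) q + u_of (\<gamma> q) *\<^sub>R B_u S (fst q))"

definition hom_residual :: "('n::finite) lti_system \<Rightarrow> (real \<times> real \<Rightarrow> real^'n) \<Rightarrow> real \<times> real \<Rightarrow> real^'n" where
  "hom_residual S w q = par_t w q - (A_x S (fst q) *v w q + A_z S (fst q) *v par_z w q
     + A_zz S (fst q) *v par_z (par_z w) q)"

text \<open>Off the submanifold of the PDE, the Lie derivative differs from zero only through the \<open>x\<^sub>t\<close>-slot of
  \<open>d\<^sub>t v\<close>: moving a jet along \<open>x\<^sub>t\<close> by minus the residual reaches the submanifold and
  changes no other term.\<close>

lemma hom_residual_section:
  fixes v :: "('n::finite) etotal \<Rightarrow> real^'n"
  assumes S: "smooth_on {0..1} (A_x S)" "smooth_on {0..1} (A_z S)" "smooth_on {0..1} (A_zz S)"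
    "smooth_on {0..1} (B_u S)"
    and v: "smooth_on E_space v" and lie: "lie_conditions S v"
    and \<gamma>: "section_on D \<gamma>" and u: "\<And>z z' t. (z, t) \<in> D \<Longrightarrow> (z', t) \<in> D \<Longrightarrow> u_of (\<gamma> (z, t)) = u_of (\<gamma> (z', t))"
    and q: "q \<in> D" and v': "(v has_derivative v') (at (\<gamma> q) within E_space)"
  shows "hom_residual S (v \<circ> \<gamma>) q = v' (0, 0, residual S \<gamma> q, 0)"
proof -
  note uz = input_par_z[OF \<gamma> u q]
  have E: "\<gamma> q \<in> E_space" by (rule section_onD(5)[OF \<gamma> q])
  define R where "R = residual S \<gamma> q"
  \<comment> \<open>the value of \<open>x\<^sub>t\<close> for which the jet satisfies the PDE\<close>
  define xt where "xt = par_t (x_of \<circ> \<gamma>) q - R"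
  define ut where "ut = par_t (u_of \<circ> \<gamma>) q"
  define j where "j = (\<gamma> q, (par_z (x_of \<circ> \<gamma>) q, xt, 0 :: real, ut))"
  define j2 where "j2 = (j, (par_z (par_z (x_of \<circ> \<gamma>)) q, 0 :: real^'n, 0 :: real^'n, 0 :: real, 0 :: real, 0 :: real))"
  have fz: "fst (\<gamma> q) = fst q"
    using arg_cong[OF section_onD(4)[OF \<gamma> q], of fst] by simp
  have J: "j2 \<in> J2" using E by (simp add: j2_def j_def J2_def J1_def)
  have "pde_lhs S \<alpha> j2 = 0" for \<alpha>
  proof -
    have "xt = A_x S (fst q) *v x_of (\<gamma> q) + A_z S (fst q) *v par_z (x_of \<circ> \<gamma>) q
     + A_zz S (fst q) *v par_z (par_z (x_of \<circ> \<gamma>)) q + u_of (\<gamma> q) *\<^sub>R B_u S (fst q)"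
      by (simp add: xt_def R_def residual_def)
    moreover have "pde_lhs S \<alpha> j2 = (xt - (A_x S (fst (\<gamma> q)) *v x_of (\<gamma> q) + A_z S (fst (\<gamma> q)) *v par_z (x_of \<circ> \<gamma>) q
     + A_zz S (fst (\<gamma> q)) *v par_z (par_z (x_of \<circ> \<gamma>)) q + u_of (\<gamma> q) *\<^sub>R B_u S (fst (\<gamma> q)))) $ \<alpha>"
      by (simp add: pde_lhs_def j2_def j_def x_of_eq u_of_eq split: prod.splits)
    ultimately show ?thesis by (simp add: fz)
  qed
  then have "j2 \<in> S2 S" using J by (simp add: S2_def j2_def j_def)
  then have "lie J2 (prolong2 v) (pde_lhs S \<alpha>) j2 = 0" for \<alpha>
    using lie by (simp add: lie_conditions_def)
  then have "(dt0 v j - (A_x S (fst q) *v v (\<gamma> q) + A_z S (fst q) *v dz0 v j + A_zz S (fst q) *v dz1 (dz0 v) j2)) $ \<alpha> = 0" for \<alpha>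
    unfolding lie_pde_lhs[OF S J] by (simp add: j2_def j_def fz)
  then have "dt0 v j - (A_x S (fst q) *v v (\<gamma> q) + A_z S (fst q) *v dz0 v j + A_zz S (fst q) *v dz1 (dz0 v) j2) = 0"
    by (simp only: vec_eq_iff zero_index) simp
  moreover have "dz0 v j = par_z (v \<circ> \<gamma>) q"
    using dz0_section[OF \<gamma> q v] by (simp add: j_def uz)
  moreover have "dz1 (dz0 v) j2 = par_z (par_z (v \<circ> \<gamma>)) q"
    using dz1_dz0_section[OF \<gamma> q v] by (simp add: j_def j2_def uz)
  moreover have "dt0 v j = par_t (v \<circ> \<gamma>) q - v' (0, 0, R, 0)"
  proof -
    have fr: "frechet_derivative v (at (\<gamma> q) within E_space) = v'"
      by (rule frechet_derivative_fat[OF fat_jets(1) E v'])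
    have "dt0 v (\<gamma> q, (0, par_t (x_of \<circ> \<gamma>) q, 0, ut)) = par_t (v \<circ> \<gamma>) q"
      using dt0_section[OF \<gamma> q v] by (simp add: ut_def)
    then have "v' (0, 1, par_t (x_of \<circ> \<gamma>) q, ut) = par_t (v \<circ> \<gamma>) q"
      by (simp add: dt0_def fr)
    moreover have "dt0 v j = v' ((0, 1, par_t (x_of \<circ> \<gamma>) q, ut) - (0, 0, R, 0))"
      by (simp add: dt0_def j_def fr xt_def)
    ultimately show ?thesis
      by (simp only: linear_diff[OF has_derivative_linear[OF v']])
  qed
  ultimately show ?thesis
    by (simp add: hom_residual_def R_def algebra_simps)
qed

lemma
  assumes v: "smooth_on E_space v" and lie: "lie_conditions S v"
    and \<gamma>: "section_on D \<gamma>"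
  shows boundary_A_section: "(0, t) \<in> D \<Longrightarrow>
      (\<And>l. l < n_A S \<Longrightarrow> G_x S l \<bullet> x_of (\<gamma> (0, t)) + G_z S l \<bullet> par_z (x_of \<circ> \<gamma>) (0, t) = 0) \<Longrightarrow> l < n_A S \<Longrightarrow>
      G_x S l \<bullet> v (\<gamma> (0, t)) + G_z S l \<bullet> par_z (v \<circ> \<gamma>) (0, t) = 0"
    and boundary_B_section: "(1, t) \<in> D \<Longrightarrow>
      (\<And>m. m < n_B S \<Longrightarrow> H_x S m \<bullet> x_of (\<gamma> (1, t)) + H_z S m \<bullet> par_z (x_of \<circ> \<gamma>) (1, t) = 0) \<Longrightarrow> m < n_B S \<Longrightarrow>
      H_x S m \<bullet> v (\<gamma> (1, t)) + H_z S m \<bullet> par_z (v \<circ> \<gamma>) (1, t) = 0"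
    and output_section: "(z_out S, t) \<in> D \<Longrightarrow>
      C_x S \<bullet> v (\<gamma> (z_out S, t)) + C_z S \<bullet> par_z (v \<circ> \<gamma>) (z_out S, t) = 0"
proof -
  define j :: "_ \<Rightarrow> 'a jet1" where "j q = (\<gamma> q, (par_z (x_of \<circ> \<gamma>) q, 0, par_z (u_of \<circ> \<gamma>) q, 0))" for q
  have J: "j q \<in> J1" if "q \<in> D" for q
    using section_onD(5)[OF \<gamma> that] by (simp add: j_def J1_def)
  have fz: "fst (fst (j q)) = fst q" if "q \<in> D" for q
    using arg_cong[OF section_onD(4)[OF \<gamma> that], of fst] by (simp add: j_def)
  have form: "jet_form a b (j q) = a \<bullet> x_of (\<gamma> q) + b \<bullet> par_z (x_of \<circ> \<gamma>) q" for a b q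
    by (simp add: jet_form_def j_def x_of_eq split: prod.splits)
  have L: "lie J1 (prolong1 v) (jet_form a b) (j q) = a \<bullet> v (\<gamma> q) + b \<bullet> par_z (v \<circ> \<gamma>) q" if "q \<in> D" for a b q
    unfolding lie_jet_form[OF J[OF that]] using dz0_section[OF \<gamma> that v] by (simp add: j_def)
  note lie' = lie[unfolded lie_conditions_def boundary_forms]
  show "G_x S l \<bullet> v (\<gamma> (0, t)) + G_z S l \<bullet> par_z (v \<circ> \<gamma>) (0, t) = 0"
    if q: "(0, t) \<in> D" and bc: "\<And>l. l < n_A S \<Longrightarrow> G_x S l \<bullet> x_of (\<gamma> (0, t)) + G_z S l \<bullet> par_z (x_of \<circ> \<gamma>) (0, t) = 0"
      and l: "l < n_A S"
  proof -
    have "j (0, t) \<in> S1A S"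
      using J[OF q] fz[OF q] bc by (simp add: S1A_def boundary_forms form)
    then have "lie J1 (prolong1 v) (jet_form (G_x S l) (G_z S l)) (j (0, t)) = 0" using lie' l by blast
    then show ?thesis by (simp only: L[OF q])
  qed
  show "H_x S m \<bullet> v (\<gamma> (1, t)) + H_z S m \<bullet> par_z (v \<circ> \<gamma>) (1, t) = 0"
    if q: "(1, t) \<in> D" and bc: "\<And>m. m < n_B S \<Longrightarrow> H_x S m \<bullet> x_of (\<gamma> (1, t)) + H_z S m \<bullet> par_z (x_of \<circ> \<gamma>) (1, t) = 0"
      and m: "m < n_B S"
  proof -
    have "j (1, t) \<in> S1B S"
      using J[OF q] fz[OF q] bc by (simp add: S1B_def boundary_forms form)
    then have "lie J1 (prolong1 v) (jet_form (H_x S m) (H_z S m)) (j (1, t)) = 0" using lie' m by blast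
    then show ?thesis by (simp only: L[OF q])
  qed
  show "C_x S \<bullet> v (\<gamma> (z_out S, t)) + C_z S \<bullet> par_z (v \<circ> \<gamma>) (z_out S, t) = 0" if q: "(z_out S, t) \<in> D"
  proof -
    have "fst (fst (j (z_out S, t))) = z_out S" using fz[OF q] by simp
    then have "lie J1 (prolong1 v) (jet_form (C_x S) (C_z S)) (j (z_out S, t)) = 0" using lie' J[OF q] by blast
    then show ?thesis by (simp only: L[OF q])
  qed
qed

lemma silent_of_lie:
  assumes S: "smooth_on {0..1} (A_x S)" "smooth_on {0..1} (A_z S)" "smooth_on {0..1} (A_zz S)"
    "smooth_on {0..1} (B_u S)" and z: "z_out S \<in> {0..1}"
    and v: "smooth_on E_space v" and lie: "lie_conditions S v" and tr: "trajectory S x0 u \<gamma>"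
  shows "silent S (v \<circ> \<gamma>)"
proof -
  note sol = trajectory_solves[OF tr] and sec = trajectory_section[OF tr]
  have pde: "hom_residual S (v \<circ> \<gamma>) (z, t) = 0" if "z \<in> {0<..<1}" "t \<ge> 0" for z t
  proof -
    have b: "(z, t) \<in> base" using that by (simp add: base_def)
    obtain v' where v': "(v has_derivative v') (at (\<gamma> (z, t)) within E_space)"
      using smooth_on_derivatives[OF v] section_onD(5)[OF sec b] by metis
    have "residual S \<gamma> (z, t) = 0"
      using solves_onD(3)[OF sol b that(1)] by (simp add: residual_def)
    then show ?thesis
      using hom_residual_section[OF S v lie sec solves_onD(2)[OF sol] b v']
        linear_0[OF has_derivative_linear[OF v']] by (simp flip: zero_prod_def)
  qed
  have "homogeneous S (v \<circ> \<gamma>)"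
    unfolding homogeneous_def
  proof (intro conjI ballI allI impI)
    show "smooth_on base (v \<circ> \<gamma>)"
      unfolding comp_def by (rule smooth_on_compose[OF v section_onD(2,5)[OF sec]])
    show "par_t (v \<circ> \<gamma>) (z, t) = A_x S z *v (v \<circ> \<gamma>) (z, t) + A_z S z *v par_z (v \<circ> \<gamma>) (z, t)
        + A_zz S z *v par_z (par_z (v \<circ> \<gamma>)) (z, t)" if "z \<in> {0<..<1}" "t \<ge> 0" for z t
      using pde[OF that] by (simp add: hom_residual_def)
    show "G_x S l \<bullet> (v \<circ> \<gamma>) (0, t) + G_z S l \<bullet> par_z (v \<circ> \<gamma>) (0, t) = 0" if "l < n_A S" "t \<ge> 0" for l t
    proof -
      have b: "(0, t) \<in> base" using that by (simp add: base_def)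
      show ?thesis
        using boundary_A_section[OF v lie sec b solves_onD(4)[OF sol b] that(1)] by simp
    qed
    show "H_x S m \<bullet> (v \<circ> \<gamma>) (1, t) + H_z S m \<bullet> par_z (v \<circ> \<gamma>) (1, t) = 0" if "m < n_B S" "t \<ge> 0" for m t
    proof -
      have b: "(1, t) \<in> base" using that by (simp add: base_def)
      show ?thesis
        using boundary_B_section[OF v lie sec b solves_onD(5)[OF sol b] that(1)] by simp
    qed
  qed
  moreover have "C_x S \<bullet> (v \<circ> \<gamma>) (z_out S, t) + C_z S \<bullet> par_z (v \<circ> \<gamma>) (z_out S, t) = 0" if "t \<ge> 0" for t
  proof -
    have "(z_out S, t) \<in> base" using that z by (simp add: base_def)
    from output_section[OF v lie sec this] show ?thesis by simp
  qed
  ultimately show ?thesis by (simp add: silent_def)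
qed

section \<open>Transforming sections by a flow\<close>

lemma flow_ofD:
  assumes "flow_of v W \<Phi>"
  shows "openin (top_of_set (UNIV \<times> E_space)) W" "smooth_on W (\<lambda>(\<epsilon>, p). \<Phi> \<epsilon> p)"
    "p \<in> E_space \<Longrightarrow> (0, p) \<in> W" "p \<in> E_space \<Longrightarrow> is_interval {\<epsilon>. (\<epsilon>, p) \<in> W}" "p \<in> E_space \<Longrightarrow> \<Phi> 0 p = p"
    "(\<epsilon>, p) \<in> W \<Longrightarrow> \<Phi> \<epsilon> p \<in> E_space"
    "(\<epsilon>, p) \<in> W \<Longrightarrow> ((\<lambda>s. \<Phi> s p) has_vector_derivative vert v (\<Phi> \<epsilon> p)) (at \<epsilon>)"
    "(\<epsilon>, p) \<in> W \<Longrightarrow> p \<in> E_space"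
proof -
  show o: "openin (top_of_set (UNIV \<times> E_space)) W"
    using assms unfolding flow_of_def by (elim conjE)
  show "p \<in> E_space" if "(\<epsilon>, p) \<in> W" using openin_subset[OF o] that by auto
qed (use assms in \<open>unfold flow_of_def, blast+\<close>)

lemma flow_segment:
  assumes fl: "flow_of v W \<Phi>" and W: "(\<epsilon>, p) \<in> W" and r: "r \<in> {0..1}"
  shows "(r * \<epsilon>, p) \<in> W"
proof -
  have p: "p \<in> E_space" by (rule flow_ofD(8)[OF fl W])
  have "convex {\<epsilon>. (\<epsilon>, p) \<in> W}" using flow_ofD(4)[OF fl p] by (simp add: is_interval_convex_1)
  from convexD[OF this, of 0 \<epsilon> "1 - r" r] show ?thesis
    using flow_ofD(3)[OF fl p] W r by simp
qed

lemma flow_vertical: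
  assumes fl: "flow_of v W \<Phi>" and W: "(s, p) \<in> W"
  shows "\<Phi> s p = (fst p, fst (snd p), x_of (\<Phi> s p), u_of p)"
proof -
  have p: "p \<in> E_space" by (rule flow_ofD(8)[OF fl W])
  let ?I = "{\<epsilon>. (\<epsilon>, p) \<in> W}"
  have conv: "convex ?I" using flow_ofD(4)[OF fl p] by (simp add: is_interval_convex_1)
  have const: "h (\<Phi> s p) = h p" if h: "bounded_linear h" "\<And>q. h (vert v q) = (0 :: real)" for h
  proof -
    have "((\<lambda>r. h (\<Phi> r p)) has_vector_derivative 0) (at r within ?I)" if "r \<in> ?I" for r
      using bounded_linear.has_vector_derivative[OF h(1) flow_ofD(7)[OF fl, of r p]] that h(2)
      by (simp add: has_vector_derivative_at_within)
    then obtain c where "\<And>r. r \<in> ?I \<Longrightarrow> h (\<Phi> r p) = c"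
      using has_vector_derivative_zero_constant[OF conv] by blast
    from this[of s] this[of 0] show ?thesis
      using W flow_ofD(3,5)[OF fl p] by simp
  qed
  have "fst (\<Phi> s p) = fst p" "fst (snd (\<Phi> s p)) = fst (snd p)" "u_of (\<Phi> s p) = u_of p"
    using const[OF bounded_linear_fst] const[OF bounded_linear_compose[OF bounded_linear_fst bounded_linear_snd]]
      const[OF bounded_linear_u_of] by (simp_all add: vert_def u_of_eq)
  then show ?thesis by (simp add: prod_eq_iff x_of_eq u_of_eq)
qed

lemma flow_u_of: "flow_of v W \<Phi> \<Longrightarrow> (s, p) \<in> W \<Longrightarrow> u_of (\<Phi> s p) = u_of p"
  using arg_cong[OF flow_vertical, of v W \<Phi> s p u_of] by (simp add: u_of_eq)

lemma flow_section:
  assumes fl: "flow_of v W \<Phi>" and \<gamma>: "section_on D \<gamma>" and W: "\<And>q. q \<in> D \<Longrightarrow> (s, \<gamma> q) \<in> W"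
  shows "section_on D (\<Phi> s \<circ> \<gamma>)"
  unfolding section_on_def
proof (intro conjI allI impI)
  show "openin (top_of_set base) D" by (rule section_onD(1)[OF \<gamma>])
  have "smooth_on D (\<lambda>q. (\<lambda>(\<epsilon>, p). \<Phi> \<epsilon> p) (s, \<gamma> q))"
    by (rule smooth_on_compose[OF flow_ofD(2)[OF fl]])
      (intro smooth_on_intros section_onD(2)[OF \<gamma>] W)+
  then show "smooth_on D (\<Phi> s \<circ> \<gamma>)" by (simp add: comp_def)
  show "(\<Phi> s \<circ> \<gamma>) (z, t) = (z, t, x_of ((\<Phi> s \<circ> \<gamma>) (z, t)), u_of ((\<Phi> s \<circ> \<gamma>) (z, t)))" if "(z, t) \<in> D" for z t
  proof -
    have "fst (\<gamma> (z, t)) = z" "fst (snd (\<gamma> (z, t))) = t"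
      using arg_cong[OF section_onD(4)[OF \<gamma> that], of fst]
        arg_cong[OF section_onD(4)[OF \<gamma> that], of "\<lambda>p. fst (snd p)"] by simp_all
    with arg_cong[OF flow_vertical[OF fl W[OF that]], of fst]
      arg_cong[OF flow_vertical[OF fl W[OF that]], of "\<lambda>p. fst (snd p)"]
    show ?thesis by (simp add: prod_eq_iff x_of_eq u_of_eq)
  qed
qed

lemma flow_domain_open:
  assumes fl: "flow_of v W \<Phi>" and \<gamma>: "section_on D \<gamma>"
  shows "openin (top_of_set (UNIV \<times> base)) {(s, q). q \<in> D \<and> (s, \<gamma> q) \<in> W}"
proof -
  have "openin (top_of_set (UNIV \<times> D)) ((UNIV \<times> D) \<inter> (\<lambda>(s, q). (s, \<gamma> q)) -` W)"
  proof (rule continuous_openin_preimage[OF _ _ flow_ofD(1)[OF fl]])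
    have "continuous_on (UNIV \<times> D) (\<lambda>p. (fst p, \<gamma> (snd p)))"
      by (intro continuous_intros continuous_on_compose2[OF smooth_on_continuous[OF section_onD(2)[OF \<gamma>]]]) auto
    then show "continuous_on (UNIV \<times> D) (\<lambda>(s, q). (s, \<gamma> q))" by (simp add: case_prod_unfold)
    show "(\<lambda>(s, q). (s, \<gamma> q)) \<in> UNIV \<times> D \<rightarrow> UNIV \<times> E_space" using section_onD(5)[OF \<gamma>] by auto
  qed
  moreover have "(UNIV \<times> D) \<inter> (\<lambda>(s, q). (s, \<gamma> q)) -` W = {(s, q). q \<in> D \<and> (s, \<gamma> q) \<in> W}" by auto
  ultimately show ?thesis
    using openin_trans[OF _ openin_UNIV_Times[OF section_onD(1)[OF \<gamma>]]] by simp
qed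

text \<open>The variational equations: the jet of the transformed section moves, as \<open>s\<close> varies, with the
  derivatives of \<open>v\<close> along the section, that is, along the prolongation of \<open>v\<close>.\<close>

lemma flow_variation:
  fixes \<gamma> :: "real \<times> real \<Rightarrow> ('n::finite) etotal"
  assumes fl: "flow_of v W \<Phi>" and v: "smooth_on E_space v" and \<gamma>: "section_on D \<gamma>"
    and q: "q \<in> D" and W: "(s, \<gamma> q) \<in> W"
  shows "((\<lambda>s. x_of (\<Phi> s (\<gamma> q))) has_vector_derivative v (\<Phi> s (\<gamma> q))) (at s)"
    "((\<lambda>s. par_z (x_of \<circ> (\<Phi> s \<circ> \<gamma>)) q) has_vector_derivative par_z (v \<circ> (\<Phi> s \<circ> \<gamma>)) q) (at s)"
    "((\<lambda>s. par_t (x_of \<circ> (\<Phi> s \<circ> \<gamma>)) q) has_vector_derivative par_t (v \<circ> (\<Phi> s \<circ> \<gamma>)) q) (at s)"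
    "((\<lambda>s. par_z (par_z (x_of \<circ> (\<Phi> s \<circ> \<gamma>))) q) has_vector_derivative par_z (par_z (v \<circ> (\<Phi> s \<circ> \<gamma>))) q) (at s)"
proof -
  define T where "T = {(s, q). q \<in> D \<and> (s, \<gamma> q) \<in> W}"
  have T: "openin (top_of_set (UNIV \<times> base)) T" unfolding T_def by (rule flow_domain_open[OF fl \<gamma>])
  define X where "X = (\<lambda>(s, q). x_of (\<Phi> s (\<gamma> q)))"
  define Y where "Y = (\<lambda>(s, q). v (\<Phi> s (\<gamma> q)))"
  have sm: "smooth_on T X"
  proof -
    have g: "smooth_on T (\<lambda>p. \<gamma> (snd p))"
      by (rule smooth_on_compose[OF section_onD(2)[OF \<gamma>] smooth_on_snd[OF smooth_on_ident]]) (auto simp: T_def)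
    have "smooth_on T (\<lambda>p. (\<lambda>(\<epsilon>, p). \<Phi> \<epsilon> p) (fst p, \<gamma> (snd p)))"
      by (rule smooth_on_compose[OF flow_ofD(2)[OF fl] smooth_on_Pair[OF smooth_on_fst[OF smooth_on_ident] g]])
        (auto simp: T_def)
    from smooth_on_linear_compose[OF bounded_linear_x_of this] show ?thesis
      by (simp add: X_def case_prod_unfold)
  qed
  have Y: "((\<lambda>s. X (s, q)) has_vector_derivative Y (s, q)) (at s)" if "(s, q) \<in> T" for s q
    using bounded_linear.has_vector_derivative[OF bounded_linear_x_of flow_ofD(7)[OF fl, of s "\<gamma> q"]] that
    by (simp add: X_def Y_def T_def vert_def x_of_eq)
  have sq: "(s, q) \<in> T" using q W by (simp add: T_def)
  show "((\<lambda>s. x_of (\<Phi> s (\<gamma> q))) has_vector_derivative v (\<Phi> s (\<gamma> q))) (at s)"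
    using Y[OF sq] by (simp add: X_def Y_def)
  show "((\<lambda>s. par_z (x_of \<circ> (\<Phi> s \<circ> \<gamma>)) q) has_vector_derivative par_z (v \<circ> (\<Phi> s \<circ> \<gamma>)) q) (at s)"
    "((\<lambda>s. par_t (x_of \<circ> (\<Phi> s \<circ> \<gamma>)) q) has_vector_derivative par_t (v \<circ> (\<Phi> s \<circ> \<gamma>)) q) (at s)"
    using family_derivative_par[OF T sm Y sq] by (simp_all add: X_def Y_def comp_def)
  define Xz where "Xz = (\<lambda>(s, q). par_z (\<lambda>q. X (s, q)) q)"
  define Yz where "Yz = (\<lambda>(s, q). par_z (\<lambda>q. Y (s, q)) q)"
  have smz: "smooth_on T Xz" unfolding Xz_def by (rule smooth_on_par_z_family[OF T sm])
  have Yz: "((\<lambda>s. Xz (s, q)) has_vector_derivative Yz (s, q)) (at s)" if "(s, q) \<in> T" for s q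
    using family_derivative_par(1)[OF T sm Y that] by (simp add: Xz_def Yz_def)
  have e: "(\<lambda>q. Xz (s, q)) = par_z (x_of \<circ> (\<Phi> s \<circ> \<gamma>))" "(\<lambda>q. Yz (s, q)) = par_z (v \<circ> (\<Phi> s \<circ> \<gamma>))" for s
    by (simp_all add: Xz_def Yz_def X_def Y_def comp_def)
  show "((\<lambda>s. par_z (par_z (x_of \<circ> (\<Phi> s \<circ> \<gamma>))) q) has_vector_derivative par_z (par_z (v \<circ> (\<Phi> s \<circ> \<gamma>))) q) (at s)"
    using family_derivative_par(1)[OF T smz Yz sq] unfolding e .
qed

lemma residual_variation:
  fixes \<gamma> :: "real \<times> real \<Rightarrow> ('n::finite) etotal"
  assumes fl: "flow_of v W \<Phi>" and v: "smooth_on E_space v" and \<gamma>: "section_on D \<gamma>"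
    and q: "q \<in> D" and W: "(s, \<gamma> q) \<in> W"
  shows "((\<lambda>s. residual S (\<Phi> s \<circ> \<gamma>) q) has_vector_derivative hom_residual S (v \<circ> (\<Phi> s \<circ> \<gamma>)) q) (at s)"
proof -
  note d = flow_variation[OF assms]
  have m: "((\<lambda>s. A *v f s) has_vector_derivative A *v f') (at s)"
    if "(f has_vector_derivative f') (at s)" for f :: "real \<Rightarrow> real^'n" and f' and A :: "real^'n^'n"
    by (rule bounded_linear.has_vector_derivative[OF matrix_vector_mul_bounded_linear that])
  have "((\<lambda>s. par_t (x_of \<circ> (\<Phi> s \<circ> \<gamma>)) q - (A_x S (fst q) *v x_of (\<Phi> s (\<gamma> q)) + A_z S (fst q) *v par_z (x_of \<circ> (\<Phi> s \<circ> \<gamma>)) q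
      + A_zz S (fst q) *v par_z (par_z (x_of \<circ> (\<Phi> s \<circ> \<gamma>))) q + u_of (\<gamma> q) *\<^sub>R B_u S (fst q)))
    has_vector_derivative par_t (v \<circ> (\<Phi> s \<circ> \<gamma>)) q - (A_x S (fst q) *v v (\<Phi> s (\<gamma> q)) + A_z S (fst q) *v par_z (v \<circ> (\<Phi> s \<circ> \<gamma>)) q
      + A_zz S (fst q) *v par_z (par_z (v \<circ> (\<Phi> s \<circ> \<gamma>))) q + 0)) (at s)"
    by (intro has_vector_derivative_diff has_vector_derivative_add m d has_vector_derivative_const)
  then have d': "((\<lambda>s. par_t (x_of \<circ> (\<Phi> s \<circ> \<gamma>)) q - (A_x S (fst q) *v x_of (\<Phi> s (\<gamma> q)) + A_z S (fst q) *v par_z (x_of \<circ> (\<Phi> s \<circ> \<gamma>)) q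
      + A_zz S (fst q) *v par_z (par_z (x_of \<circ> (\<Phi> s \<circ> \<gamma>))) q + u_of (\<gamma> q) *\<^sub>R B_u S (fst q)))
    has_vector_derivative hom_residual S (v \<circ> (\<Phi> s \<circ> \<gamma>)) q) (at s)"
    by (simp add: hom_residual_def)
  have "openin (top_of_set UNIV) (UNIV \<inter> (\<lambda>s. (s, \<gamma> q)) -` W)"
    by (rule continuous_openin_preimage[OF _ _ flow_ofD(1)[OF fl]])
      (use section_onD(5)[OF \<gamma> q] in \<open>auto intro!: continuous_intros\<close>)
  then have op: "open {s. (s, \<gamma> q) \<in> W}" by (simp add: vimage_def)
  show ?thesis
    by (rule has_vector_derivative_transform_within_open[OF d' op])
      (use W flow_u_of[OF fl] in \<open>simp_all add: residual_def\<close>)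
qed

lemma form_variation:
  assumes fl: "flow_of v W \<Phi>" and v: "smooth_on E_space v" and \<gamma>: "section_on D \<gamma>"
    and q: "q \<in> D" and W: "(s, \<gamma> q) \<in> W"
  shows "((\<lambda>s. a \<bullet> x_of (\<Phi> s (\<gamma> q)) + b \<bullet> par_z (x_of \<circ> (\<Phi> s \<circ> \<gamma>)) q) has_vector_derivative
    a \<bullet> v (\<Phi> s (\<gamma> q)) + b \<bullet> par_z (v \<circ> (\<Phi> s \<circ> \<gamma>)) q) (at s)"
  by (intro has_vector_derivative_add bounded_linear.has_vector_derivative[OF bounded_linear_inner_right]
      flow_variation[OF assms])

lemma has_vector_derivative_rescale:
  assumes "(f has_vector_derivative f') (at (r * \<epsilon>))"
  shows "((\<lambda>r. f (r * \<epsilon>)) has_vector_derivative \<epsilon> *\<^sub>R f') (at r)"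
proof -
  have "((\<lambda>r. r * \<epsilon>) has_vector_derivative \<epsilon>) (at r)" by (auto intro!: derivative_eq_intros)
  from vector_diff_chain_at[OF this assms] show ?thesis by (simp add: comp_def)
qed

text \<open>By \<open>residual_variation\<close> and \<open>hom_residual_section\<close> the residual \<open>R\<close> along the flow satisfies
  \<open>dR/ds = D\<^sub>x v (R)\<close>, a linear equation, so it stays zero.\<close>

lemma flow_solves_pde:
  fixes v :: "('n::finite) etotal \<Rightarrow> real^'n"
  assumes S: "smooth_on {0..1} (A_x S)" "smooth_on {0..1} (A_z S)" "smooth_on {0..1} (A_zz S)"
    "smooth_on {0..1} (B_u S)"
    and v: "smooth_on E_space v" and lie: "lie_conditions S v" and fl: "flow_of v W \<Phi>"
    and \<gamma>: "section_on D \<gamma>" and u: "\<And>z z' t. (z, t) \<in> D \<Longrightarrow> (z', t) \<in> D \<Longrightarrow> u_of (\<gamma> (z, t)) = u_of (\<gamma> (z', t))"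
    and W: "\<And>q. q \<in> D \<Longrightarrow> (\<epsilon>, \<gamma> q) \<in> W" and q: "q \<in> D" and R0: "residual S \<gamma> q = 0"
  shows "residual S (\<Phi> \<epsilon> \<circ> \<gamma>) q = 0"
proof -
  obtain v' where v': "\<And>p. p \<in> E_space \<Longrightarrow> (v has_derivative v' p) (at p within E_space)"
    "\<And>d. smooth_on E_space (\<lambda>p. v' p d)"
    using smooth_on_derivatives[OF v] by metis
  have Wr: "(r * \<epsilon>, \<gamma> q) \<in> W" if "r \<in> {0..1}" "q \<in> D" for r q
    by (rule flow_segment[OF fl W[OF that(2)] that(1)])
  let ?p = "\<lambda>r. \<Phi> (r * \<epsilon>) (\<gamma> q)"
  have E: "?p r \<in> E_space" if "r \<in> {0..1}" for r by (rule flow_ofD(6)[OF fl Wr[OF that q]])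
  let ?K = "?p ` {0..1}"
  have "continuous_on {0..1} ?p"
    by (rule continuous_on_vector_derivative[OF has_vector_derivative_at_within[OF
            has_vector_derivative_rescale[OF flow_ofD(7)[OF fl Wr[OF _ q]]]]])
  then have K: "compact ?K" by (rule compact_continuous_image) simp
  have KE: "?K \<subseteq> E_space" using E by auto
  obtain B where B: "B \<ge> 0" "\<And>p h. p \<in> ?K \<Longrightarrow> norm (v' p h) \<le> B * norm h"
  proof (rule derivative_bound_compact[OF K])
    show "linear (v' p)" if "p \<in> ?K" for p
      using that KE has_derivative_linear[OF v'(1)] by blast
    show "continuous_on ?K (\<lambda>p. v' p d)" for d
      by (rule continuous_on_subset[OF smooth_on_continuous[OF v'(2)] KE])
  qed blast
  have "residual S (\<Phi> (1 * \<epsilon>) \<circ> \<gamma>) q = 0"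
  proof (rule gronwall_zero[where C = "\<bar>\<epsilon>\<bar> * B"])
    show "((\<lambda>r. residual S (\<Phi> (r * \<epsilon>) \<circ> \<gamma>) q) has_vector_derivative
        \<epsilon> *\<^sub>R hom_residual S (v \<circ> (\<Phi> (r * \<epsilon>) \<circ> \<gamma>)) q) (at r)" if "r \<in> {0..1}" for r
      by (rule has_vector_derivative_rescale[OF residual_variation[OF fl v \<gamma> q Wr[OF that q]]])
    show "norm (\<epsilon> *\<^sub>R hom_residual S (v \<circ> (\<Phi> (r * \<epsilon>) \<circ> \<gamma>)) q)
        \<le> \<bar>\<epsilon>\<bar> * B * norm (residual S (\<Phi> (r * \<epsilon>) \<circ> \<gamma>) q)" if r: "r \<in> {0..1}" for r
    proof -
      have u': "u_of ((\<Phi> (r * \<epsilon>) \<circ> \<gamma>) (z, t)) = u_of ((\<Phi> (r * \<epsilon>) \<circ> \<gamma>) (z', t))"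
        if "(z, t) \<in> D" "(z', t) \<in> D" for z z' t
        unfolding comp_def flow_u_of[OF fl Wr[OF r that(1)]] flow_u_of[OF fl Wr[OF r that(2)]]
        by (rule u[OF that])
      have eq: "hom_residual S (v \<circ> (\<Phi> (r * \<epsilon>) \<circ> \<gamma>)) q = v' (?p r) (0, 0, residual S (\<Phi> (r * \<epsilon>) \<circ> \<gamma>) q, 0)"
      proof (rule hom_residual_section[where D = D and \<gamma> = "\<Phi> (r * \<epsilon>) \<circ> \<gamma>", OF S v lie _ u' q])
        show "section_on D (\<Phi> (r * \<epsilon>) \<circ> \<gamma>)" by (rule flow_section[OF fl \<gamma> Wr[OF r]])
        show "(v has_derivative v' (?p r)) (at ((\<Phi> (r * \<epsilon>) \<circ> \<gamma>) q) within E_space)"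
          using v'(1)[OF E[OF r]] by simp
      qed
      have "norm (hom_residual S (v \<circ> (\<Phi> (r * \<epsilon>) \<circ> \<gamma>)) q) \<le> B * norm (residual S (\<Phi> (r * \<epsilon>) \<circ> \<gamma>) q)"
        unfolding eq using B(2)[of "?p r" "(0, 0, residual S (\<Phi> (r * \<epsilon>) \<circ> \<gamma>) q, 0)"] r by (simp add: norm_Pair)
      from mult_left_mono[OF this, of "\<bar>\<epsilon>\<bar>"] show ?thesis by (simp add: mult.assoc)
    qed
    have "par_z (x_of \<circ> (\<Phi> 0 \<circ> \<gamma>)) p = par_z (x_of \<circ> \<gamma>) p"
      "par_t (x_of \<circ> (\<Phi> 0 \<circ> \<gamma>)) p = par_t (x_of \<circ> \<gamma>) p" if "p \<in> D" for p
      using par_z_cong[OF section_onD(1)[OF \<gamma>] section_smooth(1)[OF \<gamma>], of "x_of \<circ> (\<Phi> 0 \<circ> \<gamma>)" p] that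
        flow_ofD(5)[OF fl section_onD(5)[OF \<gamma>]] by simp_all
    moreover from this have "par_z (par_z (x_of \<circ> (\<Phi> 0 \<circ> \<gamma>))) q = par_z (par_z (x_of \<circ> \<gamma>)) q"
      using par_z_cong(1)[OF section_onD(1)[OF \<gamma>] smooth_on_par(1)[OF section_onD(1)[OF \<gamma>] section_smooth(1)[OF \<gamma>]],
          of "par_z (x_of \<circ> (\<Phi> 0 \<circ> \<gamma>))" q] q by simp
    ultimately show "residual S (\<Phi> (0 * \<epsilon>) \<circ> \<gamma>) q = 0"
      using R0 q flow_ofD(5)[OF fl section_onD(5)[OF \<gamma> q]] by (simp add: residual_def)
  qed
  then show ?thesis by simp
qed

lemma flow_input:
  assumes fl: "flow_of v W \<Phi>" and W: "\<And>q. q \<in> D \<Longrightarrow> (s, \<gamma> q) \<in> W"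
    and u: "\<And>z z' t. (z, t) \<in> D \<Longrightarrow> (z', t) \<in> D \<Longrightarrow> u_of (\<gamma> (z, t)) = u_of (\<gamma> (z', t))"
    and "(z, t) \<in> D" "(z', t) \<in> D"
  shows "u_of ((\<Phi> s \<circ> \<gamma>) (z, t)) = u_of ((\<Phi> s \<circ> \<gamma>) (z', t))"
  unfolding comp_def flow_u_of[OF fl W[OF assms(4)]] flow_u_of[OF fl W[OF assms(5)]]
  by (rule u[OF assms(4,5)])

text \<open>At a boundary point of the base, \<open>z\<close>, \<open>t\<close> and \<open>u\<close> are fixed along the flow, so \<open>(x, x\<^sub>z)\<close> moves with
  the autonomous field \<open>(v, d\<^sub>z v)\<close>, which by the Lie conditions preserves the subspace of admissible values.
  The formulation by \<open>a\<close>, \<open>b\<close> and \<open>n\<close> serves both ends.\<close>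

lemma flow_solves_boundary:
  fixes v :: "('n::finite) etotal \<Rightarrow> real^'n" and a b :: "nat \<Rightarrow> real^'n"
  assumes v: "smooth_on E_space v" and fl: "flow_of v W \<Phi>"
    and lie: "\<And>j l. j \<in> J1 \<Longrightarrow> fst (fst j) = z \<Longrightarrow> (\<And>l. l < n \<Longrightarrow> jet_form (a l) (b l) j = 0) \<Longrightarrow> l < n \<Longrightarrow>
        lie J1 (prolong1 v) (jet_form (a l) (b l)) j = 0"
    and \<gamma>: "section_on D \<gamma>" and u: "\<And>z z' t. (z, t) \<in> D \<Longrightarrow> (z', t) \<in> D \<Longrightarrow> u_of (\<gamma> (z, t)) = u_of (\<gamma> (z', t))"
    and W: "\<And>q. q \<in> D \<Longrightarrow> (\<epsilon>, \<gamma> q) \<in> W" and q: "(z, t) \<in> D"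
    and bc: "\<And>l. l < n \<Longrightarrow> a l \<bullet> x_of (\<gamma> (z, t)) + b l \<bullet> par_z (x_of \<circ> \<gamma>) (z, t) = 0" and l: "l < n"
  shows "a l \<bullet> x_of (\<Phi> \<epsilon> (\<gamma> (z, t))) + b l \<bullet> par_z (x_of \<circ> (\<Phi> \<epsilon> \<circ> \<gamma>)) (z, t) = 0"
proof -
  define c where "c = u_of (\<gamma> (z, t))"
  define j :: "(real^'n) \<times> (real^'n) \<Rightarrow> 'n jet1" where "j p = ((z, t, fst p, c), (snd p, 0, 0, 0))" for p
  define F where "F p = (v (fst (j p)), dz0 v (j p))" for p
  define y where "y r = (x_of (\<Phi> (r * \<epsilon>) (\<gamma> (z, t))), par_z (x_of \<circ> (\<Phi> (r * \<epsilon>) \<circ> \<gamma>)) (z, t))" for r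
  define L where "L = {p :: (real^'n) \<times> (real^'n). \<forall>l<n. a l \<bullet> fst p + b l \<bullet> snd p = 0}"
  have b: "(z, t) \<in> base" using section_onD(3)[OF \<gamma>] q by auto
  have J: "j p \<in> J1" "fst (j p) \<in> E_space" for p
    using b by (simp_all add: j_def J1_def E_space_iff base_def)
  have Wr: "(r * \<epsilon>, \<gamma> q) \<in> W" if "r \<in> {0..1}" "q \<in> D" for r q
    by (rule flow_segment[OF fl W[OF that(2)] that(1)])
  have smj: "smooth_on UNIV j" unfolding j_def by (intro smooth_on_intros)
  have "y 1 \<in> L"
  proof (rule invariant_subspace[where F = F and c = \<epsilon>])
    show "smooth_on UNIV F"
      unfolding F_def
      by (intro smooth_on_Pair smooth_on_compose[OF v] smooth_on_compose[OF smooth_on_dz0[OF v] smj]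
          smooth_on_fst smj J)
    show "subspace L"
    proof (rule subspaceI)
      show "0 \<in> L" by (simp add: L_def)
      show "p + p' \<in> L" if "p \<in> L" "p' \<in> L" for p p'
        unfolding L_def
      proof (clarify)
        fix l assume "l < n"
        then have "a l \<bullet> fst p + b l \<bullet> snd p = 0" "a l \<bullet> fst p' + b l \<bullet> snd p' = 0"
          using that by (auto simp: L_def)
        then show "a l \<bullet> fst (p + p') + b l \<bullet> snd (p + p') = 0" by (simp add: inner_add_right)
      qed
      show "c *\<^sub>R p \<in> L" if "p \<in> L" for c p
        using that by (simp add: L_def flip: distrib_left)
    qed
    show "F p \<in> L" if "p \<in> L" for p
    proof -
      have "jet_form (a l) (b l) (j p) = 0" if "l < n" for l
        using \<open>p \<in> L\<close> that by (simp add: jet_form_def j_def L_def)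
      then have "lie J1 (prolong1 v) (jet_form (a l) (b l)) (j p) = 0" if "l < n" for l
        using lie[OF J(1), of p l] that by (simp add: j_def)
      then show ?thesis
        by (simp add: lie_jet_form[OF J(1)] F_def L_def)
    qed
    show "(y has_vector_derivative \<epsilon> *\<^sub>R F (y r)) (at r)" if r: "r \<in> {0..1}" for r
    proof -
      let ?\<sigma> = "\<Phi> (r * \<epsilon>) \<circ> \<gamma>"
      have sec: "section_on D ?\<sigma>" by (rule flow_section[OF fl \<gamma> Wr[OF r]])
      have uz: "par_z (u_of \<circ> ?\<sigma>) (z, t) = 0"
        by (rule input_par_z(1)[OF sec flow_input[where D = D and \<gamma> = \<gamma>, OF fl Wr[OF r] u] q])
      have s: "?\<sigma> (z, t) = (z, t, x_of (?\<sigma> (z, t)), c)"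
        using section_onD(4)[OF sec q] flow_u_of[OF fl Wr[OF r q]] by (simp add: c_def)
      have "F (y r) = (v (?\<sigma> (z, t)), par_z (v \<circ> ?\<sigma>) (z, t))"
        using dz0_section[OF sec q v, of 0 0] s by (simp add: F_def j_def y_def uz)
      moreover have "(y has_vector_derivative (\<epsilon> *\<^sub>R v (?\<sigma> (z, t)), \<epsilon> *\<^sub>R par_z (v \<circ> ?\<sigma>) (z, t))) (at r)"
        unfolding y_def comp_apply[of "\<Phi> (r * \<epsilon>)" \<gamma> "(z, t)"]
        by (intro has_vector_derivative_Pair
            has_vector_derivative_rescale[OF flow_variation(1)[OF fl v \<gamma> q Wr[OF r q]]]
            has_vector_derivative_rescale[OF flow_variation(2)[OF fl v \<gamma> q Wr[OF r q]]])
      ultimately show ?thesis by simp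
    qed
    have "par_z (x_of \<circ> (\<Phi> 0 \<circ> \<gamma>)) (z, t) = par_z (x_of \<circ> \<gamma>) (z, t)"
      using par_z_cong(1)[OF section_onD(1)[OF \<gamma>] section_smooth(1)[OF \<gamma>], of "x_of \<circ> (\<Phi> 0 \<circ> \<gamma>)"] q
        flow_ofD(5)[OF fl section_onD(5)[OF \<gamma>]] by simp
    then show "y 0 \<in> L"
      using bc flow_ofD(5)[OF fl section_onD(5)[OF \<gamma> q]] by (simp add: y_def L_def)
  qed
  then show ?thesis using l by (simp add: y_def L_def)
qed

lemma flow_preserves_output:
  assumes v: "smooth_on E_space v" and lie: "lie_conditions S v" and fl: "flow_of v W \<Phi>"
    and \<gamma>: "section_on D \<gamma>" and W: "\<And>q. q \<in> D \<Longrightarrow> (\<epsilon>, \<gamma> q) \<in> W" and q: "(z_out S, t) \<in> D"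
  shows "output_of S (\<Phi> \<epsilon> \<circ> \<gamma>) t = output_of S \<gamma> t"
proof -
  have Wr: "(r * \<epsilon>, \<gamma> q) \<in> W" if "r \<in> {0..1}" "q \<in> D" for r q
    by (rule flow_segment[OF fl W[OF that(2)] that(1)])
  let ?y = "\<lambda>r. output_of S (\<Phi> (r * \<epsilon>) \<circ> \<gamma>) t"
  have "(?y has_vector_derivative 0) (at r)" if r: "r \<in> {0..1}" for r
  proof -
    have "C_x S \<bullet> v (\<Phi> (r * \<epsilon>) (\<gamma> (z_out S, t))) + C_z S \<bullet> par_z (v \<circ> (\<Phi> (r * \<epsilon>) \<circ> \<gamma>)) (z_out S, t) = 0"
      using output_section[OF v lie flow_section[OF fl \<gamma> Wr[OF r]] q] by simp
    then show ?thesis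
      using has_vector_derivative_rescale[OF form_variation[OF fl v \<gamma> q Wr[OF r q], of "C_x S" "C_z S"]]
      by (simp add: output_of_def)
  qed
  then have "(?y has_vector_derivative 0) (at r within {0..1})" if "r \<in> {0..1}" for r
    using that has_vector_derivative_at_within by blast
  then obtain c where "\<And>r. r \<in> {0..1} \<Longrightarrow> ?y r = c"
    using has_vector_derivative_zero_constant[of "{0..1::real}" ?y] by auto
  from this[of 1] this[of 0] have "output_of S (\<Phi> \<epsilon> \<circ> \<gamma>) t = output_of S (\<Phi> 0 \<circ> \<gamma>) t" by simp
  also have "\<dots> = output_of S \<gamma> t"
    using par_z_cong(1)[OF section_onD(1)[OF \<gamma>] section_smooth(1)[OF \<gamma>], of "x_of \<circ> (\<Phi> 0 \<circ> \<gamma>)"] q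
      flow_ofD(5)[OF fl section_onD(5)[OF \<gamma>]] by (simp add: output_of_def)
  finally show ?thesis .
qed

lemma symmetry_of_lie:
  fixes v :: "('n::finite) etotal \<Rightarrow> real^'n"
  assumes S: "smooth_on {0..1} (A_x S)" "smooth_on {0..1} (A_z S)" "smooth_on {0..1} (A_zz S)"
    "smooth_on {0..1} (B_u S)"
    and v: "smooth_on E_space v" and lie: "lie_conditions S v" and fl: "flow_of v W \<Phi>"
  shows "symmetry_group S W \<Phi>" "preserves_io S W \<Phi>"
proof -
  note lie' = lie[unfolded lie_conditions_def boundary_forms]
  have "solves_on S D (\<Phi> \<epsilon> \<circ> \<gamma>)"
    if D: "openin (top_of_set base) D" and sol: "solves_on S D \<gamma>" and W: "\<And>q. q \<in> D \<Longrightarrow> (\<epsilon>, \<gamma> q) \<in> W" for D \<gamma> \<epsilon>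
  proof -
    note \<gamma> = solves_on_section[OF sol D] and u = solves_onD(2)[OF sol]
    have sec: "section_on D (\<Phi> \<epsilon> \<circ> \<gamma>)" by (rule flow_section[OF fl \<gamma> W])
    have pde: "par_t (x_of \<circ> (\<Phi> \<epsilon> \<circ> \<gamma>)) (z, t) = A_x S z *v x_of ((\<Phi> \<epsilon> \<circ> \<gamma>) (z, t))
        + A_z S z *v par_z (x_of \<circ> (\<Phi> \<epsilon> \<circ> \<gamma>)) (z, t) + A_zz S z *v par_z (par_z (x_of \<circ> (\<Phi> \<epsilon> \<circ> \<gamma>))) (z, t)
        + u_of ((\<Phi> \<epsilon> \<circ> \<gamma>) (z, t)) *\<^sub>R B_u S z" if q: "(z, t) \<in> D" and z: "z \<in> {0<..<1}" for z t
    proof -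
      have "residual S \<gamma> (z, t) = 0"
        using solves_onD(3)[OF sol q z] by (simp add: residual_def)
      from flow_solves_pde[OF S v lie fl \<gamma> u W q this] show ?thesis by (simp add: residual_def)
    qed
    have A: "G_x S l \<bullet> x_of ((\<Phi> \<epsilon> \<circ> \<gamma>) (0, t)) + G_z S l \<bullet> par_z (x_of \<circ> (\<Phi> \<epsilon> \<circ> \<gamma>)) (0, t) = 0"
      if q: "(0, t) \<in> D" and l: "l < n_A S" for t l
      unfolding comp_apply[of "\<Phi> \<epsilon>" \<gamma> "(0, t)"]
      by (rule flow_solves_boundary[OF v fl _ \<gamma> u W q solves_onD(4)[OF sol q] l])
        (use lie' in \<open>auto simp: S1A_def boundary_forms\<close>)
    have B: "H_x S m \<bullet> x_of ((\<Phi> \<epsilon> \<circ> \<gamma>) (1, t)) + H_z S m \<bullet> par_z (x_of \<circ> (\<Phi> \<epsilon> \<circ> \<gamma>)) (1, t) = 0"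
      if q: "(1, t) \<in> D" and m: "m < n_B S" for t m
      unfolding comp_apply[of "\<Phi> \<epsilon>" \<gamma> "(1, t)"]
      by (rule flow_solves_boundary[OF v fl _ \<gamma> u W q solves_onD(5)[OF sol q] m])
        (use lie' in \<open>auto simp: S1B_def boundary_forms\<close>)
    show ?thesis
      unfolding solves_on_def
      using sec[unfolded section_on_def] flow_input[where D = D and \<gamma> = \<gamma>, OF fl W u] pde A B by blast
  qed
  then show "symmetry_group S W \<Phi>" unfolding symmetry_group_def by blast
  show "preserves_io S W \<Phi>"
    unfolding preserves_io_def
  proof (intro allI impI conjI ballI)
    fix D \<gamma> \<epsilon>
    assume D: "openin (top_of_set base) D" and sol: "solves_on S D \<gamma>" and W: "\<forall>q\<in>D. (\<epsilon>, \<gamma> q) \<in> W"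
    show "u_of (\<Phi> \<epsilon> (\<gamma> q)) = u_of (\<gamma> q)" if "q \<in> D" for q
      using flow_u_of[OF fl] W that by blast
    show "output_of S (\<Phi> \<epsilon> \<circ> \<gamma>) t = output_of S \<gamma> t" if "(z_out S, t) \<in> D" for t
      by (rule flow_preserves_output[OF v lie fl solves_on_section[OF sol D] _ that]) (use W in blast)
  qed
qed

section \<open>From symmetries back to silent solutions\<close>

lemma solves_on_subset:
  assumes "solves_on S D \<gamma>" "D' \<subseteq> D" shows "solves_on S D' \<gamma>"
  using assms smooth_on_subset[of D \<gamma> D'] unfolding solves_on_def by blast

lemma derivative_of_locally_constant:
  assumes "(f has_vector_derivative d) (at 0)" "open N" "(0::real) \<in> N" "\<And>s. s \<in> N \<Longrightarrow> f s = k"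
  shows "d = 0"
proof -
  have "((\<lambda>_. k) has_vector_derivative d) (at 0)"
    by (rule has_vector_derivative_transform_within_open[OF assms(1-4)])
  then show ?thesis using vector_derivative_unique_at[OF _ has_vector_derivative_const] by blast
qed

text \<open>Near each point of the base the transformed section solves the system for all small parameters.
  Differentiating at parameter zero needs no parameter interval common to the whole base.\<close>

lemma silent_of_symmetry:
  fixes v :: "('n::finite) etotal \<Rightarrow> real^'n"
  assumes z: "z_out S \<in> {0..1}"
    and v: "smooth_on E_space v" and fl: "flow_of v W \<Phi>"
    and sym: "symmetry_group S W \<Phi>" and io: "preserves_io S W \<Phi>" and tr: "trajectory S x0 u \<gamma>"
  shows "silent S (v \<circ> \<gamma>)"
proof -
  note sol = trajectory_solves[OF tr] and sec = trajectory_section[OF tr]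
  have local: "\<exists>N D. open N \<and> 0 \<in> N \<and> openin (top_of_set base) D \<and> q \<in> D \<and> (\<forall>s\<in>N. \<forall>p\<in>D. (s, \<gamma> p) \<in> W)"
    if q: "q \<in> base" for q
  proof -
    have "(0, q) \<in> {(s, q). q \<in> base \<and> (s, \<gamma> q) \<in> W}"
      using q flow_ofD(3)[OF fl section_onD(5)[OF sec q]] by simp
    from Times_in_interior_subtopology[OF this flow_domain_open[OF fl sec]]
    obtain N D where ND: "openin (top_of_set UNIV) N" "0 \<in> N" "openin (top_of_set base) D" "q \<in> D"
      "N \<times> D \<subseteq> {(s, q). q \<in> base \<and> (s, \<gamma> q) \<in> W}"
      by blast
    have "open N" using ND(1) by simp
    moreover have "\<forall>s\<in>N. \<forall>p\<in>D. (s, \<gamma> p) \<in> W" using ND(5) by auto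
    ultimately show ?thesis using ND(2-4) by blast
  qed
  have solN: "solves_on S D (\<Phi> s \<circ> \<gamma>)"
    if "openin (top_of_set base) D" "\<forall>p\<in>D. (s, \<gamma> p) \<in> W" for s D
    using sym that solves_on_subset[OF sol openin_imp_subset[OF that(1)]] unfolding symmetry_group_def by blast
  have W0: "(0, \<gamma> q) \<in> W" if "q \<in> base" for q using flow_ofD(3)[OF fl section_onD(5)[OF sec that]] .
  define w where "w = v \<circ> \<gamma>"
  have smw: "smooth_on base w"
    unfolding w_def comp_def by (rule smooth_on_compose[OF v section_onD(2,5)[OF sec]])
  have id: "w q = (v \<circ> (\<Phi> 0 \<circ> \<gamma>)) q" if "q \<in> base" for q
    using flow_ofD(5)[OF fl section_onD(5)[OF sec that]] by (simp add: w_def)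
  have pid: "par_z w q = par_z (v \<circ> (\<Phi> 0 \<circ> \<gamma>)) q" "par_t w q = par_t (v \<circ> (\<Phi> 0 \<circ> \<gamma>)) q" if "q \<in> base" for q
    using par_z_cong[where w' = "v \<circ> (\<Phi> 0 \<circ> \<gamma>)", OF openin_base smw id that] by auto
  have pzid: "par_z (par_z w) q = par_z (par_z (v \<circ> (\<Phi> 0 \<circ> \<gamma>))) q" if "q \<in> base" for q
    by (rule par_z_cong(1)[OF openin_base smooth_on_par(1)[OF openin_base smw] pid(1) that])
  have form: "a \<bullet> w q + b \<bullet> par_z w q = 0"
    if q: "q \<in> base" and const: "\<And>D s. openin (top_of_set base) D \<Longrightarrow> q \<in> D \<Longrightarrow> \<forall>p\<in>D. (s, \<gamma> p) \<in> W \<Longrightarrow>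
      a \<bullet> x_of (\<Phi> s (\<gamma> q)) + b \<bullet> par_z (x_of \<circ> (\<Phi> s \<circ> \<gamma>)) q = k" for q a b k
  proof -
    obtain N D where ND: "open N" "0 \<in> N" "openin (top_of_set base) D" "q \<in> D" "\<forall>s\<in>N. \<forall>p\<in>D. (s, \<gamma> p) \<in> W"
      using local[OF q] by blast
    have "a \<bullet> v (\<Phi> 0 (\<gamma> q)) + b \<bullet> par_z (v \<circ> (\<Phi> 0 \<circ> \<gamma>)) q = 0"
      by (rule derivative_of_locally_constant[OF form_variation[OF fl v sec q W0[OF q]] ND(1,2)])
        (use const[OF ND(3,4)] ND(5) in blast)
    then show ?thesis using id[OF q] pid(1)[OF q] by simp
  qed
  have pde: "par_t w (z, t) = A_x S z *v w (z, t) + A_z S z *v par_z w (z, t) + A_zz S z *v par_z (par_z w) (z, t)"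
    if "z \<in> {0<..<1}" "t \<ge> 0" for z t
  proof -
    have b: "(z, t) \<in> base" using that by (simp add: base_def)
    obtain N D where ND: "open N" "0 \<in> N" "openin (top_of_set base) D" "(z, t) \<in> D" "\<forall>s\<in>N. \<forall>p\<in>D. (s, \<gamma> p) \<in> W"
      using local[OF b] by blast
    have "residual S (\<Phi> s \<circ> \<gamma>) (z, t) = 0" if "s \<in> N" for s
      using solves_onD(3)[OF solN[OF ND(3), of s] ND(4) \<open>z \<in> {0<..<1}\<close>] ND(5) that by (simp add: residual_def)
    then have "hom_residual S (v \<circ> (\<Phi> 0 \<circ> \<gamma>)) (z, t) = 0"
      by (rule derivative_of_locally_constant[OF residual_variation[OF fl v sec b W0[OF b]] ND(1,2)])
    then show ?thesis using id[OF b] pid[OF b] pzid[OF b] by (simp add: hom_residual_def)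
  qed
  have A: "G_x S l \<bullet> w (0, t) + G_z S l \<bullet> par_z w (0, t) = 0" if "l < n_A S" "t \<ge> 0" for l t
  proof (rule form)
    show "(0, t) \<in> base" using that by (simp add: base_def)
    show "G_x S l \<bullet> x_of (\<Phi> s (\<gamma> (0, t))) + G_z S l \<bullet> par_z (x_of \<circ> (\<Phi> s \<circ> \<gamma>)) (0, t) = 0"
      if "openin (top_of_set base) D" "(0, t) \<in> D" "\<forall>p\<in>D. (s, \<gamma> p) \<in> W" for D s
      using solves_onD(4)[OF solN[OF that(1,3)] that(2) \<open>l < n_A S\<close>] by simp
  qed
  have B: "H_x S m \<bullet> w (1, t) + H_z S m \<bullet> par_z w (1, t) = 0" if "m < n_B S" "t \<ge> 0" for m t
  proof (rule form)
    show "(1, t) \<in> base" using that by (simp add: base_def)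
    show "H_x S m \<bullet> x_of (\<Phi> s (\<gamma> (1, t))) + H_z S m \<bullet> par_z (x_of \<circ> (\<Phi> s \<circ> \<gamma>)) (1, t) = 0"
      if "openin (top_of_set base) D" "(1, t) \<in> D" "\<forall>p\<in>D. (s, \<gamma> p) \<in> W" for D s
      using solves_onD(5)[OF solN[OF that(1,3)] that(2) \<open>m < n_B S\<close>] by simp
  qed
  have C: "C_x S \<bullet> w (z_out S, t) + C_z S \<bullet> par_z w (z_out S, t) = 0" if "t \<ge> 0" for t
  proof (rule form)
    show "(z_out S, t) \<in> base" using that z by (simp add: base_def)
    show "C_x S \<bullet> x_of (\<Phi> s (\<gamma> (z_out S, t))) + C_z S \<bullet> par_z (x_of \<circ> (\<Phi> s \<circ> \<gamma>)) (z_out S, t) = output_of S \<gamma> t"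
      if D: "openin (top_of_set base) D" "(z_out S, t) \<in> D" "\<forall>p\<in>D. (s, \<gamma> p) \<in> W" for D s
    proof -
      have "output_of S (\<Phi> s \<circ> \<gamma>) t = output_of S \<gamma> t"
        using io D solves_on_subset[OF sol openin_imp_subset[OF D(1)]] unfolding preserves_io_def by blast
      then show ?thesis by (simp add: output_of_def)
    qed
  qed
  show ?thesis
    unfolding silent_def homogeneous_def w_def[symmetric]
    by (intro conjI ballI allI impI smw pde A B C)
qed

section \<open>Fields that depend on the base only\<close>

lemma lie_conditions_base_field:
  fixes S :: "('n::finite) lti_system"
  assumes S: "smooth_on {0..1} (A_x S)" "smooth_on {0..1} (A_z S)" "smooth_on {0..1} (A_zz S)"
    "smooth_on {0..1} (B_u S)" and z: "z_out S \<in> {0..1}" and w: "smooth_on base w"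
  shows "lie_conditions S (base_field w) \<longleftrightarrow>
           (\<forall>z\<in>{0..1}. \<forall>t\<ge>0. par_t w (z, t) =
              A_x S z *v w (z, t) + A_z S z *v par_z w (z, t) + A_zz S z *v par_z (par_z w) (z, t)) \<and>
           (\<forall>l<n_A S. \<forall>t\<ge>0. G_x S l \<bullet> w (0, t) + G_z S l \<bullet> par_z w (0, t) = 0) \<and>
           (\<forall>m<n_B S. \<forall>t\<ge>0. H_x S m \<bullet> w (1, t) + H_z S m \<bullet> par_z w (1, t) = 0) \<and>
           (\<forall>t\<ge>0. C_x S \<bullet> w (z_out S, t) + C_z S \<bullet> par_z w (z_out S, t) = 0)"
proof -
  have pde: "lie J2 (prolong2 (base_field w)) (pde_lhs S \<alpha>) p =
      hom_residual S w (fst (fst (fst p)), fst (snd (fst (fst p)))) $ \<alpha>" if "p \<in> J2" for p \<alpha>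
  proof -
    have E: "fst (fst p) \<in> E_space" using that by (auto simp: J2_def J1_def)
    show ?thesis
      unfolding lie_pde_lhs[OF S that] hom_residual_def
      using dz0_base_field[OF w E, of "snd (fst p)"] dt0_base_field[OF w E, of "snd (fst p)"]
        dz1_dz0_base_field[OF w E, of "snd (fst p)" "snd p"]
      by (simp add: base_field_eq)
  qed
  have form: "lie J1 (prolong1 (base_field w)) (jet_form a b) j =
      a \<bullet> w (fst (fst j), fst (snd (fst j))) + b \<bullet> par_z w (fst (fst j), fst (snd (fst j)))" if "j \<in> J1" for a b j
  proof -
    have E: "fst j \<in> E_space" using that by (auto simp: J1_def)
    show ?thesis
      unfolding lie_jet_form[OF that] using dz0_base_field[OF w E, of "snd j"] by (simp add: base_field_eq)
  qed
  have j0: "((z, t, 0, 0), (0, 0, 0, 0)) \<in> J1" if "z \<in> {0..1}" "t \<ge> 0" for z t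
    using that by (simp add: J1_def E_space_def)
  have J1D: "fst (fst j) \<in> {0..1}" "fst (snd (fst j)) \<ge> 0" if "j \<in> J1" for j :: "'n jet1"
    using that by (auto simp: J1_def E_space_def)
  have 1: "(\<forall>\<alpha>. \<forall>p\<in>S2 S. lie J2 (prolong2 (base_field w)) (pde_lhs S \<alpha>) p = 0) \<longleftrightarrow>
      (\<forall>z\<in>{0..1}. \<forall>t\<ge>0. hom_residual S w (z, t) = 0)" (is "?L \<longleftrightarrow> ?R")
  proof
    assume ?L
    show ?R
    proof (intro ballI allI impI)
      fix z t :: real assume zt: "z \<in> {0..1}" "t \<ge> 0"
      \<comment> \<open>\<open>S2\<close> has a point over every point of the base: the zero jet with zero input\<close>
      let ?p = "(((z, t, 0, 0), (0, 0, 0, 0)), (0, 0, 0, 0, 0, 0)) :: 'n jet2"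
      have p: "?p \<in> J2" using j0[OF zt] by (simp add: J2_def)
      then have "?p \<in> S2 S" by (simp add: S2_def pde_lhs_def)
      then have "hom_residual S w (z, t) $ \<alpha> = 0" for \<alpha>
        using \<open>?L\<close> pde[OF p, of \<alpha>] by simp
      then show "hom_residual S w (z, t) = 0" by (simp add: vec_eq_iff)
    qed
  next
    assume R: ?R
    show ?L
    proof (intro allI ballI)
      fix \<alpha> and p :: "'n jet2" assume "p \<in> S2 S"
      then have p: "p \<in> J2" by (simp add: S2_def)
      then have "fst p \<in> J1" by (auto simp: J2_def)
      with R show "lie J2 (prolong2 (base_field w)) (pde_lhs S \<alpha>) p = 0"
        unfolding pde[OF p] using J1D[of "fst p"] by simp
    qed
  qed
  have boundary: "(\<forall>l<n. \<forall>j\<in>{j \<in> J1. fst (fst j) = z \<and> (\<forall>l<n. jet_form (a l) (b l) j = 0)}.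
        lie J1 (prolong1 (base_field w)) (jet_form (a l) (b l)) j = 0) \<longleftrightarrow>
      (\<forall>l<n. \<forall>t\<ge>0. a l \<bullet> w (z, t) + b l \<bullet> par_z w (z, t) = 0)" (is "?L \<longleftrightarrow> ?R")
    if z: "z \<in> {0..1}" for z n and a b :: "nat \<Rightarrow> real^'n"
  proof
    assume L: ?L
    show ?R
    proof (intro allI impI)
      fix l t assume l: "l < n" and t: "(0 :: real) \<le> t"
      let ?j = "((z, t, 0, 0), (0, 0, 0, 0)) :: 'n jet1"
      have "?j \<in> {j \<in> J1. fst (fst j) = z \<and> (\<forall>l<n. jet_form (a l) (b l) j = 0)}"
        using j0[OF z t] by (simp add: jet_form_def)
      with L l have "lie J1 (prolong1 (base_field w)) (jet_form (a l) (b l)) ?j = 0" by blast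
      then show "a l \<bullet> w (z, t) + b l \<bullet> par_z w (z, t) = 0" using form[OF j0[OF z t]] by simp
    qed
  next
    assume R: ?R
    show ?L
    proof (intro allI impI ballI)
      fix l j assume l: "l < n" and "j \<in> {j \<in> J1. fst (fst j) = z \<and> (\<forall>l<n. jet_form (a l) (b l) j = 0)}"
      then have j: "j \<in> J1" "fst (fst j) = z" by auto
      show "lie J1 (prolong1 (base_field w)) (jet_form (a l) (b l)) j = 0"
        unfolding form[OF j(1)] j(2) using R l J1D(2)[OF j(1)] by blast
    qed
  qed
  have C: "(\<forall>p\<in>J1. fst (fst p) = z_out S \<longrightarrow> lie J1 (prolong1 (base_field w)) (jet_form (C_x S) (C_z S)) p = 0) \<longleftrightarrow>
      (\<forall>t\<ge>0. C_x S \<bullet> w (z_out S, t) + C_z S \<bullet> par_z w (z_out S, t) = 0)" (is "?L \<longleftrightarrow> ?R")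
  proof
    assume L: ?L
    show ?R
    proof (intro allI impI)
      fix t :: real assume t: "0 \<le> t"
      have "lie J1 (prolong1 (base_field w)) (jet_form (C_x S) (C_z S)) ((z_out S, t, 0, 0), (0, 0, 0, 0)) = 0"
        by (rule L[rule_format, OF j0[OF z t]]) simp
      then show "C_x S \<bullet> w (z_out S, t) + C_z S \<bullet> par_z w (z_out S, t) = 0" using form[OF j0[OF z t]] by simp
    qed
  next
    assume R: ?R
    show ?L
    proof (intro ballI impI)
      fix j :: "'n jet1" assume j: "j \<in> J1" "fst (fst j) = z_out S"
      show "lie J1 (prolong1 (base_field w)) (jet_form (C_x S) (C_z S)) j = 0"
        unfolding form[OF j(1)] j(2) using R J1D(2)[OF j(1)] by blast
    qed
  qed
  have ends: "(0 :: real) \<in> {0..1}" "(1 :: real) \<in> {0..1}" by simp_all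
  show ?thesis
    unfolding lie_conditions_def S1A_def S1B_def boundary_forms 1 C
      boundary[OF ends(1), of "n_A S" "G_x S" "G_z S"] boundary[OF ends(2), of "n_B S" "H_x S" "H_z S"]
    by (simp add: hom_residual_def)
qed

lemma base_field_flow:
  fixes w :: "real \<times> real \<Rightarrow> real^('n::finite)"
  assumes w: "smooth_on base w"
  shows "flow_of (base_field w) (UNIV \<times> E_space) (\<lambda>\<epsilon> p. p + \<epsilon> *\<^sub>R vert (base_field w) p)"
  unfolding flow_of_def
proof (intro conjI ballI allI impI)
  show "openin (top_of_set (UNIV \<times> E_space)) (UNIV \<times> (E_space :: 'n etotal set))" by simp
  show "is_interval {\<epsilon> :: real. (\<epsilon>, p) \<in> UNIV \<times> E_space}" if "p \<in> E_space" for p :: "'n etotal"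
    using that by simp
  have "smooth_on E_space (vert (base_field w))"
    unfolding vert_def by (intro smooth_on_Pair smooth_on_const smooth_on_base_field[OF w])
  then have "smooth_on (UNIV \<times> E_space) (\<lambda>p :: real \<times> 'n etotal. vert (base_field w) (snd p))"
    by (rule smooth_on_compose) (auto intro: smooth_on_snd smooth_on_ident)
  then have "smooth_on (UNIV \<times> E_space) (\<lambda>p :: real \<times> 'n etotal. snd p + fst p *\<^sub>R vert (base_field w) (snd p))"
    by (intro smooth_on_add smooth_on_bilinear[OF bounded_bilinear_scaleR] smooth_on_fst smooth_on_snd smooth_on_ident)
  then show "smooth_on (UNIV \<times> E_space) (\<lambda>(\<epsilon>, p :: 'n etotal). p + \<epsilon> *\<^sub>R vert (base_field w) p)"
    by (simp add: case_prod_unfold)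
  have inv: "vert (base_field w) (p + \<epsilon> *\<^sub>R vert (base_field w) p) = vert (base_field w) p" for \<epsilon> and p :: "'n etotal"
    by (simp add: vert_def base_field_eq)
  show "p + \<delta> *\<^sub>R vert (base_field w) p + \<epsilon> *\<^sub>R vert (base_field w) (p + \<delta> *\<^sub>R vert (base_field w) p) =
      p + (\<epsilon> + \<delta>) *\<^sub>R vert (base_field w) p" for \<delta> \<epsilon> and p :: "'n etotal"
    unfolding inv by (simp add: scaleR_add_left)
  show "case x of (\<epsilon>, p) \<Rightarrow> p + \<epsilon> *\<^sub>R vert (base_field w) p \<in> E_space \<and>
      ((\<lambda>s. p + s *\<^sub>R vert (base_field w) p) has_vector_derivative
        vert (base_field w) (p + \<epsilon> *\<^sub>R vert (base_field w) p)) (at \<epsilon>)"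
    if "x \<in> UNIV \<times> E_space" for x :: "real \<times> 'n etotal"
  proof -
    obtain \<epsilon> p where x: "x = (\<epsilon>, p)" by (cases x)
    have "p + \<epsilon> *\<^sub>R vert (base_field w) p \<in> E_space"
      using that x by (simp add: E_space_iff vert_def)
    moreover have "((\<lambda>s. p + s *\<^sub>R vert (base_field w) p) has_vector_derivative vert (base_field w) p) (at \<epsilon>)"
      by (auto intro!: derivative_eq_intros)
    ultimately show ?thesis by (simp add: x inv)
  qed
qed auto

lemma starts_nontrivially_base_field:
  "starts_nontrivially (base_field w) \<longleftrightarrow> (\<exists>z\<in>{0..1}. w (z, 0) \<noteq> 0)"
  by (simp add: starts_nontrivially_def base_field_def)

section \<open>The equivalences\<close>

theorem mainTheorem3:
  fixes S :: "('n::finite) lti_system"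
  assumes "smooth_on {0..1} (A_x S)" and "smooth_on {0..1} (A_z S)"
    and "smooth_on {0..1} (A_zz S)" and "smooth_on {0..1} (B_u S)"
    and "z_out S \<in> {0..1}"
    \<comment> \<open>The boundary functions are linear; the rows of their (constant) Jacobians have rank \<open>n_A\<close>, \<open>n_B\<close>.\<close>
    and "dim ((\<lambda>l. (G_x S l, G_z S l)) ` {..<n_A S}) = n_A S"
    and "dim ((\<lambda>m. (H_x S m, H_z S m)) ` {..<n_B S}) = n_B S"
    and "well_posed S"
  shows
    "(\<not> observable S \<longleftrightarrow>
        (\<exists>v. smooth_on E_space v \<and> starts_nontrivially v \<and> lie_conditions S v)) \<and>
     (\<forall>v W \<Phi>. smooth_on E_space v \<longrightarrow> lie_conditions S v \<longrightarrow> flow_of v W \<Phi> \<longrightarrow>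
        symmetry_group S W \<Phi> \<and> preserves_io S W \<Phi>) \<and>
     (\<not> observable S \<longleftrightarrow>
        (\<exists>v W \<Phi>. smooth_on E_space v \<and> starts_nontrivially v \<and> lie_conditions S v \<and>
           flow_of v W \<Phi> \<and> symmetry_group S W \<Phi> \<and> preserves_io S W \<Phi>)) \<and>
     (\<not> observable S \<longleftrightarrow>
        (\<exists>v W \<Phi>. smooth_on E_space v \<and> starts_nontrivially v \<and>
           flow_of v W \<Phi> \<and> symmetry_group S W \<Phi> \<and> preserves_io S W \<Phi>)) \<and>
     (\<not> observable S \<longleftrightarrow>
        (\<exists>w. smooth_on base w \<and> starts_nontrivially (base_field w) \<and> lie_conditions S (base_field w))) \<and>
     (\<forall>w. smooth_on base w \<longrightarrow>
        (lie_conditions S (base_field w) \<longleftrightarrow>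
           (\<forall>z\<in>{0..1}. \<forall>t\<ge>0. par_t w (z, t) =
              A_x S z *v w (z, t) + A_z S z *v par_z w (z, t) + A_zz S z *v par_z (par_z w) (z, t)) \<and>
           (\<forall>l<n_A S. \<forall>t\<ge>0. G_x S l \<bullet> w (0, t) + G_z S l \<bullet> par_z w (0, t) = 0) \<and>
           (\<forall>m<n_B S. \<forall>t\<ge>0. H_x S m \<bullet> w (1, t) + H_z S m \<bullet> par_z w (1, t) = 0) \<and>
           (\<forall>t\<ge>0. C_x S \<bullet> w (z_out S, t) + C_z S \<bullet> par_z w (z_out S, t) = 0)))"
proof -
  note S = assms(1-4) and z = assms(5) and wp = assms(8)
  have base: "\<exists>w. smooth_on base w \<and> starts_nontrivially (base_field w) \<and> lie_conditions S (base_field w)"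
    if "\<not> observable S"
  proof -
    obtain w where w: "silent S w" "\<exists>z\<in>{0..1}. w (z, 0) \<noteq> 0"
      using \<open>\<not> observable S\<close> not_observable_iff[OF wp z] by blast
    have hom: "homogeneous S w" using w(1) by (simp add: silent_def)
    then have sm: "smooth_on base w" by (simp add: homogeneous_def)
    have "lie_conditions S (base_field w)"
      unfolding lie_conditions_base_field[OF S z sm]
      using homogeneous_closed[OF S(1-3) hom] w(1) unfolding silent_def homogeneous_def by blast
    then show ?thesis using sm w(2) starts_nontrivially_base_field by blast
  qed
  have flow: "\<exists>v W \<Phi>. smooth_on E_space v \<and> starts_nontrivially v \<and> lie_conditions S v \<and>
      flow_of v W \<Phi> \<and> symmetry_group S W \<Phi> \<and> preserves_io S W \<Phi>" if "\<not> observable S"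
  proof -
    obtain w where w: "smooth_on base w" "starts_nontrivially (base_field w)" "lie_conditions S (base_field w)"
      using base \<open>\<not> observable S\<close> by blast
    note fl = base_field_flow[OF w(1)] and sm = smooth_on_base_field[OF w(1)]
    show ?thesis
      using sm w(2,3) fl symmetry_of_lie[OF S sm w(3) fl] by blast
  qed
  have from_lie: "\<not> observable S" if v: "smooth_on E_space v" "starts_nontrivially v" and lie: "lie_conditions S v" for v
  proof -
    obtain x0 \<gamma> z1 where tr: "trajectory S x0 (\<lambda>_. 0) \<gamma>" "z1 \<in> {0..1}" "v (\<gamma> (z1, 0)) \<noteq> 0"
      by (rule trajectory_through[OF wp v])
    have "silent S (v \<circ> \<gamma>)" by (rule silent_of_lie[OF S z v(1) lie tr(1)])
    moreover have "\<exists>z\<in>{0..1}. (v \<circ> \<gamma>) (z, 0) \<noteq> 0" using tr(2,3) by auto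
    ultimately show ?thesis using not_observable_iff[OF wp z] by blast
  qed
  have from_symmetry: "\<not> observable S" if v: "smooth_on E_space v" "starts_nontrivially v"
    and fl: "flow_of v W \<Phi>" "symmetry_group S W \<Phi>" "preserves_io S W \<Phi>" for v W \<Phi>
  proof -
    obtain x0 \<gamma> z1 where tr: "trajectory S x0 (\<lambda>_. 0) \<gamma>" "z1 \<in> {0..1}" "v (\<gamma> (z1, 0)) \<noteq> 0"
      by (rule trajectory_through[OF wp v])
    have "silent S (v \<circ> \<gamma>)" by (rule silent_of_symmetry[OF z v(1) fl tr(1)])
    moreover have "\<exists>z\<in>{0..1}. (v \<circ> \<gamma>) (z, 0) \<noteq> 0" using tr(2,3) by auto
    ultimately show ?thesis using not_observable_iff[OF wp z] by blast
  qed
  show ?thesis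
  proof (intro conjI)
    show "\<not> observable S \<longleftrightarrow> (\<exists>v. smooth_on E_space v \<and> starts_nontrivially v \<and> lie_conditions S v)"
      using flow from_lie by blast
    show "\<forall>v W \<Phi>. smooth_on E_space v \<longrightarrow> lie_conditions S v \<longrightarrow> flow_of v W \<Phi> \<longrightarrow>
        symmetry_group S W \<Phi> \<and> preserves_io S W \<Phi>"
      using symmetry_of_lie[OF S] by blast
    show "\<not> observable S \<longleftrightarrow>
        (\<exists>v W \<Phi>. smooth_on E_space v \<and> starts_nontrivially v \<and> lie_conditions S v \<and>
           flow_of v W \<Phi> \<and> symmetry_group S W \<Phi> \<and> preserves_io S W \<Phi>)"
      using flow from_lie by blast
    show "\<not> observable S \<longleftrightarrow>
        (\<exists>v W \<Phi>. smooth_on E_space v \<and> starts_nontrivially v \<and>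
           flow_of v W \<Phi> \<and> symmetry_group S W \<Phi> \<and> preserves_io S W \<Phi>)"
      using flow from_symmetry by blast
    show "\<not> observable S \<longleftrightarrow>
        (\<exists>w. smooth_on base w \<and> starts_nontrivially (base_field w) \<and> lie_conditions S (base_field w))"
      using base from_lie smooth_on_base_field by blast
  qed (use lie_conditions_base_field[OF S z] in blast)
qed

end
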